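(* The sequence $\{m_0(n)\}_{n=1}^\infty$ is monotonically increasing, i.e. $m_0(n)\le m_0(n+1)$ for all $n\in\mathbb{N}$. In other words, for all $n,m\in\mathbb{N}$, if $D_{n,m}$ is not a Lu Qi-Keng domain, then $D_{n+1,m}$ is not a Lu Qi-Keng domain.
   Context: $\mathbb{N}=\{1,2,3,\dots\}$ and $\|\cdot\|$ is the standard Euclidean (Hermitian) norm. Fix a real number $\mu>0$. For $n,m\in\mathbb{N}$, set $$D_{n,m}=\{(z,\zeta)\in\mathbb{C}^n\times\mathbb{C}^m : \|\zeta\|^2<e^{-\mu\|z\|^2}\}.$$ For a domain $\Omega\subset\mathbb{C}^N$, the Bergman kernel $K_\Omega(z,w)$, $z,w\in\Omega$, is the reproducing kernel of the Hilbert space of holomorphic functions on $\Omega$ that are square integrable with respect to Lebesgue measure. $\Omega$ is called a Lu Qi-Keng domain if $K_\Omega$ has no zeros on $\Omega\times\Omega$. For each $n\in\mathbb{N}$, $m_0(n)$ denotes the unique element of $\mathbb{N}$ such that, for every $m\in\mathbb{N}$, $D_{n,m}$ is a Lu Qi-Keng domain if and only if $m\ge m_0(n)$ (such a number exists for every $n$). *)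

theory Defs
  imports "HOL-Complex_Analysis.Complex_Analysis" "HOL-Probability.Probability"
begin

text \<open>
  The dimension varies inside the statement, so a point of \<open>\<complex>\<^sup>N\<close> is a function
  \<open>nat \<Rightarrow> complex\<close> that is \<open>undefined\<close> outside \<open>{..<N}\<close>.
\<close>

definition Cspace :: "nat \<Rightarrow> (nat \<Rightarrow> complex) set" where
  "Cspace N = ({..<N} \<rightarrow>\<^sub>E UNIV)"

definition Cnorm :: "nat \<Rightarrow> (nat \<Rightarrow> complex) \<Rightarrow> real" where
  "Cnorm N x = L2_set (\<lambda>i. cmod (x i)) {..<N}"

definition Cmeasure :: "nat \<Rightarrow> (nat \<Rightarrow> complex) measure" where
  "Cmeasure N = PiM {..<N} (\<lambda>_. lborel)"

text \<open>
  Holomorphy on an open \<open>\<Omega> \<subseteq> Cspace N\<close>: complex Frechet differentiability at every point,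
  with complex-linear differential \<open>h \<mapsto> (\<Sum>i<N. a i * h i)\<close>.
\<close>

definition holomorphic_C :: "nat \<Rightarrow> ((nat \<Rightarrow> complex) \<Rightarrow> complex) \<Rightarrow> (nat \<Rightarrow> complex) set \<Rightarrow> bool" where
  "holomorphic_C N f \<Omega> \<longleftrightarrow>
     (\<forall>x\<in>\<Omega>. \<exists>a :: nat \<Rightarrow> complex. \<forall>\<epsilon>>0. \<exists>\<delta>>0. \<forall>y\<in>\<Omega>.
        Cnorm N (\<lambda>i. y i - x i) < \<delta> \<longrightarrow>
        cmod (f y - f x - (\<Sum>i<N. a i * (y i - x i))) \<le> \<epsilon> * Cnorm N (\<lambda>i. y i - x i))"

text \<open>
  Elements are total functions of which only the values on \<open>\<Omega>\<close> matter.
\<close>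

definition bergman_space :: "nat \<Rightarrow> (nat \<Rightarrow> complex) set \<Rightarrow> ((nat \<Rightarrow> complex) \<Rightarrow> complex) set" where
  "bergman_space N \<Omega> =
     {f. holomorphic_C N f \<Omega> \<and> set_integrable (Cmeasure N) \<Omega> (\<lambda>x. (cmod (f x))\<^sup>2)}"

definition reproduces_at ::
    "nat \<Rightarrow> (nat \<Rightarrow> complex) set \<Rightarrow> (nat \<Rightarrow> complex) \<Rightarrow> ((nat \<Rightarrow> complex) \<Rightarrow> complex) \<Rightarrow> bool" where
  "reproduces_at N \<Omega> w k \<longleftrightarrow>
     k \<in> bergman_space N \<Omega> \<and>
     (\<forall>f\<in>bergman_space N \<Omega>. f w = (LINT x:\<Omega>|Cmeasure N. f x * cnj (k x)))"

text \<open>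
  For a domain \<open>\<Omega>\<close> and \<open>w \<in> \<Omega>\<close> the reproducing function at \<open>w\<close> exists and is unique on \<open>\<Omega>\<close>,
  so the choice does not affect the values at \<open>z \<in> \<Omega>\<close>.
\<close>

definition bergman_kernel ::
    "nat \<Rightarrow> (nat \<Rightarrow> complex) set \<Rightarrow> (nat \<Rightarrow> complex) \<Rightarrow> (nat \<Rightarrow> complex) \<Rightarrow> complex" where
  "bergman_kernel N \<Omega> z w = (SOME k. reproduces_at N \<Omega> w k) z"

definition lu_qi_keng :: "nat \<Rightarrow> (nat \<Rightarrow> complex) set \<Rightarrow> bool" where
  "lu_qi_keng N \<Omega> \<longleftrightarrow> (\<forall>z\<in>\<Omega>. \<forall>w\<in>\<Omega>. bergman_kernel N \<Omega> z w \<noteq> 0)"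

text \<open>
  \<open>\<complex>\<^sup>n \<times> \<complex>\<^sup>m\<close> is identified with \<open>\<complex>\<^sup>n\<^sup>+\<^sup>m\<close>: the first \<open>n\<close> coordinates of \<open>x\<close> form \<open>z\<close>,
  the remaining \<open>m\<close> form \<open>\<zeta>\<close>.
\<close>

definition D :: "real \<Rightarrow> nat \<Rightarrow> nat \<Rightarrow> (nat \<Rightarrow> complex) set" where
  "D \<mu> n m =
     {x \<in> Cspace (n + m). (Cnorm m (\<lambda>j. x (n + j)))\<^sup>2 < exp (- \<mu> * (Cnorm n x)\<^sup>2)}"

text \<open>At most one \<open>k\<close> satisfies this, for each \<open>\<mu>\<close> and \<open>n\<close>.\<close>

definition is_m0 :: "real \<Rightarrow> nat \<Rightarrow> nat \<Rightarrow> bool" where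
  "is_m0 \<mu> n k \<longleftrightarrow> 1 \<le> k \<and> (\<forall>m\<ge>1. lu_qi_keng (n + m) (D \<mu> n m) \<longleftrightarrow> k \<le> m)"

end

theory Submission
  imports Defs
begin

text \<open>
  Up to a factor without zeros, the Bergman kernel of \<open>D \<mu> n m\<close> is a function of one complex number:
  at a pair \<open>(z, \<zeta>)\<close>, \<open>(z', \<zeta>')\<close> it vanishes exactly when
  \<open>F\<^sub>n(t) = (\<Sum>k. (m + k)\<^sup>n (m + k choose m) t\<^sup>k)\<close> vanishes at
  \<open>t = exp (\<mu> \<langle>z, z'\<rangle>) \<langle>\<zeta>, \<zeta>'\<rangle>\<close>, and these \<open>t\<close> fill the open unit disc. Hence the domain is
  Lu Qi-Keng if and only if \<open>F\<^sub>n\<close> (the function \<open>profile n m\<close>) has no zero in the disc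
  (\<open>lu_qi_keng_iff\<close>), and the theorem says that a zero of \<open>F\<^sub>n\<close> in the disc forces one of
  \<open>F\<^sub>n\<^sub>+\<^sub>1\<close> (\<open>profile_zero_Suc\<close>).

  The second statement is Rolle's theorem. Since \<open>t\<^sup>m F\<^sub>n\<^sub>+\<^sub>1 = t (t\<^sup>m F\<^sub>n)'\<close>, real zeros of \<open>F\<^sub>n\<^sub>+\<^sub>1\<close>
  separate those of \<open>t\<^sup>m F\<^sub>n\<close>, which also vanishes at \<open>0\<close>. The coordinate \<open>s = 1 / (1 - t)\<close> turns
  \<open>F\<^sub>n\<close> into \<open>s\<^sup>m\<^sup>+\<^sup>1 P\<^sub>n(s)\<close> with a real polynomial \<open>P\<^sub>n\<close> of degree \<open>n\<close>. Counting by Rolle gives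
  \<open>n\<close> distinct zeros of \<open>P\<^sub>n\<close> in \<open>(0, 1)\<close>, so there are no others, not even complex ones. The unit disc
  becomes the half-plane \<open>Re s > 1/2\<close>; a zero of \<open>F\<^sub>n\<close> in the disc is therefore a zero
  \<open>s \<in> (1/2, 1)\<close> of \<open>P\<^sub>n\<close>, and \<open>P\<^sub>n\<^sub>+\<^sub>1\<close> has a zero in \<open>(s, 1)\<close>.

  The kernel is computed only at the base points \<open>(0, r e\<^sub>i)\<close>, \<open>\<bar>r\<bar> < 1\<close>. Averaging
  over the rotations of all coordinates but \<open>\<zeta>\<^sub>i\<close> replaces a holomorphic function \<open>f\<close> by its restriction
  to the disc of base points, and averaging over the rotations of \<open>\<zeta>\<^sub>i\<close> then isolates one Taylor
  coefficient of this restriction (\<open>pairing_with_power\<close>). So the reproducing function at the base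
  point is a power series in \<open>cnj r * \<zeta>\<^sub>i\<close> whose coefficients are the inverses of the moments
  \<open>\<integral> \<bar>\<zeta>\<^sub>i\<bar>\<^sup>2\<^sup>k\<close> over the domain, that is, a constant multiple of \<open>F\<^sub>n\<close> (\<open>base_kernel_reproduces\<close>).
  Every other point is moved to a base point by automorphisms of the domain: Heisenberg translations
  bring \<open>z\<close> to \<open>0\<close>, unitary rotations in two fibre coordinates bring \<open>\<zeta>\<close> to a multiple of \<open>e\<^sub>i\<close>, and
  reproducing functions are carried along by \<open>reproduces_transport\<close>. Because the kernel is
  Hermitian (\<open>reproducing_symmetric\<close>), knowing one reproducing function at every point determines
  the kernel, whichever choice its definition makes.
\<close>

section \<open>Real zeros of the profile function\<close>

text \<open>
  These are the polynomials \<open>P\<^sub>n\<close> with \<open>profile n m t = s\<^sup>m\<^sup>+\<^sup>1 P\<^sub>n(s)\<close> for \<open>s = 1 / (1 - t)\<close>. The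
  recursion is the operator \<open>m + t d/dt\<close>, which multiplies the coefficient of \<open>t\<^sup>k\<close> by \<open>m + k\<close>,
  written in the variable \<open>s\<close>.
\<close>

fun eulerian_poly :: "nat \<Rightarrow> nat \<Rightarrow> real poly" where
  "eulerian_poly m 0 = 1"
| "eulerian_poly m (Suc n) =
     [:-1, real m + 1:] * eulerian_poly m n + [:0, -1, 1:] * pderiv (eulerian_poly m n)"

text \<open>
  This is \<open>t\<^sup>m * profile n m t\<close> as a polynomial in \<open>s\<close>. The factors \<open>s\<close> and \<open>(s - 1)\<^sup>m\<close>
  contribute the two zeros \<open>0\<close> and \<open>1\<close> between which Rolle's theorem is applied.
\<close>

definition eulerian_primitive :: "nat \<Rightarrow> nat \<Rightarrow> real poly" where
  "eulerian_primitive m n = [:0, 1:] * [:-1, 1:] ^ m * eulerian_poly m n"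

text \<open>
  For this product the recursion is a pure derivative, because \<open>t d/dt = s (s - 1) d/ds\<close>; this is what
  makes Rolle's theorem applicable.
\<close>

lemma eulerian_primitive_Suc:
  "[:0, -1, 1:] * pderiv (eulerian_primitive m n) = eulerian_primitive m (Suc n)"
proof (cases m)
  case 0
  then show ?thesis
    by (simp add: eulerian_primitive_def pderiv_mult pderiv_pCons algebra_simps)
next
  case (Suc k)
  have *: "[:0, -1, 1:] = [:0, 1:] * [:-1, 1 :: real:]" "[:-1, real m + 1:] = [:-1,1:] + of_nat m * [:0,1:]"
    by (simp_all add: of_nat_poly)
  have pk: "pderiv ([:-1, 1::real:] ^ Suc k) = of_nat m * [:-1, 1:] ^ k"
    by (subst pderiv_power_Suc) (simp add: Suc pderiv_pCons of_nat_poly)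
  have "pderiv (eulerian_primitive m n) = [:-1,1:]^m * eulerian_poly m n
     + [:0,1:] * of_nat m * [:-1, 1:] ^ k * eulerian_poly m n
     + [:0,1:] * [:-1,1:]^m * pderiv (eulerian_poly m n)"
    unfolding eulerian_primitive_def by (simp only: pderiv_mult Suc pk pderiv_singleton) (simp add: pderiv_pCons algebra_simps)
  have alg: "x * y * (y * c * p + x * a * c * p + x * (y * c) * q) = x * (y * c) * ((y + a * x) * p + x * y * q)"
    for x y c p a q :: "real poly"
    by (simp add: algebra_simps)
  show ?thesis unfolding \<open>pderiv (eulerian_primitive m n) = _\<close>
    unfolding eulerian_primitive_def eulerian_poly.simps * unfolding Suc power_Suc
    by (rule alg)
qed

lemma degree_eulerian_poly: "degree (eulerian_poly m n) = n \<and> lead_coeff (eulerian_poly m n) > 0"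
proof (induction n)
  case (Suc n)
  let ?p = "eulerian_poly m n"
  let ?q = "eulerian_poly m (Suc n)"
  have le: "degree ?q \<le> Suc n"
  proof -
    have "degree ([:-1, real m + 1:] * ?p) \<le> Suc n"
      by (rule order_trans[OF degree_mult_le]) (use Suc in auto)
    moreover have "degree ([:0,-1,1:] * pderiv ?p) \<le> Suc n"
    proof (cases "n = 0")
      case True
      then show ?thesis by simp
    next
      case False
      then show ?thesis
        by (intro order_trans[OF degree_mult_le]) (use Suc degree_pderiv[of ?p] in auto)
    qed
    ultimately show ?thesis by (simp add: degree_add_le)
  qed
  have "coeff ?q (Suc n) = (real m + 1 + real n) * coeff ?p n"
  proof -
    have "coeff ?q (Suc n) = (real m + 1) * coeff ?p n - coeff ?p (Suc n)
       - coeff (pderiv ?p) n + coeff (pCons 0 (pderiv ?p)) n"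
      by (simp add: mult_pCons_left)
    moreover have "coeff ?p (Suc n) = 0" using Suc by (intro coeff_eq_0) simp
    moreover have "coeff (pderiv ?p) n = 0" using \<open>coeff ?p (Suc n) = 0\<close> by (simp add: coeff_pderiv)
    moreover have "coeff (pCons 0 (pderiv ?p)) n = real n * coeff ?p n"
      by (cases n) (simp_all add: coeff_pderiv)
    ultimately show ?thesis by (simp add: algebra_simps)
  qed
  moreover have "coeff ?p n > 0" using Suc by auto
  ultimately have "coeff ?q (Suc n) > 0" by simp
  then have "degree ?q = Suc n" using le le_degree[of ?q "Suc n"] by linarith
  then show ?case using \<open>coeff ?q (Suc n) > 0\<close> by simp
qed simp

text \<open>
  Rolle's theorem applied to all gaps between consecutive elements of a finite set of zeros.
\<close>

lemma poly_rolle_finite: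
  fixes p :: "real poly"
  assumes "finite Z" "Z \<noteq> {}" "\<And>z. z \<in> Z \<Longrightarrow> poly p z = 0"
  shows "\<exists>Z'. finite Z' \<and> Suc (card Z') = card Z \<and> Z' \<subseteq> {Min Z<..<Max Z} \<and> (\<forall>z\<in>Z'. poly (pderiv p) z = 0)"
  using assms
proof (induction Z rule: finite_linorder_max_induct)
  case (insert b A)
  show ?case
  proof (cases "A = {}")
    case False
    then obtain Z' where Z': "finite Z'" "Suc (card Z') = card A" "Z' \<subseteq> {Min A<..<Max A}"
        "\<forall>z\<in>Z'. poly (pderiv p) z = 0"
      using insert by auto
    have lt: "Max A < b" using insert False by simp
    have "Max A \<in> A" using insert(1) False by simp
    have "poly p (Max A) = 0" "poly p b = 0"
      using insert.prems(2) \<open>Max A \<in> A\<close> by auto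
    with poly_MVT[OF lt, of p] lt obtain x where x: "Max A < x" "x < b" "poly (pderiv p) x = 0"
      by auto
    have le: "Min A \<le> Max A" using insert(1) False by simp
    then have "Min (insert b A) = Min A" "Max (insert b A) = b"
      using Min_insert[OF insert(1) False, of b] Max_insert[OF insert(1) False, of b] lt by linarith+
    moreover have "x \<notin> Z'" using Z' x by auto
    moreover have "b \<notin> A" using insert(2) by auto
    ultimately show ?thesis
      using Z' x lt le insert(1)
      by (intro exI[of _ "insert x Z'"]) auto
  qed (auto intro: exI[of _ "{}"])
qed simp

text \<open>
  The \<open>n\<close> zeros in \<open>(0, 1)\<close> at stage \<open>n\<close>, together with \<open>0\<close> and \<open>1\<close>, are \<open>n + 2\<close> zeros of the
  primitive, and between them its derivative has \<open>n + 1\<close> zeros. That \<open>1\<close> is a zero needs \<open>m \<ge> 1\<close>.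
\<close>

lemma eulerian_poly_real_roots:
  assumes "m \<ge> 1"
  shows "\<exists>S. finite S \<and> card S = n \<and> S \<subseteq> {0<..<1} \<and> (\<forall>s\<in>S. poly (eulerian_poly m n) s = 0)"
proof (induction n)
  case (Suc n)
  then obtain S where S: "finite S" "card S = n" "S \<subseteq> {0<..<1}" "\<forall>s\<in>S. poly (eulerian_poly m n) s = 0"
    by blast
  let ?Z = "insert 0 (insert 1 S)"
  have Z: "card ?Z = Suc (Suc n)" "Min ?Z = 0" "Max ?Z = 1"
  proof -
    show "card ?Z = Suc (Suc n)" using S by (force simp: card_insert_if)
    show "Min ?Z = 0" by (rule Min_eqI) (use S in \<open>force+\<close>)
    show "Max ?Z = 1" by (rule Max_eqI) (use S in \<open>force+\<close>)
  qed
  have "poly (eulerian_primitive m n) z = 0" if "z \<in> ?Z" for z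
    using S assms that by (auto simp: eulerian_primitive_def)
  from poly_rolle_finite[of ?Z, OF _ _ this] S(1) obtain S' where S': "finite S'" "Suc (card S') = card ?Z"
    "S' \<subseteq> {Min ?Z<..<Max ?Z}" "\<forall>z\<in>S'. poly (pderiv (eulerian_primitive m n)) z = 0" by blast
  have "poly (eulerian_poly m (Suc n)) s = 0" if "s \<in> S'" for s
  proof -
    have "poly (eulerian_primitive m (Suc n)) s = 0"
      using S' that by (simp flip: eulerian_primitive_Suc)
    moreover have "0 < s" "s < 1" using S'(3) that Z by auto
    ultimately show ?thesis by (auto simp: eulerian_primitive_def)
  qed
  then show ?case using S' Z by (intro exI[of _ S']) auto
qed (auto intro: exI[of _ "{}"])

lemma map_poly_of_real_add:
  "map_poly complex_of_real (p + q) = map_poly of_real p + map_poly of_real q"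
  by (rule poly_eqI) (simp add: coeff_map_poly)

lemma map_poly_of_real_mult:
  "map_poly complex_of_real (p * q) = map_poly of_real p * map_poly of_real q"
  by (rule poly_eqI) (simp add: coeff_map_poly coeff_mult)

lemma poly_map_poly_of_real:
  "poly (map_poly complex_of_real p) (of_real x) = of_real (poly p x)"
  by (induction p) (simp_all add: map_poly_pCons)

text \<open>
  The real zeros already exhaust the degree.
\<close>

lemma eulerian_poly_complex_root:
  assumes "m \<ge> 1" and z: "poly (map_poly complex_of_real (eulerian_poly m n)) z = 0"
  shows "\<exists>s. 0 < s \<and> s < 1 \<and> z = of_real s \<and> poly (eulerian_poly m n) s = 0"
proof -
  let ?p = "map_poly complex_of_real (eulerian_poly m n)"
  obtain S where S: "finite S" "card S = n" "S \<subseteq> {0<..<1}" "\<forall>s\<in>S. poly (eulerian_poly m n) s = 0"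
    using eulerian_poly_real_roots[OF assms(1)] by blast
  have deg: "degree ?p = n" using degree_eulerian_poly by (simp add: degree_map_poly)
  have nz: "?p \<noteq> 0" using degree_eulerian_poly[of m n] by (auto simp: map_poly_eq_0_iff)
  have sub: "complex_of_real ` S \<subseteq> {z. poly ?p z = 0}"
    using S by (auto simp: poly_map_poly_of_real)
  have "card {z. poly ?p z = 0} \<le> n" using card_poly_roots_bound[OF nz] deg by simp
  moreover have "card (complex_of_real ` S) = n" using S by (simp add: card_image inj_on_def)
  ultimately have "complex_of_real ` S = {z. poly ?p z = 0}"
    by (intro card_seteq sub poly_roots_finite nz) simp
  then obtain s where "s \<in> S" "z = of_real s" using z by blast
  then show ?thesis using S by auto
qed

text \<open>
  Rolle's theorem for the primitive between \<open>s\<close> and its zero \<open>1\<close>.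
\<close>

lemma eulerian_poly_next_root:
  assumes "m \<ge> 1" "0 < s" "s < 1" "poly (eulerian_poly m n) s = 0"
  shows "\<exists>s'. s < s' \<and> s' < 1 \<and> poly (eulerian_poly m (Suc n)) s' = 0"
proof -
  have "poly (eulerian_primitive m n) s = 0" "poly (eulerian_primitive m n) 1 = 0"
    using assms by (auto simp: eulerian_primitive_def)
  then obtain x where x: "s < x" "x < 1" "poly (pderiv (eulerian_primitive m n)) x = 0"
    using poly_MVT[of s 1 "eulerian_primitive m n"] assms by auto
  have "poly (eulerian_primitive m (Suc n)) x = 0"
    using x by (simp flip: eulerian_primitive_Suc)
  then show ?thesis using x assms by (auto simp: eulerian_primitive_def)
qed

text \<open>
  \<open>Re (1 / w) > 1/2\<close> says \<open>\<bar>w\<bar>\<^sup>2 < 2 Re w\<close>, that is, \<open>\<bar>1 - w\<bar> < 1\<close>.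
\<close>

lemma Re_gt_half_of_disc:
  assumes "cmod t < 1" shows "Re (1 / (1 - t)) > 1/2"
proof -
  have ne: "1 - t \<noteq> 0" using assms by auto
  have "(cmod t)^2 < 1" using power_strict_mono[OF assms norm_ge_zero, of 2] by simp
  then have "(Re t)^2 + (Im t)^2 < 1" unfolding cmod_power2 .
  then have "(cmod (1 - t))^2 < 2 * Re (1 - t)"
    unfolding cmod_power2 by (simp add: power2_eq_square algebra_simps)
  moreover have "(cmod (1 - t))^2 > 0" using ne by simp
  ultimately show ?thesis
    unfolding Re_divide cmod_power2[symmetric] by (simp add: field_simps)
qed

definition profile :: "nat \<Rightarrow> nat \<Rightarrow> complex \<Rightarrow> complex" where
  "profile n m t = (\<Sum>k. of_nat ((m + k) ^ n * ((m + k) choose m)) * t ^ k)"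

text \<open>
  Induction on \<open>m\<close> by termwise differentiation of the geometric series; it is the case \<open>n = 0\<close> of
  the closed form below.
\<close>

lemma negative_binomial_sums:
  "cmod t < 1 \<Longrightarrow> (\<lambda>k. of_nat ((m + k) choose m) * t ^ k) sums ((1 / (1 - t)) ^ (m + 1))"
proof (induction m arbitrary: t)
  case 0
  then show ?case using geometric_sums[of t] by simp
next
  case (Suc m)
  have ne: "1 - t \<noteq> 0" using Suc.prems by auto
  have ds: "((\<lambda>t. 1 / (1 - t)) has_field_derivative (1 / (1 - t))\<^sup>2) (at t)"
    using ne by (auto intro!: derivative_eq_intros simp: power2_eq_square)
  have "((\<lambda>s::complex. s ^ (m + 1)) has_field_derivative of_nat (Suc m) * (1 / (1 - t)) ^ m) (at (1 / (1 - t)))"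
    by (rule DERIV_cong[OF DERIV_power[OF DERIV_ident]]) simp
  from DERIV_chain2[OF this ds] have
    "((\<lambda>t. (1 / (1 - t)) ^ (m + 1)) has_field_derivative of_nat (Suc m) * (1 / (1 - t)) ^ (m + 2)) (at t)"
    by (simp add: power2_eq_square mult.assoc)
  from termdiffs_sums_strong[OF Suc.IH this Suc.prems]
  have "(\<lambda>n. diffs (\<lambda>k. of_nat ((m + k) choose m)) n * t ^ n) sums
     (of_nat (Suc m) * (1 / (1 - t)) ^ (m + 2))" .
  moreover have "diffs (\<lambda>k. of_nat ((m + k) choose m)) n = of_nat (Suc m) * complex_of_nat ((Suc m + n) choose Suc m)" for n
  proof -
    have "Suc n * ((m + Suc n) choose m) = Suc m * ((Suc m + n) choose Suc m)"
      using binomial_absorb_comp[of "m + Suc n" m] Suc_times_binomial_eq[of "m + n" m]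
      by (simp del: binomial_Suc_Suc mult_Suc add: mult.commute)
    then have "of_nat (Suc n) * complex_of_nat ((m + Suc n) choose m) = of_nat (Suc m) * of_nat ((Suc m + n) choose Suc m)"
      unfolding of_nat_mult[symmetric] by (rule arg_cong)
    then show ?thesis unfolding diffs_def .
  qed
  ultimately have "(\<lambda>n. of_nat (Suc m) * (of_nat ((Suc m + n) choose Suc m) * t ^ n)) sums
     (of_nat (Suc m) * (1 / (1 - t)) ^ (m + 2))" by (simp add: mult.assoc)
  then show ?case by (subst (asm) sums_mult_iff) (simp_all del: of_nat_Suc binomial_Suc_Suc)
qed

text \<open>
  The closed form of the profile. Raising \<open>n\<close> by one applies \<open>m + t d/dt\<close> to the power series, and the
  recursion of the polynomials is exactly the effect of this operator on the right-hand side.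
\<close>

lemma profile_sums:
  "cmod t < 1 \<Longrightarrow> (\<lambda>k. of_nat ((m + k) ^ n * ((m + k) choose m)) * t ^ k) sums
     ((1 / (1 - t)) ^ (m + 1) * poly (map_poly of_real (eulerian_poly m n)) (1 / (1 - t)))"
proof (induction n arbitrary: t)
  case 0
  then show ?case using negative_binomial_sums by simp
next
  case (Suc n)
  let ?P = "map_poly complex_of_real (eulerian_poly m n)"
  let ?s = "1 / (1 - t)"
  let ?c = "\<lambda>k. complex_of_nat ((m + k) ^ n * ((m + k) choose m))"
  have ne: "1 - t \<noteq> 0" using Suc.prems by auto
  have ds: "((\<lambda>t. 1 / (1 - t)) has_field_derivative ?s\<^sup>2) (at t)"
    using ne by (auto intro!: derivative_eq_intros simp: power2_eq_square)
  have "((\<lambda>s. s ^ (m + 1) * poly ?P s) has_field_derivative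
      (of_nat (m + 1) * ?s ^ m * poly ?P ?s + ?s ^ (m + 1) * poly (pderiv ?P) ?s)) (at ?s)"
    by (rule DERIV_cong[OF DERIV_mult[OF DERIV_power[OF DERIV_ident] poly_DERIV]]) (simp add: algebra_simps)
  note d = DERIV_chain2[OF this ds]
  define d' where "d' = (of_nat (m + 1) * ?s ^ m * poly ?P ?s + ?s ^ (m + 1) * poly (pderiv ?P) ?s) * ?s\<^sup>2"
  have "(\<lambda>k. diffs ?c k * t ^ k) sums d'"
    unfolding d'_def by (rule termdiffs_sums_strong[OF Suc.IH d Suc.prems])
  then have "(\<lambda>k. t * (diffs ?c k * t ^ k)) sums (t * d')" by (rule sums_mult)
  then have "(\<lambda>k. of_nat (Suc k) * ?c (Suc k) * t ^ Suc k) sums (t * d')"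
    unfolding diffs_def power_Suc by (simp only: mult_ac)
  then have "(\<lambda>k. of_nat k * ?c k * t ^ k) sums (t * d')"
    by (subst (asm) sums_Suc_iff) simp
  from sums_add[OF this sums_mult[OF Suc.IH[OF Suc.prems], of "of_nat m"]]
  have "(\<lambda>k. of_nat ((m + k) ^ Suc n * ((m + k) choose m)) * t ^ k) sums
     (t * d' + of_nat m * (?s ^ (m + 1) * poly ?P ?s))"
    by (simp add: algebra_simps)
  moreover have "t * d' + of_nat m * (?s ^ (m + 1) * poly ?P ?s)
     = ?s ^ (m + 1) * poly (map_poly of_real (eulerian_poly m (Suc n))) ?s"
  proof -
    have t: "t * ?s = ?s - 1" using ne by (simp add: field_simps)
    have pd: "pderiv ?P = map_poly of_real (pderiv (eulerian_poly m n))"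
      by (rule poly_eqI) (simp add: coeff_pderiv coeff_map_poly)
    have P: "poly (map_poly of_real (eulerian_poly m (Suc n))) ?s
       = ((of_nat m + 1) * ?s - 1) * poly ?P ?s + ?s * (?s - 1) * poly (pderiv ?P) ?s"
      unfolding pd eulerian_poly.simps map_poly_of_real_mult map_poly_of_real_add poly_add poly_mult
      by (simp add: map_poly_pCons)
    have "t * d' = (t * ?s) * ?s * (of_nat (m + 1) * ?s ^ m * poly ?P ?s + ?s ^ (m + 1) * poly (pderiv ?P) ?s)"
      unfolding d'_def by (simp add: power2_eq_square mult_ac)
    have alg: "(s - 1) * s * (of_nat (m + 1) * c * p + (s * c) * q) + of_nat m * (s * c * p)
      = s * c * (((of_nat m + 1) * s - 1) * p + s * (s - 1) * q)" for s c p q :: complex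
      by (simp add: algebra_simps)
    show ?thesis unfolding \<open>t * d' = _\<close> unfolding t P power_add power_one_right
      unfolding mult.commute[of "?s ^ m" ?s] by (rule alg)
  qed
  ultimately show ?case by (simp only:)
qed

lemma profile_eq:
  "cmod t < 1 \<Longrightarrow> profile n m t = (1 / (1 - t)) ^ (m + 1) * poly (map_poly of_real (eulerian_poly m n)) (1 / (1 - t))"
  unfolding profile_def by (rule sums_unique[OF profile_sums, symmetric])

lemma profile_holomorphic: "profile n m holomorphic_on ball 0 1"
proof (rule holomorphic_transform)
  let ?h = "\<lambda>s. s ^ (m + 1) * poly (map_poly complex_of_real (eulerian_poly m n)) s"
  have "(\<lambda>t::complex. 1 / (1 - t)) holomorphic_on ball 0 1"
    by (intro holomorphic_intros) auto
  moreover have "?h holomorphic_on UNIV"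
    by (intro holomorphic_on_mult holomorphic_on_power holomorphic_on_ident poly_holomorphic_on)
  ultimately have "(?h \<circ> (\<lambda>t. 1 / (1 - t))) holomorphic_on ball 0 1"
    by (rule holomorphic_on_compose_gen) auto
  then show "(\<lambda>t. ?h (1 / (1 - t))) holomorphic_on ball 0 1" by (simp only: o_def)
qed (simp add: profile_eq)

text \<open>
  In the variable \<open>s\<close> a zero in the disc is a real zero in \<open>(1/2, 1)\<close>; the next polynomial has a zero
  still closer to \<open>1\<close>, and going back to \<open>t = 1 - 1 / s\<close> it lies in \<open>(-1, 0)\<close>.
\<close>

lemma profile_zero_Suc:
  assumes "m \<ge> 1" "cmod t < 1" "profile n m t = 0"
  shows "\<exists>t. cmod t < 1 \<and> profile (Suc n) m t = 0"
proof -
  have ne: "1 - t \<noteq> 0" using assms by auto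
  have "poly (map_poly of_real (eulerian_poly m n)) (1 / (1 - t)) = 0"
    using assms ne by (simp add: profile_eq)
  then obtain s where s: "0 < s" "s < 1" "1 / (1 - t) = of_real s" "poly (eulerian_poly m n) s = 0"
    using eulerian_poly_complex_root[OF assms(1)] by blast
  have "s > 1/2" using Re_gt_half_of_disc[OF assms(2)] s(3) by simp
  obtain s' where s': "s < s'" "s' < 1" "poly (eulerian_poly m (Suc n)) s' = 0"
    using eulerian_poly_next_root[OF assms(1) s(1,2,4)] by blast
  define t' where "t' = 1 - 1 / s'"
  have t': "\<bar>t'\<bar> < 1" unfolding t'_def using s' \<open>s > 1/2\<close> by (auto simp: field_simps abs_if)
  have "1 / (1 - t') = s'" using s' s unfolding t'_def by simp
  then have "1 / (1 - complex_of_real t') = of_real s'"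
    by (metis of_real_1 of_real_diff of_real_divide)
  then have "profile (Suc n) m t' = 0"
    using t' s'(3) by (simp add: profile_eq poly_map_poly_of_real del: eulerian_poly.simps)
  then show ?thesis using t' by (intro exI[of _ "of_real t'"]) simp
qed

section \<open>Lebesgue measure on the complex plane\<close>

lemma emeasure_ball_complex:
  "r \<ge> 0 \<Longrightarrow> emeasure lborel (ball (c::complex) r) = ennreal (pi * r\<^sup>2)"
  using emeasure_ball[of r c] by (simp add: unit_ball_vol_2)

lemma nn_integral_lborel_translate:
  fixes f :: "'a::euclidean_space \<Rightarrow> ennreal"
  assumes [measurable]: "f \<in> borel_measurable borel"
  shows "(\<integral>\<^sup>+x. f (a + x) \<partial>lborel) = (\<integral>\<^sup>+x. f x \<partial>lborel)"
  by (subst (2) lborel_distr_plus[of a, symmetric]) (simp add: nn_integral_distr)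

text \<open>
  The uniqueness argument for Haar measure: integrate \<open>b y * f (c x)\<close>, with \<open>b\<close> the indicator of the
  unit disc, over both variables. Translations and Fubini turn it into the integral of
  \<open>b (y - c x) * f y\<close>, whose \<open>x\<close>-integral is the area of a disc of radius \<open>1 / \<bar>c\<bar>\<close>.
\<close>

lemma nn_integral_lborel_complex_mult:
  fixes f :: "complex \<Rightarrow> ennreal" and c :: complex
  assumes [measurable]: "f \<in> borel_measurable borel" and c: "c \<noteq> 0"
  shows "(\<integral>\<^sup>+x. f (c * x) \<partial>lborel) * ennreal ((cmod c)\<^sup>2) = (\<integral>\<^sup>+x. f x \<partial>lborel)"
proof -
  define b where "b = (indicator (ball 0 1) :: complex \<Rightarrow> ennreal)"
  have [measurable]: "b \<in> borel_measurable borel" unfolding b_def by (intro borel_measurable_indicator) simp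
  have area: "(\<integral>\<^sup>+x. b (y - c * x) \<partial>lborel) = ennreal (pi / (cmod c)\<^sup>2)" for y
  proof -
    have "b (y - c * x) = indicator (ball (y / c) (1 / cmod c)) x" for x
    proof -
      have "cmod (y - c * x) = cmod c * cmod (y / c - x)"
        using c by (simp flip: norm_mult add: algebra_simps)
      then have "cmod (y - c * x) < 1 \<longleftrightarrow> cmod (y / c - x) < 1 / cmod c"
        using c pos_less_divide_eq[of "cmod c" "cmod (y / c - x)" 1] by (simp only:) (simp add: mult.commute)
      then show ?thesis
        by (simp add: b_def indicator_def mem_ball dist_norm norm_minus_commute[of "c * x"])
    qed
    then show ?thesis
      by (simp add: emeasure_ball_complex power_divide)
  qed
  have "ennreal pi * (\<integral>\<^sup>+x. f (c * x) \<partial>lborel) = (\<integral>\<^sup>+y. \<integral>\<^sup>+x. b y * f (c * x) \<partial>lborel \<partial>lborel)"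
  proof -
    have "(\<integral>\<^sup>+y. b y \<partial>lborel) = ennreal pi"
      unfolding b_def using emeasure_ball_complex[of 1 0] by simp
    then show ?thesis by (simp add: nn_integral_cmult nn_integral_multc)
  qed
  also have "\<dots> = (\<integral>\<^sup>+y. \<integral>\<^sup>+x. b y * f (c * x + y) \<partial>lborel \<partial>lborel)"
  proof (rule nn_integral_cong)
    fix y
    show "(\<integral>\<^sup>+x. b y * f (c * x) \<partial>lborel) = (\<integral>\<^sup>+x. b y * f (c * x + y) \<partial>lborel)"
      using nn_integral_lborel_translate[of "\<lambda>x. b y * f (c * x)" "y / c"] c
      by (simp add: algebra_simps)
  qed
  also have "\<dots> = (\<integral>\<^sup>+x. \<integral>\<^sup>+y. b y * f (c * x + y) \<partial>lborel \<partial>lborel)"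
    by (rule lborel_pair.Fubini') measurable
  also have "\<dots> = (\<integral>\<^sup>+x. \<integral>\<^sup>+y. b (y - c * x) * f y \<partial>lborel \<partial>lborel)"
  proof (rule nn_integral_cong)
    fix x
    show "(\<integral>\<^sup>+y. b y * f (c * x + y) \<partial>lborel) = (\<integral>\<^sup>+y. b (y - c * x) * f y \<partial>lborel)"
      using nn_integral_lborel_translate[of "\<lambda>y. b (y - c * x) * f y" "c * x"]
      by (simp add: algebra_simps)
  qed
  also have "\<dots> = (\<integral>\<^sup>+y. \<integral>\<^sup>+x. b (y - c * x) * f y \<partial>lborel \<partial>lborel)"
    by (rule lborel_pair.Fubini') measurable
  also have "\<dots> = ennreal (pi / (cmod c)\<^sup>2) * (\<integral>\<^sup>+y. f y \<partial>lborel)"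
    by (simp add: nn_integral_multc area nn_integral_cmult)
  finally have eq: "ennreal pi * (\<integral>\<^sup>+x. f (c * x) \<partial>lborel) = ennreal (pi / (cmod c)\<^sup>2) * (\<integral>\<^sup>+y. f y \<partial>lborel)" .
  let ?k = "ennreal ((cmod c)\<^sup>2 / pi)"
  have "?k * ennreal pi = ennreal ((cmod c)\<^sup>2)" "?k * ennreal (pi / (cmod c)\<^sup>2) = 1"
    using c by (simp_all flip: ennreal_mult)
  then show ?thesis using arg_cong[OF eq, of "\<lambda>z. ?k * z"]
    by (simp flip: mult.assoc) (simp add: mult.commute)
qed

lemma nn_integral_lborel_complex_affine:
  fixes f :: "complex \<Rightarrow> ennreal" and c h :: complex
  assumes [measurable]: "f \<in> borel_measurable borel" and c: "c \<noteq> 0"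
  shows "(\<integral>\<^sup>+x. f (c * x + h) * ennreal ((cmod c)\<^sup>2) \<partial>lborel) = (\<integral>\<^sup>+x. f x \<partial>lborel)"
  using nn_integral_lborel_complex_mult[of "\<lambda>x. f (x + h)" c] c nn_integral_lborel_translate[of f h]
  by (simp add: nn_integral_multc add.commute)

text \<open>
  Polar coordinates: both measures give \<open>pi * a\<close> to \<open>{..<a}\<close> for \<open>a \<ge> 0\<close>.
\<close>

lemma distr_cmod_square:
  "distr lborel borel (\<lambda>z::complex. (cmod z)\<^sup>2) = density lborel (\<lambda>s. ennreal pi * indicator {0..} s)"
proof (rule measure_eqI_generator_eq[where E="range (\<lambda>a::real. {..<a})" and \<Omega>=UNIV and A="\<lambda>i. {..<real i}"])
  show "Int_stable (range (\<lambda>a::real. {..<a}))"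
    unfolding Int_stable_def
    by (intro ballI, elim rangeE) (metis inf.absorb1 inf.absorb2 lessThan_subset_iff linear rangeI)
  fix X assume "X \<in> range (\<lambda>a::real. {..<a})"
  then obtain a :: real where X: "X = {..<a}" by auto
  have 1: "(\<lambda>z::complex. (cmod z)\<^sup>2) -` {..<a} = ball 0 (sqrt a)"
    by (auto simp: real_less_lsqrt real_sqrt_less_iff dist_norm) (metis norm_ge_zero real_sqrt_less_mono real_sqrt_unique, metis norm_ge_zero real_less_rsqrt real_sqrt_pow2 real_sqrt_less_iff real_sqrt_unique)
  have 2: "emeasure (density lborel (\<lambda>s. ennreal pi * indicator {0..} s)) X
     = ennreal pi * emeasure lborel {0..<a}"
  proof -
    have "emeasure (density lborel (\<lambda>s. ennreal pi * indicator {0..} s)) X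
        = (\<integral>\<^sup>+s. ennreal pi * indicator {0..<a} s \<partial>lborel)"
      unfolding X by (subst emeasure_density) (auto intro!: nn_integral_cong simp: indicator_def)
    then show ?thesis by (simp add: nn_integral_cmult)
  qed
  show "emeasure (distr lborel borel (\<lambda>z::complex. (cmod z)\<^sup>2)) X = emeasure (density lborel (\<lambda>s. ennreal pi * indicator {0..} s)) X"
  proof (cases "a \<ge> 0")
    case True
    then show ?thesis unfolding 2
      by (subst emeasure_distr) (auto simp: 1 X emeasure_ball_complex ennreal_mult)
  next
    case False
    then have "ball 0 (sqrt a) = ({}::complex set)" by simp
    then have "emeasure lborel (ball 0 (sqrt a) :: complex set) = 0" by (simp only: emeasure_empty)
    then show ?thesis unfolding 2 using False
      by (subst emeasure_distr) (auto simp: 1 X)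
  qed
next
  show "sets (distr lborel borel (\<lambda>z::complex. (cmod z)\<^sup>2)) = sigma_sets UNIV (range (\<lambda>a::real. {..<a}))"
    by (simp add: borel_Iio)
  show "sets (density lborel (\<lambda>s. ennreal pi * indicator {0..} s)) = sigma_sets UNIV (range (\<lambda>a::real. {..<a}))"
    by (simp add: borel_Iio)
  show "(\<Union>i. {..<real i}) = UNIV"
    by (auto intro: reals_Archimedean2)
  fix i
  have "(\<lambda>z::complex. (cmod z)\<^sup>2) -` {..<real i} \<inter> space lborel \<subseteq> ball 0 (sqrt (real i))"
    by (auto simp: dist_norm) (metis real_less_rsqrt)
  then have "emeasure lborel ((\<lambda>z::complex. (cmod z)\<^sup>2) -` {..<real i} \<inter> space lborel) \<le> emeasure lborel (ball (0::complex) (sqrt (real i)))"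
    by (rule emeasure_mono) simp
  also have "\<dots> < \<infinity>" by (simp add: emeasure_ball_complex)
  finally show "emeasure (distr lborel borel (\<lambda>z::complex. (cmod z)\<^sup>2)) {..<real i} \<noteq> \<infinity>"
    by (subst emeasure_distr) (auto simp: less_top)
qed auto

lemma nn_integral_cmod_square:
  fixes g :: "real \<Rightarrow> ennreal"
  assumes [measurable]: "g \<in> borel_measurable borel"
  shows "(\<integral>\<^sup>+z. g ((cmod z)\<^sup>2) \<partial>lborel) = ennreal pi * (\<integral>\<^sup>+s. g s * indicator {0..} s \<partial>lborel)"
proof -
  have "(\<integral>\<^sup>+z. g ((cmod z)\<^sup>2) \<partial>lborel) = (\<integral>\<^sup>+s. g s \<partial>distr lborel borel (\<lambda>z::complex. (cmod z)\<^sup>2))"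
    by (simp add: nn_integral_distr)
  also have "\<dots> = (\<integral>\<^sup>+s. ennreal pi * (g s * indicator {0..} s) \<partial>lborel)"
    unfolding distr_cmod_square by (simp add: nn_integral_density mult_ac)
  finally show ?thesis by (simp add: nn_integral_cmult)
qed

lemma nn_integral_gaussian_moment:
  "(\<integral>\<^sup>+z. ennreal ((cmod z) ^ (2 * k) * exp (- (cmod z)\<^sup>2)) \<partial>lborel) = ennreal (pi * fact k)"
  using nn_integral_cmod_square[of "\<lambda>s. ennreal (s ^ k * exp (- s))"] nn_intergal_power_times_exp_Ici[of k]
  by (simp add: ennreal_mult power_mult)

lemma nn_integral_gaussian:
  assumes "a > 0"
  shows "(\<integral>\<^sup>+z. ennreal (exp (- (a * (cmod z)\<^sup>2))) \<partial>lborel) = ennreal (pi / a)"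
proof -
  have "(\<integral>\<^sup>+z. ennreal (exp (- (cmod z)\<^sup>2)) \<partial>lborel) = ennreal pi"
    using nn_integral_gaussian_moment[of 0] by simp
  moreover have "(\<integral>\<^sup>+z. ennreal (exp (- (cmod (of_real (sqrt a) * z))\<^sup>2)) \<partial>lborel) * ennreal a
      = (\<integral>\<^sup>+z. ennreal (exp (- (cmod z)\<^sup>2)) \<partial>lborel)"
    using nn_integral_lborel_complex_mult[of "\<lambda>z. ennreal (exp (- (cmod z)\<^sup>2))" "of_real (sqrt a)"] assms
    by simp
  ultimately have eq: "(\<integral>\<^sup>+z. ennreal (exp (- (a * (cmod z)\<^sup>2))) \<partial>lborel) * ennreal a = ennreal pi"
    using assms by (simp add: norm_mult power_mult_distrib)
  have "ennreal a * ennreal (1 / a) = 1" using assms by (simp flip: ennreal_mult)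
  then show ?thesis using arg_cong[OF eq, of "\<lambda>z. z * ennreal (1 / a)"] assms
    by (simp add: mult.assoc) (simp flip: ennreal_mult)
qed

lemma nn_integral_exp_Ioi:
  "(\<integral>\<^sup>+s. ennreal (exp (- s)) * indicator {c<..} s \<partial>lborel) = ennreal (exp (- c))"
proof -
  have "(\<integral>\<^sup>+s. ennreal (exp (- s)) * indicator {c<..} s \<partial>lborel) = (\<integral>\<^sup>+s. ennreal (exp (- s)) * indicator {c..} s \<partial>lborel)"
  proof (rule nn_integral_cong_AE)
    have "AE s in lborel. s \<noteq> c" by (rule AE_lborel_singleton)
    then show "AE s in lborel. ennreal (exp (- s)) * indicator {c<..} s = ennreal (exp (- s)) * indicator {c..} s"
      by eventually_elim (auto simp: indicator_def)
  qed
  also have "\<dots> = ennreal (0 - (- exp (- c)))"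
  proof (rule nn_integral_FTC_atLeast)
    show "((\<lambda>s. - exp (- s)) \<longlongrightarrow> (0::real)) at_top"
      using tendsto_minus[OF filterlim_compose[OF exp_at_bot filterlim_uminus_at_bot_at_top]] by simp
    show "DERIV (\<lambda>s. - exp (- s)) x :> exp (- x)" for x :: real
      by (auto intro!: derivative_eq_intros)
  qed auto
  finally show ?thesis by simp
qed

lemma nn_integral_power_exp_Ioi:
  "(\<integral>\<^sup>+s. ennreal (s ^ k * exp (- s)) * indicator {0<..} s \<partial>lborel) = ennreal (fact k)"
proof -
  have "(\<integral>\<^sup>+s. ennreal (s ^ k * exp (- s)) * indicator {0<..} s \<partial>lborel) = (\<integral>\<^sup>+s. ennreal (s ^ k * exp (- s)) * indicator {0..} s \<partial>lborel)"
  proof (rule nn_integral_cong_AE)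
    have "AE s in lborel. s \<noteq> (0::real)" by (rule AE_lborel_singleton)
    then show "AE s in lborel. ennreal (s ^ k * exp (- s)) * indicator {0<..} s = ennreal (s ^ k * exp (- s)) * indicator {0::real..} s"
      by eventually_elim (auto simp: indicator_def)
  qed
  then show ?thesis using nn_intergal_power_times_exp_Ici[of k] by simp
qed

section \<open>Change of variables in several complex variables\<close>

interpretation Cprod: product_sigma_finite "\<lambda>_::nat. lborel :: complex measure"
  by standard

lemma sigma_finite_Cmeasure: "sigma_finite_measure (Cmeasure N)"
  unfolding Cmeasure_def by (rule Cprod.sigma_finite) simp

lemma space_Cmeasure: "space (Cmeasure N) = Cspace N"
  by (simp add: Cmeasure_def Cspace_def space_PiM)

lemma measurable_coord [measurable]: "i < N \<Longrightarrow> (\<lambda>x. x i) \<in> borel_measurable (Cmeasure N)"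
  unfolding Cmeasure_def by measurable

lemma measurable_Cmeasure_upd:
  assumes "j < N" "g \<in> borel_measurable (Cmeasure N)"
  shows "(\<lambda>x. x(j := g x)) \<in> Cmeasure N \<rightarrow>\<^sub>M Cmeasure N"
proof -
  have "insert j {..<N} = {..<N}" using assms by auto
  then show ?thesis
    using assms measurable_fun_upd[of "{..<N}" "{..<N}" j "\<lambda>x. x" "Cmeasure N" "\<lambda>_. lborel" g]
    by (simp add: Cmeasure_def)
qed

text \<open>
  \<open>J\<close> is the complex Jacobian determinant of \<open>\<phi>\<close>, so that \<open>\<bar>J\<bar>\<^sup>2\<close> is the real one. Taking the integral
  identity itself as the definition makes composition immediate, and no Jacobian matrix appears.
\<close>

definition change_of_vars ::
    "nat \<Rightarrow> ((nat \<Rightarrow> complex) \<Rightarrow> nat \<Rightarrow> complex) \<Rightarrow> ((nat \<Rightarrow> complex) \<Rightarrow> complex) \<Rightarrow> bool" where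
  "change_of_vars N \<phi> J \<longleftrightarrow>
     \<phi> \<in> Cmeasure N \<rightarrow>\<^sub>M Cmeasure N \<and> J \<in> borel_measurable (Cmeasure N) \<and>
     (\<forall>f\<in>borel_measurable (Cmeasure N).
        (\<integral>\<^sup>+x. f (\<phi> x) * ennreal ((cmod (J x))\<^sup>2) \<partial>Cmeasure N) = (\<integral>\<^sup>+x. f x \<partial>Cmeasure N))"

text \<open>
  The building block of all coordinate changes: one coordinate undergoes an affine map whose
  coefficients depend on the other coordinates only, so Fubini reduces the claim to one variable.
\<close>

lemma change_of_vars_elementary:
  assumes j: "j < N"
    and [measurable]: "u \<in> borel_measurable (Cmeasure N)" "h \<in> borel_measurable (Cmeasure N)"
    and u0: "\<And>x. u x \<noteq> 0"
    and u: "\<And>x v. u (x(j := v)) = u x" and h: "\<And>x v. h (x(j := v)) = h x"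
  shows "change_of_vars N (\<lambda>x. x(j := u x * x j + h x)) u"
  unfolding change_of_vars_def
proof (intro conjI ballI)
  show m[measurable]: "(\<lambda>x. x(j := u x * x j + h x)) \<in> Cmeasure N \<rightarrow>\<^sub>M Cmeasure N"
    using j by (intro measurable_Cmeasure_upd) measurable
  show "u \<in> borel_measurable (Cmeasure N)" by fact
  fix f :: "(nat \<Rightarrow> complex) \<Rightarrow> ennreal"
  assume f[measurable]: "f \<in> borel_measurable (Cmeasure N)"
  define I where "I = {..<N} - {j}"
  have I: "finite I" "j \<notin> I" "insert j I = {..<N}" using j by (auto simp: I_def)
  have M: "Cmeasure N = PiM (insert j I) (\<lambda>_. lborel)" by (simp add: I Cmeasure_def)
  have "(\<integral>\<^sup>+x. f (x(j := u x * x j + h x)) * ennreal ((cmod (u x))\<^sup>2) \<partial>Cmeasure N)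
     = (\<integral>\<^sup>+x. \<integral>\<^sup>+y. f (x(j := u x * y + h x)) * ennreal ((cmod (u x))\<^sup>2) \<partial>lborel \<partial>PiM I (\<lambda>_. lborel))"
  proof -
    have "(\<lambda>x. f (x(j := u x * x j + h x)) * ennreal ((cmod (u x))\<^sup>2)) \<in> borel_measurable (Cmeasure N)"
      by measurable
    then show ?thesis unfolding M
      by (subst Cprod.product_nn_integral_insert) (use I in \<open>simp_all add: u h\<close>)
  qed
  also have "\<dots> = (\<integral>\<^sup>+x. \<integral>\<^sup>+y. f (x(j := y)) \<partial>lborel \<partial>PiM I (\<lambda>_. lborel))"
  proof (rule nn_integral_cong)
    fix x assume x: "x \<in> space (PiM I (\<lambda>_. lborel :: complex measure))"
    have "(\<lambda>y. x(j := y)) \<in> lborel \<rightarrow>\<^sub>M PiM (insert j I) (\<lambda>_. lborel)"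
      using measurable_component_update[OF x I(2)] by simp
    then have "(\<lambda>y. f (x(j := y))) \<in> borel_measurable lborel"
      using measurable_compose f M by metis
    then have "(\<lambda>y. f (x(j := y))) \<in> borel_measurable borel" by simp
    from nn_integral_lborel_complex_affine[OF this u0[of x], of "h x"]
    show "(\<integral>\<^sup>+y. f (x(j := u x * y + h x)) * ennreal ((cmod (u x))\<^sup>2) \<partial>lborel) = (\<integral>\<^sup>+y. f (x(j := y)) \<partial>lborel)" .
  qed
  also have "\<dots> = (\<integral>\<^sup>+x. f x \<partial>Cmeasure N)"
    unfolding M using I f M by (subst Cprod.product_nn_integral_insert) simp_all
  finally show "(\<integral>\<^sup>+x. f (x(j := u x * x j + h x)) * ennreal ((cmod (u x))\<^sup>2) \<partial>Cmeasure N) = (\<integral>\<^sup>+x. f x \<partial>Cmeasure N)" .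
qed

lemma change_of_vars_nn_integral:
  assumes "change_of_vars N \<phi> J" "f \<in> borel_measurable (Cmeasure N)"
  shows "(\<integral>\<^sup>+x. f x \<partial>Cmeasure N) = (\<integral>\<^sup>+x. f (\<phi> x) * ennreal ((cmod (J x))\<^sup>2) \<partial>Cmeasure N)"
  using assms unfolding change_of_vars_def by simp

lemma change_of_vars_comp:
  assumes "change_of_vars N \<phi> J" "change_of_vars N \<psi> L"
  shows "change_of_vars N (\<lambda>x. \<psi> (\<phi> x)) (\<lambda>x. L (\<phi> x) * J x)"
proof -
  have [measurable]: "\<phi> \<in> Cmeasure N \<rightarrow>\<^sub>M Cmeasure N" "\<psi> \<in> Cmeasure N \<rightarrow>\<^sub>M Cmeasure N"
    "J \<in> borel_measurable (Cmeasure N)" "L \<in> borel_measurable (Cmeasure N)"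
    using assms by (auto simp: change_of_vars_def)
  have "(\<integral>\<^sup>+x. f (\<psi> (\<phi> x)) * ennreal ((cmod (L (\<phi> x) * J x))\<^sup>2) \<partial>Cmeasure N) = (\<integral>\<^sup>+x. f x \<partial>Cmeasure N)"
    if [measurable]: "f \<in> borel_measurable (Cmeasure N)" for f
  proof -
    have "(\<lambda>y. f (\<psi> y) * ennreal ((cmod (L y))\<^sup>2)) \<in> borel_measurable (Cmeasure N)" by measurable
    then have "(\<integral>\<^sup>+x. f (\<psi> (\<phi> x)) * ennreal ((cmod (L (\<phi> x)))\<^sup>2) * ennreal ((cmod (J x))\<^sup>2) \<partial>Cmeasure N)
      = (\<integral>\<^sup>+x. f x \<partial>Cmeasure N)"
      using bspec[OF conjunct2[OF conjunct2[OF assms(1)[unfolded change_of_vars_def]]]]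
        bspec[OF conjunct2[OF conjunct2[OF assms(2)[unfolded change_of_vars_def]]] that] by fastforce
    then show ?thesis by (simp add: norm_mult power_mult_distrib ennreal_mult mult.assoc)
  qed
  then show ?thesis by (auto simp: change_of_vars_def)
qed

lemma change_of_vars_id: "change_of_vars N (\<lambda>x. x) (\<lambda>x. 1)"
  by (simp add: change_of_vars_def)

definition scale_on :: "nat set \<Rightarrow> complex \<Rightarrow> (nat \<Rightarrow> complex) \<Rightarrow> nat \<Rightarrow> complex" where
  "scale_on S c x = (\<lambda>i. if i \<in> S then c * x i else x i)"

text \<open>
  One elementary map for each coordinate in \<open>S\<close>; the factor is unaffected by the earlier ones because it
  does not depend on the coordinates in \<open>S\<close>.
\<close>

lemma change_of_vars_scale:
  assumes "S \<subseteq> {..<N}" and u[measurable]: "u \<in> borel_measurable (Cmeasure N)"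
    and u0: "\<And>x. u x \<noteq> 0"
    and ind: "\<And>x v j. j \<in> S \<Longrightarrow> u (x(j := v)) = u x"
  shows "change_of_vars N (\<lambda>x. scale_on S (u x) x) (\<lambda>x. u x ^ card S)"
proof -
  have "finite S" using assms(1) finite_subset by blast
  then show ?thesis using assms(1) ind
  proof (induction S)
    case empty
    then show ?case by (simp add: scale_on_def change_of_vars_id)
  next
    case (insert j S)
    have inv: "u (scale_on S (u x) x) = u x" for x
    proof -
      have "u (\<lambda>i. if i \<in> T then y i else x i) = u x" if "T \<subseteq> S" for T y
      proof -
        have "finite T" using that insert(1) finite_subset by blast
        then show ?thesis using that
        proof (induction T)
          case (insert k T)
          have "(\<lambda>i. if i \<in> insert k T then y i else x i) = (\<lambda>i. if i \<in> T then y i else x i)(k := y k)"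
            by auto
          then show ?case using insert insert.prems by (simp only:) (use \<open>\<And>x v j. j \<in> Set.insert _ _ \<Longrightarrow> u (x(j := v)) = u x\<close> in auto)
        qed simp
      qed
      from this[of S "\<lambda>i. u x * x i"] show ?thesis by (simp add: scale_on_def)
    qed
    have "change_of_vars N (\<lambda>x. scale_on S (u x) x) (\<lambda>x. u x ^ card S)"
      using insert by auto
    moreover have "change_of_vars N (\<lambda>x. x(j := u x * x j + 0)) u"
      by (rule change_of_vars_elementary) (use insert.prems u0 in \<open>simp_all del: fun_upd_apply\<close>)
    ultimately have "change_of_vars N (\<lambda>x. (scale_on S (u x) x)(j := u (scale_on S (u x) x) * scale_on S (u x) x j + 0))
        (\<lambda>x. u (scale_on S (u x) x) * u x ^ card S)"
      by (rule change_of_vars_comp)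
    moreover have "(scale_on S (u x) x)(j := u x * scale_on S (u x) x j + 0) = scale_on (insert j S) (u x) x" for x
      using insert(2) by (auto simp: scale_on_def)
    ultimately show ?case using insert(1,2) by (simp add: inv)
  qed
qed

lemma change_of_vars_distr:
  assumes "change_of_vars N \<phi> J"
  shows "distr (density (Cmeasure N) (\<lambda>x. ennreal ((cmod (J x))\<^sup>2))) (Cmeasure N) \<phi> = Cmeasure N"
proof (rule measure_eqI)
  have [measurable]: "\<phi> \<in> Cmeasure N \<rightarrow>\<^sub>M Cmeasure N" "J \<in> borel_measurable (Cmeasure N)"
    using assms by (auto simp: change_of_vars_def)
  fix A assume "A \<in> sets (distr (density (Cmeasure N) (\<lambda>x. ennreal ((cmod (J x))\<^sup>2))) (Cmeasure N) \<phi>)"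
  then have A[measurable]: "A \<in> sets (Cmeasure N)" by simp
  have "emeasure (distr (density (Cmeasure N) (\<lambda>x. ennreal ((cmod (J x))\<^sup>2))) (Cmeasure N) \<phi>) A
     = (\<integral>\<^sup>+x. indicator A (\<phi> x) * ennreal ((cmod (J x))\<^sup>2) \<partial>Cmeasure N)"
    by (subst emeasure_distr, simp, simp, subst emeasure_density)
       (auto intro!: nn_integral_cong simp: indicator_def)
  also have "\<dots> = (\<integral>\<^sup>+x. indicator A x \<partial>Cmeasure N)"
    using assms by (auto simp: change_of_vars_def)
  finally show "emeasure (distr (density (Cmeasure N) (\<lambda>x. ennreal ((cmod (J x))\<^sup>2))) (Cmeasure N) \<phi>) A
     = emeasure (Cmeasure N) A" by simp
qed simp

lemma change_of_vars_integral:
  fixes f :: "(nat \<Rightarrow> complex) \<Rightarrow> 'b::{banach, second_countable_topology}"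
  assumes cov: "change_of_vars N \<phi> J" and f[measurable]: "f \<in> borel_measurable (Cmeasure N)"
  shows "integrable (Cmeasure N) (\<lambda>x. (cmod (J x))\<^sup>2 *\<^sub>R f (\<phi> x)) \<longleftrightarrow> integrable (Cmeasure N) f" (is ?A)
    and "(\<integral>x. (cmod (J x))\<^sup>2 *\<^sub>R f (\<phi> x) \<partial>Cmeasure N) = (\<integral>x. f x \<partial>Cmeasure N)" (is ?B)
proof -
  have [measurable]: "\<phi> \<in> Cmeasure N \<rightarrow>\<^sub>M Cmeasure N" "J \<in> borel_measurable (Cmeasure N)"
    using cov by (auto simp: change_of_vars_def)
  show ?A
    by (subst (2) change_of_vars_distr[OF cov, symmetric])
       (simp add: integrable_distr_eq integrable_density)
  show ?B
    by (subst (2) change_of_vars_distr[OF cov, symmetric])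
       (simp add: integral_distr integral_density)
qed

section \<open>Calculus of holomorphic functions of several variables\<close>

text \<open>
  The filter of points of \<open>\<Omega>\<close> that approach \<open>x\<close> (which is itself included). With it the
  differentiability condition is a statement about the Landau class \<open>o\<close>, and the rules of the
  differential calculus follow from the arithmetic of Landau classes.
\<close>

definition near :: "nat \<Rightarrow> (nat \<Rightarrow> complex) set \<Rightarrow> (nat \<Rightarrow> complex) \<Rightarrow> (nat \<Rightarrow> complex) filter" where
  "near N \<Omega> x = inf (filtercomap (\<lambda>y. Cnorm N (\<lambda>i. y i - x i)) (nhds 0)) (principal \<Omega>)"

text \<open>
  The distance is complex-valued because both arguments of a Landau class have the same type.
\<close>

definition Cdist :: "nat \<Rightarrow> (nat \<Rightarrow> complex) \<Rightarrow> (nat \<Rightarrow> complex) \<Rightarrow> complex" where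
  "Cdist N x y = of_real (Cnorm N (\<lambda>i. y i - x i))"

definition has_differential ::
    "nat \<Rightarrow> (nat \<Rightarrow> complex) set \<Rightarrow> (nat \<Rightarrow> complex) \<Rightarrow> ((nat \<Rightarrow> complex) \<Rightarrow> complex) \<Rightarrow> (nat \<Rightarrow> complex) \<Rightarrow> bool" where
  "has_differential N \<Omega> x f a \<longleftrightarrow>
     (\<lambda>y. f y - f x - (\<Sum>i<N. a i * (y i - x i))) \<in> o[near N \<Omega> x](Cdist N x)"

lemma Cnorm_nonneg: "Cnorm N x \<ge> 0"
  by (simp add: Cnorm_def L2_set_nonneg)

lemma Cnorm_power2: "(Cnorm N x)\<^sup>2 = (\<Sum>i<N. (cmod (x i))\<^sup>2)"
  by (simp add: Cnorm_def L2_set_def sum_nonneg)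

lemma cmod_le_Cnorm: "i < N \<Longrightarrow> cmod (x i) \<le> Cnorm N x"
  unfolding Cnorm_def by (rule member_le_L2_set) auto

lemma Cnorm_le_sum: "Cnorm N x \<le> (\<Sum>i<N. cmod (x i))"
  unfolding Cnorm_def by (rule L2_set_le_sum) simp

lemma norm_Cdist [simp]: "norm (Cdist N x y) = Cnorm N (\<lambda>i. y i - x i)"
  by (simp add: Cdist_def Cnorm_nonneg)

lemma eventually_near:
  "eventually P (near N \<Omega> x) \<longleftrightarrow> (\<exists>\<delta>>0. \<forall>y\<in>\<Omega>. Cnorm N (\<lambda>i. y i - x i) < \<delta> \<longrightarrow> P y)"
proof
  assume "eventually P (near N \<Omega> x)"
  then obtain Q where Q: "eventually Q (nhds (0::real))" "\<And>y. Q (Cnorm N (\<lambda>i. y i - x i)) \<Longrightarrow> y \<in> \<Omega> \<longrightarrow> P y"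
    unfolding near_def eventually_inf_principal eventually_filtercomap by blast
  then obtain \<delta> where "\<delta> > 0" "\<And>t. dist t 0 < \<delta> \<Longrightarrow> Q t"
    unfolding eventually_nhds_metric by blast
  then show "\<exists>\<delta>>0. \<forall>y\<in>\<Omega>. Cnorm N (\<lambda>i. y i - x i) < \<delta> \<longrightarrow> P y"
    using Q(2) Cnorm_nonneg by (intro exI[of _ \<delta>]) auto
next
  assume "\<exists>\<delta>>0. \<forall>y\<in>\<Omega>. Cnorm N (\<lambda>i. y i - x i) < \<delta> \<longrightarrow> P y"
  then obtain \<delta> where d: "\<delta> > 0" "\<And>y. y \<in> \<Omega> \<Longrightarrow> Cnorm N (\<lambda>i. y i - x i) < \<delta> \<Longrightarrow> P y" by blast
  have "eventually (\<lambda>t. t < \<delta>) (nhds (0::real))"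
    using d(1) eventually_nhds_in_open[of "{..<\<delta>}" 0] by simp
  then show "eventually P (near N \<Omega> x)"
    unfolding near_def eventually_inf_principal eventually_filtercomap using d(2) by blast
qed

lemma holomorphic_C_iff:
  "holomorphic_C N f \<Omega> \<longleftrightarrow> (\<forall>x\<in>\<Omega>. \<exists>a. has_differential N \<Omega> x f a)"
  unfolding holomorphic_C_def has_differential_def smallo_def mem_Collect_eq eventually_near norm_Cdist
  by (rule refl)

lemma coord_bigo: "i < N \<Longrightarrow> (\<lambda>y. y i - x i) \<in> O[near N \<Omega> x](Cdist N x)"
  by (rule landau_o.bigI[of 1]) (auto intro!: always_eventually cmod_le_Cnorm[of i N "\<lambda>i. _ i - x i"])

lemma has_differential_bigo:
  assumes "has_differential N \<Omega> x f a"
  shows "(\<lambda>y. f y - f x) \<in> O[near N \<Omega> x](Cdist N x)"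
proof -
  have "(\<lambda>y. \<Sum>i<N. a i * (y i - x i)) \<in> O[near N \<Omega> x](Cdist N x)"
  proof (rule big_sum_in_bigo)
    fix i assume "i \<in> {..<N}"
    then show "(\<lambda>y. a i * (y i - x i)) \<in> O[near N \<Omega> x](Cdist N x)"
      using coord_bigo[of i N x \<Omega>] by (cases "a i = 0") auto
  qed
  from sum_in_bigo(1)[OF landau_o.small_imp_big[OF assms[unfolded has_differential_def]] this]
  show ?thesis by simp
qed

lemma tendsto_Cdist: "(Cdist N x \<longlongrightarrow> 0) (near N \<Omega> x)"
proof (rule tendstoI)
  fix e :: real assume "e > 0"
  then show "eventually (\<lambda>y. dist (Cdist N x y) 0 < e) (near N \<Omega> x)"
    by (auto simp: eventually_near)
qed

lemma Cdist_smallo_1: "Cdist N x \<in> o[near N \<Omega> x](\<lambda>_. 1)"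
  by (rule smalloI_tendsto) (simp_all add: tendsto_Cdist)

lemma has_differential_tendsto:
  assumes "has_differential N \<Omega> x f a"
  shows "(f \<longlongrightarrow> f x) (near N \<Omega> x)"
proof -
  have "(\<lambda>y. f y - f x) \<in> o[near N \<Omega> x](\<lambda>_. 1)"
    using landau_o.big_small_trans[OF has_differential_bigo[OF assms] Cdist_smallo_1] .
  from smalloD_tendsto[OF this] have "((\<lambda>y. f y - f x) \<longlongrightarrow> 0) (near N \<Omega> x)" by simp
  then show ?thesis by (rule Lim_null[THEN iffD2])
qed

lemma has_differential_const: "has_differential N \<Omega> x (\<lambda>_. c) (\<lambda>_. 0)"
  by (simp add: has_differential_def)

lemma has_differential_coord:
  assumes "j < N" shows "has_differential N \<Omega> x (\<lambda>y. y j) (\<lambda>i. if i = j then 1 else 0)"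
  using assms by (simp add: has_differential_def if_distrib[of "\<lambda>c. c * _"] sum.delta cong: if_cong)

lemma has_differential_add:
  assumes "has_differential N \<Omega> x f a" "has_differential N \<Omega> x g b"
  shows "has_differential N \<Omega> x (\<lambda>y. f y + g y) (\<lambda>i. a i + b i)"
proof -
  have "f y + g y - (f x + g x) - (\<Sum>i<N. (a i + b i) * (y i - x i))
    = (f y - f x - (\<Sum>i<N. a i * (y i - x i))) + (g y - g x - (\<Sum>i<N. b i * (y i - x i)))" for y
    by (simp add: distrib_right sum.distrib)
  then show ?thesis using sum_in_smallo(1)[OF assms[unfolded has_differential_def]]
    unfolding has_differential_def by (simp only:)
qed

lemma has_differential_mult:
  assumes f: "has_differential N \<Omega> x f a" and g: "has_differential N \<Omega> x g b"
  shows "has_differential N \<Omega> x (\<lambda>y. f y * g y) (\<lambda>i. f x * b i + g x * a i)"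
proof -
  let ?F = "near N \<Omega> x" and ?d = "Cdist N x"
  define R where "R = (\<lambda>y. f y - f x - (\<Sum>i<N. a i * (y i - x i)))"
  define S where "S = (\<lambda>y. g y - g x - (\<Sum>i<N. b i * (y i - x i)))"
  have "R \<in> o[?F](?d)" "S \<in> o[?F](?d)"
    using f g by (auto simp: has_differential_def R_def S_def)
  then have 1: "(\<lambda>y. f x * S y) \<in> o[?F](?d)" "(\<lambda>y. g x * R y) \<in> o[?F](?d)"
    by (auto intro: landau_o.small.cmult_in_iff' simp: landau_o.small.cmult_in_iff')
  have "(\<lambda>y. (f y - f x) * (g y - g x)) \<in> o[?F](\<lambda>y. ?d y * 1)"
    by (rule landau_o.big_small_mult[OF has_differential_bigo[OF f]
         landau_o.big_small_trans[OF has_differential_bigo[OF g] Cdist_smallo_1]])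
  then have 2: "(\<lambda>y. (f y - f x) * (g y - g x)) \<in> o[?F](?d)" by simp
  have "(\<lambda>y. f x * S y + g x * R y + (f y - f x) * (g y - g x)) \<in> o[?F](?d)"
    by (intro sum_in_smallo 1 2)
  moreover have "f x * S y + g x * R y + (f y - f x) * (g y - g x)
     = f y * g y - f x * g x - (\<Sum>i<N. (f x * b i + g x * a i) * (y i - x i))" for y
  proof -
    have "(\<Sum>i<N. (f x * b i + g x * a i) * (y i - x i))
       = f x * (\<Sum>i<N. b i * (y i - x i)) + g x * (\<Sum>i<N. a i * (y i - x i))"
      unfolding sum_distrib_left by (simp add: distrib_right sum.distrib mult.assoc)
    then show ?thesis by (simp add: R_def S_def) (simp add: algebra_simps)
  qed
  ultimately show ?thesis by (simp add: has_differential_def)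
qed

lemma has_differential_compose:
  assumes f: "has_differential N \<Omega> x f a" and h: "(h has_field_derivative h') (at (f x))"
  shows "has_differential N \<Omega> x (\<lambda>y. h (f y)) (\<lambda>i. h' * a i)"
proof -
  let ?F = "near N \<Omega> x" and ?d = "Cdist N x"
  have "(\<lambda>y. h (f y) - h (f x) - h' * (f y - f x)) \<in> o[?F](\<lambda>y. f y - f x)"
  proof (rule landau_o.smallI)
    fix c :: real assume "c > 0"
    then obtain \<delta> where d: "\<delta> > 0" "\<And>w. norm (w - f x) < \<delta> \<Longrightarrow> norm (h w - h (f x) - h' * (w - f x)) \<le> c * norm (w - f x)"
      using h unfolding has_field_derivative_def has_derivative_at_alt by blast
    have "eventually (\<lambda>y. dist (f y) (f x) < \<delta>) ?F"
      using has_differential_tendsto[OF f] d(1) by (rule tendstoD)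
    then show "eventually (\<lambda>y. norm (h (f y) - h (f x) - h' * (f y - f x)) \<le> c * norm (f y - f x)) ?F"
      by eventually_elim (use d(2) in \<open>auto simp: dist_norm\<close>)
  qed
  from landau_o.small_big_trans[OF this has_differential_bigo[OF f]]
  have 1: "(\<lambda>y. h (f y) - h (f x) - h' * (f y - f x)) \<in> o[?F](?d)" .
  have 2: "(\<lambda>y. h' * (f y - f x - (\<Sum>i<N. a i * (y i - x i)))) \<in> o[?F](?d)"
    using f unfolding has_differential_def by (cases "h' = 0") auto
  have "h (f y) - h (f x) - h' * (f y - f x) + h' * (f y - f x - (\<Sum>i<N. a i * (y i - x i)))
    = h (f y) - h (f x) - (\<Sum>i<N. h' * a i * (y i - x i))" for y
    by (simp add: right_diff_distrib sum_distrib_left mult.assoc)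
  with sum_in_smallo(1)[OF 1 2] show ?thesis
    unfolding has_differential_def by (simp only:)
qed

lemma has_differential_chain:
  assumes f: "has_differential N \<Omega>' (\<phi> x) f a"
    and p: "\<And>i. i < N \<Longrightarrow> has_differential N \<Omega> x (\<lambda>y. \<phi> y i) (b i)"
    and map: "\<And>y. y \<in> \<Omega> \<Longrightarrow> \<phi> y \<in> \<Omega>'"
  shows "has_differential N \<Omega> x (\<lambda>y. f (\<phi> y)) (\<lambda>j. \<Sum>i<N. a i * b i j)"
proof -
  let ?F = "near N \<Omega> x" and ?d = "Cdist N x"
  have big: "(\<lambda>y. Cdist N (\<phi> x) (\<phi> y)) \<in> O[?F](?d)"
  proof -
    have "(\<lambda>y. Cdist N (\<phi> x) (\<phi> y)) \<in> O[?F](\<lambda>y. \<Sum>i<N. of_real (cmod (\<phi> y i - \<phi> x i)))"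
    proof (rule landau_o.bigI[of 1])
      show "eventually (\<lambda>y. norm (Cdist N (\<phi> x) (\<phi> y)) \<le> 1 * norm (\<Sum>i<N. complex_of_real (cmod (\<phi> y i - \<phi> x i)))) ?F"
        using Cnorm_le_sum[of N "\<lambda>i. \<phi> _ i - \<phi> x i"]
        by (intro always_eventually) (simp flip: of_real_sum add: sum_nonneg)
    qed simp
    also have "(\<lambda>y. \<Sum>i<N. complex_of_real (cmod (\<phi> y i - \<phi> x i))) \<in> O[?F](?d)"
    proof (rule big_sum_in_bigo)
      fix i assume "i \<in> {..<N}"
      then have "(\<lambda>y. \<phi> y i - \<phi> x i) \<in> O[?F](?d)" using has_differential_bigo[OF p] by simp
      then show "(\<lambda>y. complex_of_real (cmod (\<phi> y i - \<phi> x i))) \<in> O[?F](?d)"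
        by (simp add: bigo_def)
    qed
    finally show ?thesis .
  qed
  have lim: "filterlim \<phi> (near N \<Omega>' (\<phi> x)) ?F"
    unfolding filterlim_iff
  proof (intro allI impI)
    fix P assume "eventually P (near N \<Omega>' (\<phi> x))"
    then obtain \<delta> where d: "\<delta> > 0" "\<And>y. y \<in> \<Omega>' \<Longrightarrow> Cnorm N (\<lambda>i. y i - \<phi> x i) < \<delta> \<Longrightarrow> P y"
      unfolding eventually_near by blast
    have "(\<lambda>y. Cdist N (\<phi> x) (\<phi> y)) \<in> o[?F](\<lambda>_. 1)"
      by (rule landau_o.big_small_trans[OF big Cdist_smallo_1])
    from smalloD_tendsto[OF this] have "((\<lambda>y. Cdist N (\<phi> x) (\<phi> y)) \<longlongrightarrow> 0) ?F" by simp
    from tendstoD[OF this d(1)] have "eventually (\<lambda>y. Cnorm N (\<lambda>i. \<phi> y i - \<phi> x i) < \<delta>) ?F" by simp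
    moreover have "eventually (\<lambda>y. y \<in> \<Omega>) ?F" by (auto simp: eventually_near intro: exI[of _ 1])
    ultimately show "eventually (\<lambda>y. P (\<phi> y)) ?F"
      by eventually_elim (use d(2) map in auto)
  qed
  have "(\<lambda>y. f (\<phi> y) - f (\<phi> x) - (\<Sum>i<N. a i * (\<phi> y i - \<phi> x i))) \<in> o[?F](\<lambda>y. Cdist N (\<phi> x) (\<phi> y))"
    using landau_o.small.compose[OF f[unfolded has_differential_def] lim] .
  from landau_o.small_big_trans[OF this big]
  have 1: "(\<lambda>y. f (\<phi> y) - f (\<phi> x) - (\<Sum>i<N. a i * (\<phi> y i - \<phi> x i))) \<in> o[?F](?d)" .
  have 2: "(\<lambda>y. \<Sum>i<N. a i * (\<phi> y i - \<phi> x i - (\<Sum>j<N. b i j * (y j - x j)))) \<in> o[?F](?d)"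
  proof (rule big_sum_in_smallo)
    fix i assume "i \<in> {..<N}"
    then show "(\<lambda>y. a i * (\<phi> y i - \<phi> x i - (\<Sum>j<N. b i j * (y j - x j)))) \<in> o[?F](?d)"
      using p[of i] unfolding has_differential_def by (cases "a i = 0") auto
  qed
  have "(\<Sum>i<N. a i * (\<phi> y i - \<phi> x i - (\<Sum>j<N. b i j * (y j - x j))))
     = (\<Sum>i<N. a i * (\<phi> y i - \<phi> x i)) - (\<Sum>j<N. (\<Sum>i<N. a i * b i j) * (y j - x j))" for y
  proof -
    have "(\<Sum>i<N. a i * (\<Sum>j<N. b i j * (y j - x j))) = (\<Sum>j<N. (\<Sum>i<N. a i * b i j) * (y j - x j))"
      unfolding sum_distrib_left sum_distrib_right by (subst sum.swap) (simp add: mult.assoc)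
    then show ?thesis by (simp add: right_diff_distrib sum_subtractf)
  qed
  then have "f (\<phi> y) - f (\<phi> x) - (\<Sum>i<N. a i * (\<phi> y i - \<phi> x i))
       + (\<Sum>i<N. a i * (\<phi> y i - \<phi> x i - (\<Sum>j<N. b i j * (y j - x j))))
     = f (\<phi> y) - f (\<phi> x) - (\<Sum>j<N. (\<Sum>i<N. a i * b i j) * (y j - x j))" for y
    by simp
  with sum_in_smallo(1)[OF 1 2] show ?thesis
    unfolding has_differential_def by (simp only:)
qed

lemma holomorphic_C_const: "holomorphic_C N (\<lambda>_. c) \<Omega>"
  unfolding holomorphic_C_iff using has_differential_const by blast

lemma holomorphic_C_coord: "j < N \<Longrightarrow> holomorphic_C N (\<lambda>x. x j) \<Omega>"
  unfolding holomorphic_C_iff using has_differential_coord by blast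

lemma holomorphic_C_add:
  "holomorphic_C N f \<Omega> \<Longrightarrow> holomorphic_C N g \<Omega> \<Longrightarrow> holomorphic_C N (\<lambda>x. f x + g x) \<Omega>"
  unfolding holomorphic_C_iff using has_differential_add by blast

lemma holomorphic_C_mult:
  "holomorphic_C N f \<Omega> \<Longrightarrow> holomorphic_C N g \<Omega> \<Longrightarrow> holomorphic_C N (\<lambda>x. f x * g x) \<Omega>"
  unfolding holomorphic_C_iff using has_differential_mult by blast

lemma holomorphic_C_compose:
  assumes f: "holomorphic_C N f \<Omega>" and h: "h holomorphic_on U" "open U" and "\<And>x. x \<in> \<Omega> \<Longrightarrow> f x \<in> U"
  shows "holomorphic_C N (\<lambda>x. h (f x)) \<Omega>"
  unfolding holomorphic_C_iff
proof
  fix x assume x: "x \<in> \<Omega>"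
  then obtain a where "has_differential N \<Omega> x f a" using f by (auto simp: holomorphic_C_iff)
  from has_differential_compose[OF this holomorphic_derivI[OF h(1,2), of "f x" UNIV]] x assms(4)
  show "\<exists>a. has_differential N \<Omega> x (\<lambda>x. h (f x)) a" by auto
qed

lemma holomorphic_C_chain:
  assumes f: "holomorphic_C N f \<Omega>'" and p: "\<And>i. i < N \<Longrightarrow> holomorphic_C N (\<lambda>y. \<phi> y i) \<Omega>"
    and map: "\<And>y. y \<in> \<Omega> \<Longrightarrow> \<phi> y \<in> \<Omega>'"
  shows "holomorphic_C N (\<lambda>x. f (\<phi> x)) \<Omega>"
  unfolding holomorphic_C_iff
proof
  fix x assume x: "x \<in> \<Omega>"
  obtain a where a: "has_differential N \<Omega>' (\<phi> x) f a" using f map[OF x] by (auto simp: holomorphic_C_iff)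
  have "\<forall>i. \<exists>b. i < N \<longrightarrow> has_differential N \<Omega> x (\<lambda>y. \<phi> y i) b"
    using p x unfolding holomorphic_C_iff by blast
  then obtain b where "\<And>i. i < N \<Longrightarrow> has_differential N \<Omega> x (\<lambda>y. \<phi> y i) (b i)" by metis
  from has_differential_chain[OF a this map]
  show "\<exists>a. has_differential N \<Omega> x (\<lambda>x. f (\<phi> x)) a" by blast
qed

text \<open>
  Holomorphic functions of several variables enter the argument through their restrictions to
  complex lines, to which the one-variable Cauchy theory applies.
\<close>

lemma holomorphic_on_affine_line:
  assumes f: "holomorphic_C N f \<Omega>" and U: "open U"
    and \<gamma>: "\<And>l. l \<in> U \<Longrightarrow> \<gamma> l \<in> \<Omega>" and aff: "\<And>l i. i < N \<Longrightarrow> \<gamma> l i = p i + l * q i"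
  shows "(\<lambda>l. f (\<gamma> l)) holomorphic_on U"
proof (rule holomorphic_onI)
  fix l assume l: "l \<in> U"
  obtain a where a: "\<And>\<epsilon>. \<epsilon> > 0 \<Longrightarrow> \<exists>\<delta>>0. \<forall>y\<in>\<Omega>. Cnorm N (\<lambda>i. y i - \<gamma> l i) < \<delta> \<longrightarrow>
      cmod (f y - f (\<gamma> l) - (\<Sum>i<N. a i * (y i - \<gamma> l i))) \<le> \<epsilon> * Cnorm N (\<lambda>i. y i - \<gamma> l i)"
    using f \<gamma>[OF l] unfolding holomorphic_C_def by blast
  define slope where "slope = (\<Sum>i<N. a i * q i)"
  define C where "C = Cnorm N q + 1"
  have C: "C > 0" using Cnorm_nonneg[of N q] by (simp add: C_def)
  have dist: "Cnorm N (\<lambda>i. \<gamma> l' i - \<gamma> l i) \<le> C * cmod (l' - l)" for l'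
  proof -
    have "Cnorm N (\<lambda>i. \<gamma> l' i - \<gamma> l i) = Cnorm N (\<lambda>i. (l' - l) * q i)"
      unfolding Cnorm_def by (rule L2_set_cong) (auto simp: aff algebra_simps)
    also have "\<dots> = cmod (l' - l) * Cnorm N q"
      by (simp add: Cnorm_def norm_mult L2_set_right_distrib)
    finally show ?thesis by (simp add: C_def algebra_simps)
  qed
  have lin: "(\<Sum>i<N. a i * (\<gamma> l' i - \<gamma> l i)) = slope * (l' - l)" for l'
    unfolding slope_def sum_distrib_right by (rule sum.cong) (auto simp: aff algebra_simps)
  have "((\<lambda>l. f (\<gamma> l)) has_field_derivative slope) (at l within U)"
    unfolding has_field_derivative_def has_derivative_within_alt
  proof (intro conjI allI impI bounded_linear_mult_right)
    fix e :: real assume e: "e > 0"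
    then obtain \<delta> where d: "\<delta> > 0" "\<And>y. y \<in> \<Omega> \<Longrightarrow> Cnorm N (\<lambda>i. y i - \<gamma> l i) < \<delta> \<Longrightarrow>
      cmod (f y - f (\<gamma> l) - (\<Sum>i<N. a i * (y i - \<gamma> l i))) \<le> (e / C) * Cnorm N (\<lambda>i. y i - \<gamma> l i)"
      using a[of "e / C"] C by (meson divide_pos_pos)
    show "\<exists>d>0. \<forall>y\<in>U. norm (y - l) < d \<longrightarrow> norm (f (\<gamma> y) - f (\<gamma> l) - slope * (y - l)) \<le> e * norm (y - l)"
    proof (intro exI[of _ "\<delta> / C"] conjI ballI impI)
      fix y assume y: "y \<in> U" "norm (y - l) < \<delta> / C"
      then have "C * norm (y - l) < \<delta>" using C by (simp add: field_simps)
      then have "Cnorm N (\<lambda>i. \<gamma> y i - \<gamma> l i) < \<delta>" using dist[of y] by simp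
      from d(2)[OF \<gamma>[OF y(1)] this] lin[of y]
      have "norm (f (\<gamma> y) - f (\<gamma> l) - slope * (y - l)) \<le> (e / C) * Cnorm N (\<lambda>i. \<gamma> y i - \<gamma> l i)" by simp
      also have "\<dots> \<le> (e / C) * (C * norm (y - l))"
        using dist[of y] e C by (intro mult_left_mono) auto
      finally show "norm (f (\<gamma> y) - f (\<gamma> l) - slope * (y - l)) \<le> e * norm (y - l)" using C by simp
    qed (use d C in auto)
  qed
  then show "(\<lambda>l. f (\<gamma> l)) field_differentiable at l within U"
    by (auto simp: field_differentiable_def)
qed

lemma continuous_on_Cnorm: "continuous_on UNIV (\<lambda>y. Cnorm N (\<lambda>i. y i - x i))"
  unfolding Cnorm_def L2_set_def by (intro continuous_intros continuous_on_product_coordinates)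

text \<open>
  The function is continuous for the product topology on all functions \<open>nat \<Rightarrow> complex\<close> (after
  restriction of the argument to \<open>{..<N}\<close>), and for a countable index set the Borel sets of that topology are
  those of the product \<open>\<sigma>\<close>-algebra.
\<close>

lemma holomorphic_C_measurable:
  assumes f: "holomorphic_C N f \<Omega>" and op: "open {y. restrict y {..<N} \<in> \<Omega>}" and sub: "\<Omega> \<subseteq> Cspace N"
  shows "(\<lambda>x. indicator \<Omega> x *\<^sub>R f x) \<in> borel_measurable (Cmeasure N)"
proof -
  let ?O = "{y. restrict y {..<N} \<in> \<Omega>}"
  have cont: "continuous_on ?O (\<lambda>y. f (restrict y {..<N}))"
    unfolding continuous_on_def
  proof
    fix x assume x: "x \<in> ?O"
    let ?x = "restrict x {..<N}"
    obtain a where "has_differential N \<Omega> ?x f a" using f x by (auto simp: holomorphic_C_iff)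
    from has_differential_tendsto[OF this] have lim: "(f \<longlongrightarrow> f ?x) (near N \<Omega> ?x)" .
    have eq: "Cnorm N (\<lambda>i. restrict y {..<N} i - restrict x {..<N} i) = Cnorm N (\<lambda>i. y i - x i)" for y
      unfolding Cnorm_def by (rule L2_set_cong) auto
    have "filterlim (\<lambda>y. restrict y {..<N}) (near N \<Omega> ?x) (at x within ?O)"
      unfolding filterlim_iff
    proof (intro allI impI)
      fix P assume "eventually P (near N \<Omega> ?x)"
      then obtain \<delta> where d: "\<delta> > 0" "\<And>y. y \<in> \<Omega> \<Longrightarrow> Cnorm N (\<lambda>i. y i - ?x i) < \<delta> \<Longrightarrow> P y"
        unfolding eventually_near by blast
      have "((\<lambda>y. Cnorm N (\<lambda>i. y i - x i)) \<longlongrightarrow> Cnorm N (\<lambda>i. x i - x i)) (at x within ?O)"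
        by (rule tendsto_within_subset[OF bspec[OF continuous_on_Cnorm[unfolded continuous_on_def] UNIV_I] subset_UNIV])
      moreover have "Cnorm N (\<lambda>i. x i - x i) = 0" by (simp add: Cnorm_def L2_set_def)
      ultimately have "eventually (\<lambda>y. Cnorm N (\<lambda>i. y i - x i) < \<delta>) (at x within ?O)"
        using d(1) by (simp add: order_tendsto_iff)
      moreover have "eventually (\<lambda>y. y \<in> ?O) (at x within ?O)"
        by (simp add: eventually_at_filter)
      ultimately show "eventually (\<lambda>y. P (restrict y {..<N})) (at x within ?O)"
        by eventually_elim (rule d(2), auto simp: eq[simplified])
    qed
    from filterlim_compose[OF lim this]
    show "((\<lambda>y. f (restrict y {..<N})) \<longlongrightarrow> f ?x) (at x within ?O)" .
  qed
  have "(\<lambda>y. indicator ?O y *\<^sub>R f (restrict y {..<N})) \<in> borel_measurable borel"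
    using borel_measurable_continuous_on_indicator[OF _ cont] op by simp
  then have 1: "(\<lambda>y. indicator ?O y *\<^sub>R f (restrict y {..<N})) \<in> borel_measurable (PiM UNIV (\<lambda>_. borel))"
    by (simp cong: measurable_cong_sets add: sets_PiM_equal_borel)
  have "(\<lambda>x i. if i < N then x i else 0) \<in> Cmeasure N \<rightarrow>\<^sub>M PiM UNIV (\<lambda>_::nat. borel :: complex measure)"
  proof (rule measurable_PiM_single')
    fix i :: nat
    show "(\<lambda>x. if i < N then x i else 0) \<in> Cmeasure N \<rightarrow>\<^sub>M borel"
    proof (cases "i < N")
      case True
      then show ?thesis using measurable_coord[OF True] by simp
    qed simp
  qed auto
  from measurable_compose[OF this 1]
  have 2: "(\<lambda>x. indicator ?O (\<lambda>i. if i < N then x i else 0) *\<^sub>R f (restrict (\<lambda>i. if i < N then x i else 0) {..<N})) \<in> borel_measurable (Cmeasure N)" .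
  have "restrict (\<lambda>i. if i < N then x i else 0) {..<N} = x" if "x \<in> space (Cmeasure N)" for x
    using that by (auto simp: Cmeasure_def space_PiM PiE_def extensional_def fun_eq_iff)
  then have "indicator ?O (\<lambda>i. if i < N then x i else 0) *\<^sub>R f (restrict (\<lambda>i. if i < N then x i else 0) {..<N})
     = indicator \<Omega> x *\<^sub>R f x" if "x \<in> space (Cmeasure N)" for x
    using that by (simp add: indicator_def)
  then show ?thesis using 2 by (simp cong: measurable_cong)
qed

section \<open>Averaging over circle actions\<close>

text \<open>
  Cauchy's formula for Taylor coefficients, with the unit circle parametrised by the angle.
\<close>

lemma circle_coefficient:
  fixes h :: "complex \<Rightarrow> complex"
  assumes h: "h holomorphic_on U" and U: "open U" "cball 0 1 \<subseteq> U"
  shows "((\<lambda>t. h (cis t) * cnj (cis t) ^ k) has_integral (2 * pi * ((deriv ^^ k) h 0 / fact k))) {0..2 * pi}"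
    and "continuous_on {0..2 * pi} (\<lambda>t. h (cis t) * cnj (cis t) ^ k)"
proof -
  have "h holomorphic_on cball 0 1" by (rule holomorphic_on_subset[OF h U(2)])
  then have cont: "continuous_on (cball 0 1) h" and hol: "h holomorphic_on ball 0 1"
    by (auto intro: holomorphic_on_imp_continuous_on elim: holomorphic_on_subset)
  have "((\<lambda>u. h u / (u - 0) ^ Suc k) has_contour_integral ((2 * pi * \<i>) / fact k * (deriv ^^ k) h 0)) (circlepath 0 1)"
    using Cauchy_has_contour_integral_higher_derivative_circlepath[OF cont hol, of 0 k] by simp
  then have "((\<lambda>t. h (cis t) / cis t ^ Suc k * \<i> * cis t) has_integral ((2 * pi * \<i>) / fact k * (deriv ^^ k) h 0)) {0..2 * pi}"
    unfolding circlepath_def by (subst (asm) has_contour_integral_part_circlepath_iff) simp_all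
  \<comment> \<open>The speed of the circle is \<open>\<i> * cis t\<close>; the factor \<open>cis t\<close> cancels one power of the denominator.\<close>
  from has_integral_mult_right[OF this, of "- \<i>"]
  have "((\<lambda>t. - \<i> * (h (cis t) / cis t ^ Suc k * \<i> * cis t)) has_integral (- \<i> * ((2 * pi * \<i>) / fact k * (deriv ^^ k) h 0))) {0..2 * pi}" .
  moreover have "- \<i> * (h (cis t) / cis t ^ Suc k * \<i> * cis t) = h (cis t) * cnj (cis t) ^ k" for t
    by (simp add: cis_cnj power_divide flip: cis_inverse) (simp add: field_simps)
  moreover have "- \<i> * ((2 * pi * \<i>) / fact k * (deriv ^^ k) h 0) = 2 * pi * ((deriv ^^ k) h 0 / fact k)"
    by (simp add: mult_ac)
  ultimately show "((\<lambda>t. h (cis t) * cnj (cis t) ^ k) has_integral (2 * pi * ((deriv ^^ k) h 0 / fact k))) {0..2 * pi}"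
    by (simp only:)
  have "continuous_on {0..2 * pi} (\<lambda>t. h (cis t))"
    by (rule continuous_on_compose2[OF cont]) (auto intro!: continuous_intros)
  then show "continuous_on {0..2 * pi} (\<lambda>t. h (cis t) * cnj (cis t) ^ k)"
    by (intro continuous_intros)
qed

lemma measurable_scale_on:
  assumes "S \<subseteq> {..<N}"
  shows "(\<lambda>(t, x). scale_on S (cis t) x) \<in> borel \<Otimes>\<^sub>M Cmeasure N \<rightarrow>\<^sub>M Cmeasure N"
  unfolding Cmeasure_def
proof (rule measurable_PiM_single')
  show "(\<lambda>\<omega>. (case \<omega> of (t, x) \<Rightarrow> scale_on S (cis t) x)) \<in> space (borel \<Otimes>\<^sub>M Pi\<^sub>M {..<N} (\<lambda>_. lborel)) \<rightarrow> (\<Pi>\<^sub>E i\<in>{..<N}. space lborel)"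
    using assms by (auto simp: space_pair_measure space_PiM scale_on_def PiE_def extensional_def)
  fix i assume i: "i \<in> {..<N}"
  have [measurable]: "(\<lambda>t. cis t) \<in> borel_measurable borel"
    by (intro borel_measurable_continuous_onI continuous_intros)
  have "(\<lambda>\<omega>. snd \<omega> i) \<in> borel_measurable (borel \<Otimes>\<^sub>M Pi\<^sub>M {..<N} (\<lambda>_. lborel :: complex measure))"
    using i by measurable
  moreover have "(\<lambda>\<omega>. cis (fst \<omega>)) \<in> borel_measurable (borel \<Otimes>\<^sub>M Pi\<^sub>M {..<N} (\<lambda>_. lborel :: complex measure))"
    by measurable
  ultimately show "(\<lambda>\<omega>. (case \<omega> of (t, x) \<Rightarrow> scale_on S (cis t) x) i) \<in> borel \<Otimes>\<^sub>M Pi\<^sub>M {..<N} (\<lambda>_. lborel) \<rightarrow>\<^sub>M lborel"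
    by (cases "i \<in> S") (simp_all add: scale_on_def case_prod_unfold borel_measurable_times)
qed

text \<open>
  The integral over \<open>\<Omega>\<close> is invariant under each rotation of the coordinates in \<open>S\<close>, hence equal to its
  mean over all of them; by Fubini the mean over the circle can be taken inside.
\<close>

lemma rotation_average:
  fixes G c :: "(nat \<Rightarrow> complex) \<Rightarrow> complex"
  assumes S: "S \<subseteq> {..<N}" and G: "set_integrable (Cmeasure N) \<Omega> G"
    and inv: "\<And>x t. x \<in> space (Cmeasure N) \<Longrightarrow> scale_on S (cis t) x \<in> \<Omega> \<longleftrightarrow> x \<in> \<Omega>"
    and avg: "\<And>x. x \<in> \<Omega> \<Longrightarrow> ((\<lambda>t. G (scale_on S (cis t) x)) has_integral 2 * pi * c x) {0..2 * pi}"
    and cont: "\<And>x. x \<in> \<Omega> \<Longrightarrow> continuous_on {0..2 * pi} (\<lambda>t. G (scale_on S (cis t) x))"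
  shows "set_integrable (Cmeasure N) \<Omega> c" "(LINT x:\<Omega>|Cmeasure N. G x) = (LINT x:\<Omega>|Cmeasure N. c x)"
proof -
  let ?M = "Cmeasure N"
  interpret M: sigma_finite_measure ?M by (rule sigma_finite_Cmeasure)
  interpret P: pair_sigma_finite lborel ?M by standard
  define g where "g x = indicator \<Omega> x *\<^sub>R G x" for x
  have gint: "integrable ?M g" using G unfolding set_integrable_def g_def .
  then have [measurable]: "g \<in> borel_measurable ?M" by auto
  define H where "H t x = indicator {0..2 * pi} t *\<^sub>R g (scale_on S (cis t) x)" for t :: real and x
  have "(\<lambda>(t, x). g (scale_on S (cis t) x)) \<in> borel_measurable (borel \<Otimes>\<^sub>M ?M)"
    using measurable_compose[OF measurable_scale_on[OF S] \<open>g \<in> borel_measurable ?M\<close>]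
    by (simp add: case_prod_unfold)
  then have Hm: "(\<lambda>(t, x). H t x) \<in> borel_measurable (lborel \<Otimes>\<^sub>M ?M)"
  proof -
    assume [measurable]: "(\<lambda>(t, x). g (scale_on S (cis t) x)) \<in> borel_measurable (borel \<Otimes>\<^sub>M ?M)"
    have "(\<lambda>p. indicator {0..2 * pi} (fst p) *\<^sub>R (case p of (t, x) \<Rightarrow> g (scale_on S (cis t) x)))
       \<in> borel_measurable (borel \<Otimes>\<^sub>M ?M)" by measurable
    moreover have "sets (lborel \<Otimes>\<^sub>M ?M) = sets (borel \<Otimes>\<^sub>M ?M)"
      by (rule sets_pair_measure_cong) simp_all
    ultimately show ?thesis unfolding H_def by (simp add: case_prod_unfold cong: measurable_cong_sets)
  qed
  have rot: "change_of_vars N (\<lambda>x. scale_on S (cis t) x) (\<lambda>_. cis t ^ card S)" for t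
    by (rule change_of_vars_scale) (use S in auto)
  have gt: "integrable ?M (\<lambda>x. g (scale_on S (cis t) x))"
    "(\<integral>x. g (scale_on S (cis t) x) \<partial>?M) = (\<integral>x. g x \<partial>?M)" for t
    using change_of_vars_integral[OF rot, of g t] gint by (simp_all add: norm_power)
  have ngt: "(\<integral>x. norm (g (scale_on S (cis t) x)) \<partial>?M) = (\<integral>x. norm (g x) \<partial>?M)" for t
    using change_of_vars_integral(2)[OF rot, of "\<lambda>x. norm (g x)" t] by (simp add: norm_power)
  have Hint: "integrable (lborel \<Otimes>\<^sub>M ?M) (\<lambda>(t, x). H t x)"
  proof (rule P.Fubini_integrable[OF Hm])
    have "(\<lambda>t. \<integral>x. norm (case (t, x) of (t, x) \<Rightarrow> H t x) \<partial>?M) = (\<lambda>t. indicator {0..2 * pi} t *\<^sub>R (\<integral>x. norm (g x) \<partial>?M))"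
      by (simp add: H_def ngt)
    then show "integrable lborel (\<lambda>t. \<integral>x. norm (case (t, x) of (t, x) \<Rightarrow> H t x) \<partial>?M)"
      by (simp add: integrable_scaleR_left integrable_real_indicator)
    show "AE t in lborel. integrable ?M (\<lambda>x. case (t, x) of (t, x) \<Rightarrow> H t x)"
      by (simp add: H_def gt)
  qed
  have inner: "(\<integral>t. H t x \<partial>lborel) = 2 * pi * (indicator \<Omega> x *\<^sub>R c x)" if x: "x \<in> space ?M" for x
  proof (cases "x \<in> \<Omega>")
    case True
    have si: "set_integrable lborel {0..2 * pi} (\<lambda>t. G (scale_on S (cis t) x))"
      by (rule borel_integrable_atLeastAtMost'[OF cont[OF True]])
    have "(\<integral>t. H t x \<partial>lborel) = (LINT t:{0..2 * pi}|lborel. G (scale_on S (cis t) x))"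
      using True inv[OF x] by (simp add: H_def g_def set_lebesgue_integral_def)
    also have "\<dots> = integral {0..2 * pi} (\<lambda>t. G (scale_on S (cis t) x))"
      by (rule set_borel_integral_eq_integral(2)[OF si])
    also have "\<dots> = 2 * pi * c x" using avg[OF True] by (rule integral_unique)
    finally show ?thesis using True by simp
  next
    case False
    then show ?thesis using inv[OF x] by (simp add: H_def g_def)
  qed
  have "integrable ?M (\<lambda>x. \<integral>t. H t x \<partial>lborel)"
    using P.integrable_snd[OF Hint] .
  moreover have "integrable ?M (\<lambda>x. \<integral>t. H t x \<partial>lborel) \<longleftrightarrow> integrable ?M (\<lambda>x. 2 * pi * (indicator \<Omega> x *\<^sub>R c x))"
    by (rule Bochner_Integration.integrable_cong[OF refl inner])
  ultimately have "integrable ?M (\<lambda>x. 2 * pi * (indicator \<Omega> x *\<^sub>R c x))" by (simp only:)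
  then have "integrable ?M (\<lambda>x. of_real (1 / (2 * pi)) * (2 * pi * (indicator \<Omega> x *\<^sub>R c x)))"
    by (rule integrable_mult_right)
  moreover have "of_real (1 / (2 * pi)) * (2 * pi * y) = y" for y :: complex by simp
  ultimately show "set_integrable ?M \<Omega> c" unfolding set_integrable_def by (simp only:)
  have "2 * pi * (\<integral>x. indicator \<Omega> x *\<^sub>R c x \<partial>?M) = (\<integral>x. 2 * pi * (indicator \<Omega> x *\<^sub>R c x) \<partial>?M)"
    by (rule integral_mult_right_zero[symmetric])
  also have "\<dots> = (\<integral>x. (\<integral>t. H t x \<partial>lborel) \<partial>?M)"
    by (rule Bochner_Integration.integral_cong[OF refl inner[symmetric]])
  also have "\<dots> = (\<integral>t. (\<integral>x. H t x \<partial>?M) \<partial>lborel)"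
    by (rule P.Fubini_integral[OF Hint])
  also have "\<dots> = (\<integral>t. indicator {0..2 * pi} t *\<^sub>R (\<integral>x. g x \<partial>?M) \<partial>lborel)"
    by (simp add: H_def gt)
  also have "\<dots> = 2 * pi * (\<integral>x. g x \<partial>?M)"
    by (simp add: scaleR_conv_of_real)
  finally show "(LINT x:\<Omega>|?M. G x) = (LINT x:\<Omega>|?M. c x)"
    by (simp add: set_lebesgue_integral_def g_def)
qed

section \<open>Symmetry of reproducing functions\<close>

text \<open>
  The kernel is Hermitian: evaluate each reproducing function by means of the other. In particular all
  functions that reproduce at \<open>w\<close> take the same value at \<open>x\<close> as soon as some function reproduces at \<open>x\<close>.
\<close>

lemma reproducing_symmetric:
  assumes "reproduces_at N \<Omega> x k" "reproduces_at N \<Omega> w l"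
  shows "l x = cnj (k w)"
proof -
  have "l x = (LINT y:\<Omega>|Cmeasure N. l y * cnj (k y))" "k w = (LINT y:\<Omega>|Cmeasure N. k y * cnj (l y))"
    using assms by (auto simp: reproduces_at_def)
  moreover have "cnj (LINT y:\<Omega>|Cmeasure N. k y * cnj (l y)) = (LINT y:\<Omega>|Cmeasure N. l y * cnj (k y))"
    unfolding set_lebesgue_integral_def by (subst Bochner_Integration.integral_cnj[symmetric]) (simp add: mult.commute)
  ultimately show ?thesis by simp
qed

section \<open>The Fock-Bargmann-Hartogs domain\<close>

locale fock_bargmann_hartogs =
  fixes \<mu> :: real and n m :: nat
  assumes mu: "\<mu> > 0" and m: "m \<ge> 1"
begin

abbreviation "N \<equiv> n + m"
abbreviation "M \<equiv> Cmeasure N"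
abbreviation "\<Omega> \<equiv> D \<mu> n m"

text \<open>
  With \<open>weight\<close> below, the domain is \<open>fibre_sq x < weight x\<close>; the two sides involve disjoint sets of
  coordinates.
\<close>

definition fibre_sq :: "(nat \<Rightarrow> complex) \<Rightarrow> real" where
  "fibre_sq x = (\<Sum>l=n..<N. (cmod (x l))\<^sup>2)"

definition weight :: "(nat \<Rightarrow> complex) \<Rightarrow> real" where
  "weight x = exp (- \<mu> * (\<Sum>l<n. (cmod (x l))\<^sup>2))"

lemma mem_D: "x \<in> \<Omega> \<longleftrightarrow> x \<in> Cspace N \<and> fibre_sq x < weight x"
proof -
  have "(\<Sum>l=n..<N. (cmod (x l))\<^sup>2) = (\<Sum>j<m. (cmod (x (n + j)))\<^sup>2)"
    using sum.shift_bounds_nat_ivl[of "\<lambda>l. (cmod (x l))\<^sup>2" 0 n m]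
    by (simp add: atLeast0LessThan add.commute)
  then show ?thesis by (simp add: D_def fibre_sq_def weight_def Cnorm_power2)
qed

lemma D_subset: "\<Omega> \<subseteq> Cspace N" by (auto simp: mem_D)

lemma measurable_fibre_sq [measurable]: "fibre_sq \<in> borel_measurable M"
  unfolding fibre_sq_def by (intro borel_measurable_sum borel_measurable_power borel_measurable_norm measurable_coord) simp

lemma measurable_weight [measurable]: "weight \<in> borel_measurable M"
proof -
  have "(\<lambda>x. \<Sum>l<n. (cmod (x l))\<^sup>2) \<in> borel_measurable M"
    by (intro borel_measurable_sum borel_measurable_power borel_measurable_norm measurable_coord) simp
  then show ?thesis unfolding weight_def by measurable
qed

lemma sets_D [measurable]: "\<Omega> \<in> sets M"
proof -
  have "\<Omega> = {x \<in> space M. fibre_sq x < weight x}" by (auto simp: mem_D space_Cmeasure)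
  then show ?thesis by simp
qed

lemma weight_pos: "weight x > 0" by (simp add: weight_def)

lemma weight_le_1: "weight x \<le> 1"
  using mu by (simp add: weight_def sum_nonneg)

lemma fibre_coord_lt_1:
  assumes "x \<in> \<Omega>" "i < m" shows "cmod (x (n + i)) < 1"
proof -
  have "(cmod (x (n + i)))\<^sup>2 \<le> fibre_sq x"
    unfolding fibre_sq_def by (rule member_le_sum) (use assms in auto)
  also have "\<dots> < 1" using assms(1) weight_le_1[of x] by (simp add: mem_D)
  finally show ?thesis by (simp add: abs_square_less_1)
qed

lemma open_D: "open {y. restrict y {..<N} \<in> \<Omega>}"
proof -
  have "restrict y {..<N} \<in> \<Omega> \<longleftrightarrow> fibre_sq y < weight y" for y
    by (simp add: mem_D Cspace_def fibre_sq_def weight_def)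
  moreover have "continuous_on UNIV fibre_sq"
    unfolding fibre_sq_def by (intro continuous_intros continuous_on_product_coordinates)
  moreover have "continuous_on UNIV weight"
    unfolding weight_def by (intro continuous_intros continuous_on_product_coordinates)
  ultimately show ?thesis by (simp add: open_Collect_less)
qed

lemma scale_on_Cspace: "S \<subseteq> {..<N} \<Longrightarrow> x \<in> Cspace N \<Longrightarrow> scale_on S c x \<in> Cspace N"
  by (auto simp: Cspace_def scale_on_def PiE_def extensional_def)

lemma scale_on_D:
  assumes "S \<subseteq> {..<N}" "x \<in> \<Omega>" "cmod c \<le> 1"
  shows "scale_on S c x \<in> \<Omega>"
proof -
  have le: "(cmod (scale_on S c x l))\<^sup>2 \<le> (cmod (x l))\<^sup>2" for l
    using assms(3) by (auto simp: scale_on_def norm_mult intro!: power_mono mult_left_le_one_le)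
  have "fibre_sq (scale_on S c x) \<le> fibre_sq x"
    unfolding fibre_sq_def by (intro sum_mono le)
  moreover have "weight x \<le> weight (scale_on S c x)"
    unfolding weight_def using mu by (simp add: sum_mono le)
  ultimately show ?thesis using assms by (auto simp: mem_D scale_on_Cspace)
qed

section \<open>Moments of the fibre coordinates\<close>

definition fibre :: "nat set" where "fibre = {n..<N}"

lemma fibre: "fibre \<subseteq> {..<N}" "card fibre = m" by (auto simp: fibre_def)

lemma fibre_scale:
  "fibre_sq (scale_on fibre c x) = (cmod c)\<^sup>2 * fibre_sq x" "weight (scale_on fibre c x) = weight x"
  by (simp_all add: fibre_sq_def weight_def fibre_def scale_on_def norm_mult power_mult_distrib sum_distrib_left)

text \<open>
  The closed form of \<open>\<integral> \<bar>\<zeta>\<^sub>i\<bar>\<^sup>2\<^sup>k\<close> over the domain.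
\<close>

definition moment :: "nat \<Rightarrow> real" where
  "moment k = pi ^ m * fact k * (pi / (\<mu> * real (m + k))) ^ n / fact (m + k)"

lemma moment_pos: "moment k > 0"
  using mu m by (simp add: moment_def)

text \<open>
  The integrand is a product of one-variable functions.
\<close>

lemma nn_integral_full_gaussian:
  assumes i: "i < m"
  shows "(\<integral>\<^sup>+x. ennreal ((cmod (x (n + i))) ^ (2 * k) * exp (- fibre_sq x) * weight x ^ (m + k)) \<partial>M)
     = ennreal (moment k * fact (m + k))"
proof -
  define f :: "nat \<Rightarrow> complex \<Rightarrow> ennreal" where
    "f l z = (if l < n then ennreal (exp (- (\<mu> * real (m + k) * (cmod z)\<^sup>2)))
       else if l = n + i then ennreal ((cmod z) ^ (2 * k) * exp (- (cmod z)\<^sup>2))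
       else ennreal (exp (- (cmod z)\<^sup>2)))" for l z
  define v where "v l = (if l < n then pi / (\<mu> * real (m + k)) else if l = n + i then pi * fact k else pi)" for l
  have split: "{..<N} = {..<n} \<union> insert (n + i) ({n..<N} - {n + i})" "{..<n} \<inter> insert (n + i) ({n..<N} - {n + i}) = {}"
    using i by auto
  have "(\<Prod>l<N. f l (x l)) = ennreal ((cmod (x (n + i))) ^ (2 * k) * exp (- fibre_sq x) * weight x ^ (m + k))" for x
  proof -
    have 1: "(\<Prod>l<n. f l (x l)) = ennreal (weight x ^ (m + k))"
    proof -
      have "(\<Prod>l<n. f l (x l)) = ennreal (\<Prod>l<n. exp (- (\<mu> * real (m + k) * (cmod (x l))\<^sup>2)))"
        by (simp add: f_def prod_ennreal)
      also have "(\<Prod>l<n. exp (- (\<mu> * real (m + k) * (cmod (x l))\<^sup>2))) = weight x ^ (m + k)"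
        unfolding weight_def exp_sum[symmetric, OF finite_lessThan] exp_of_nat_mult[symmetric]
        by (rule arg_cong[where f=exp]) (simp only: sum_distrib_left, rule sum.cong, simp_all)
      finally show ?thesis .
    qed
    have "(\<Prod>l\<in>{n..<N} - {n + i}. f l (x l)) = ennreal (\<Prod>l\<in>{n..<N} - {n + i}. exp (- (cmod (x l))\<^sup>2))"
      by (simp add: f_def flip: prod_ennreal)
    also have "(\<Prod>l\<in>{n..<N} - {n + i}. exp (- (cmod (x l))\<^sup>2)) = exp (- (\<Sum>l\<in>{n..<N} - {n + i}. (cmod (x l))\<^sup>2))"
      by (simp add: exp_sum sum_negf flip: sum_negf)
    finally have 2: "(\<Prod>l\<in>{n..<N} - {n + i}. f l (x l)) = ennreal (exp (- (\<Sum>l\<in>{n..<N} - {n + i}. (cmod (x l))\<^sup>2)))" .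
    have 3: "fibre_sq x = (cmod (x (n + i)))\<^sup>2 + (\<Sum>l\<in>{n..<N} - {n + i}. (cmod (x l))\<^sup>2)"
      unfolding fibre_sq_def by (rule sum.remove) (use i in auto)
    have 4: "f (n + i) (x (n + i)) = ennreal ((cmod (x (n + i))) ^ (2 * k) * exp (- (cmod (x (n + i)))\<^sup>2))"
      by (simp add: f_def)
    have "(\<Prod>l<N. f l (x l)) = (\<Prod>l<n. f l (x l)) * (f (n + i) (x (n + i)) * (\<Prod>l\<in>{n..<N} - {n + i}. f l (x l)))"
      unfolding split(1) by (subst prod.union_disjoint[OF _ _ split(2)], simp, simp, subst prod.insert) simp_all
    then show ?thesis
      unfolding 1 2 4 by (simp add: 3 exp_add exp_minus exp_diff weight_pos less_imp_le ennreal_mult[symmetric] field_simps)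
  qed
  then have "(\<integral>\<^sup>+x. ennreal ((cmod (x (n + i))) ^ (2 * k) * exp (- fibre_sq x) * weight x ^ (m + k)) \<partial>M)
     = (\<integral>\<^sup>+x. (\<Prod>l<N. f l (x l)) \<partial>M)" by simp
  also have "\<dots> = (\<Prod>l<N. integral\<^sup>N lborel (f l))"
    unfolding Cmeasure_def by (rule Cprod.product_nn_integral_prod) (auto simp: f_def)
  also have "\<dots> = (\<Prod>l<N. ennreal (v l))"
  proof (rule prod.cong[OF refl])
    fix l
    consider "l < n" | "l = n + i" | "\<not> l < n" "l \<noteq> n + i" by blast
    then show "integral\<^sup>N lborel (f l) = ennreal (v l)"
    proof cases
      case 1
      then show ?thesis
        using nn_integral_gaussian[of "\<mu> * real (m + k)"] mu m by (simp add: f_def[abs_def] v_def)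
    next
      case 2
      then show ?thesis using nn_integral_gaussian_moment[of k] by (simp add: f_def[abs_def] v_def)
    next
      case 3
      then show ?thesis using nn_integral_gaussian_moment[of 0] by (simp add: f_def[abs_def] v_def)
    qed
  qed
  also have "\<dots> = ennreal (\<Prod>l<N. v l)"
    using mu m by (intro prod_ennreal) (auto simp: v_def)
  also have "(\<Prod>l<N. v l) = (pi / (\<mu> * real (m + k))) ^ n * (pi * fact k * pi ^ (m - 1))"
    unfolding split(1)
  proof (subst prod.union_disjoint[OF _ _ split(2)], simp, simp, subst prod.insert)
    have "(\<Prod>l\<in>{n..<N} - {n + i}. v l) = (\<Prod>l\<in>{n..<N} - {n + i}. pi)"
      by (rule prod.cong) (auto simp: v_def)
    also have "\<dots> = pi ^ (m - 1)" using i by simp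
    finally show "(\<Prod>l<n. v l) * (v (n + i) * (\<Prod>l\<in>{n..<N} - {n + i}. v l))
      = (pi / (\<mu> * real (m + k))) ^ n * (pi * fact k * pi ^ (m - 1))"
      by (simp add: v_def)
  qed auto
  also have "\<dots> = moment k * fact (m + k)"
  proof -
    have "pi ^ m = pi * pi ^ (m - 1)" using m by (cases m) simp_all
    then show ?thesis unfolding moment_def by simp
  qed
  finally show ?thesis .
qed

text \<open>
  Scaling the fibre by \<open>sqrt s\<close> shows that the moment of \<open>{fibre_sq < s * weight}\<close> is \<open>s\<^sup>m\<^sup>+\<^sup>k\<close> times
  that of the domain. Integrating against \<open>exp (- s)\<close> gives \<open>(m + k)!\<close> times the moment on one side,
  and by Fubini the integral of \<open>\<bar>\<zeta>\<^sub>i\<bar>\<^sup>2\<^sup>k exp (- fibre_sq / weight)\<close> over the whole space on the other.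
  Scaling the fibre by the square root of \<open>weight\<close> turns the latter into the product Gaussian integral.
\<close>

lemma nn_integral_moment:
  assumes i: "i < m"
  shows "(\<integral>\<^sup>+x. ennreal ((cmod (x (n + i))) ^ (2 * k)) * indicator \<Omega> x \<partial>M) = ennreal (moment k)"
    (is "?J = _")
proof -
  have ni [measurable]: "(\<lambda>x. x (n + i)) \<in> borel_measurable M" using i by (intro measurable_coord) simp
  have nif: "n + i \<in> fibre" using i by (simp add: fibre_def)
  let ?p = "\<lambda>x. ennreal ((cmod (x (n + i))) ^ (2 * k))"
  let ?q = "\<lambda>s x. if fibre_sq x < s * weight x then 1 else 0 :: ennreal"
  have J: "?J = (\<integral>\<^sup>+x. ?p x * ?q 1 x \<partial>M)"
    by (rule nn_integral_cong) (auto simp: indicator_def mem_D space_Cmeasure)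
  have 1: "(\<integral>\<^sup>+x. ?p x * ?q s x \<partial>M) = ennreal (s ^ (m + k)) * ?J" if s: "s > 0" for s
  proof -
    have cov: "change_of_vars N (\<lambda>x. scale_on fibre (of_real (sqrt s)) x) (\<lambda>x. of_real (sqrt s) ^ card fibre)"
      by (rule change_of_vars_scale) (use s fibre in auto)
    have "(\<lambda>x. ?p x * ?q s x) \<in> borel_measurable M" by measurable
    then have "(\<integral>\<^sup>+x. ?p x * ?q s x \<partial>M)
       = (\<integral>\<^sup>+x. (?p (scale_on fibre (of_real (sqrt s)) x) * ?q s (scale_on fibre (of_real (sqrt s)) x))
           * ennreal ((cmod (of_real (sqrt s) ^ card fibre))\<^sup>2) \<partial>M)"
      by (rule change_of_vars_nn_integral[OF cov])
    also have "\<dots> = (\<integral>\<^sup>+x. ennreal (s ^ (m + k)) * (?p x * ?q 1 x) \<partial>M)"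
    proof (rule nn_integral_cong)
      fix x
      have a: "(cmod (of_real (sqrt s) ^ card fibre))\<^sup>2 = s ^ m"
      proof -
        have "(sqrt s ^ m)\<^sup>2 = ((sqrt s)\<^sup>2) ^ m"
          unfolding power_mult[symmetric] by (simp add: mult.commute)
        then show ?thesis using s by (simp add: fibre norm_power)
      qed
      have b: "(cmod (scale_on fibre (of_real (sqrt s)) x (n + i))) ^ (2 * k) = s ^ k * (cmod (x (n + i))) ^ (2 * k)"
        using s nif by (simp add: scale_on_def norm_mult power_mult power_mult_distrib)
      have c: "?q s (scale_on fibre (of_real (sqrt s)) x) = ?q 1 x"
        using s by (simp add: fibre_scale)
      show "(?p (scale_on fibre (of_real (sqrt s)) x) * ?q s (scale_on fibre (of_real (sqrt s)) x))
           * ennreal ((cmod (of_real (sqrt s) ^ card fibre))\<^sup>2) = ennreal (s ^ (m + k)) * (?p x * ?q 1 x)"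
        unfolding a b c using s by (simp add: power_add ennreal_mult mult_ac)
    qed
    also have "\<dots> = ennreal (s ^ (m + k)) * ?J"
      unfolding J by (rule nn_integral_cmult) measurable
    finally show ?thesis .
  qed
  interpret M: sigma_finite_measure M by (rule sigma_finite_Cmeasure)
  interpret P: pair_sigma_finite lborel M by standard
  have "ennreal (fact (m + k)) * ?J = (\<integral>\<^sup>+s. ennreal (s ^ (m + k) * exp (- s)) * indicator {0<..} s * ?J \<partial>lborel)"
    by (subst nn_integral_multc) (simp_all add: nn_integral_power_exp_Ioi)
  also have "\<dots> = (\<integral>\<^sup>+s. (\<integral>\<^sup>+x. ennreal (exp (- s)) * indicator {0<..} s * (?p x * ?q s x) \<partial>M) \<partial>lborel)"
  proof (rule nn_integral_cong)
    fix s :: real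
    have "(\<integral>\<^sup>+x. ennreal (exp (- s)) * indicator {0<..} s * (?p x * ?q s x) \<partial>M)
      = ennreal (exp (- s)) * indicator {0<..} s * (\<integral>\<^sup>+x. ?p x * ?q s x \<partial>M)"
      by (rule nn_integral_cmult) measurable
    moreover have "ennreal (s ^ (m + k) * exp (- s)) * indicator {0<..} s * ?J
      = ennreal (exp (- s)) * indicator {0<..} s * (\<integral>\<^sup>+x. ?p x * ?q s x \<partial>M)"
    proof (cases "s > 0")
      case True
      have "ennreal (s ^ (m + k) * exp (- s)) = ennreal (exp (- s)) * ennreal (s ^ (m + k))"
        using True by (simp add: ennreal_mult mult.commute)
      then show ?thesis unfolding 1[OF True] using True by (simp only:) (simp add: mult.assoc)
    qed simp
    ultimately show "ennreal (s ^ (m + k) * exp (- s)) * indicator {0<..} s * ?J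
      = (\<integral>\<^sup>+x. ennreal (exp (- s)) * indicator {0<..} s * (?p x * ?q s x) \<partial>M)"
      by (simp only:)
  qed
  also have "\<dots> = (\<integral>\<^sup>+x. (\<integral>\<^sup>+s. ennreal (exp (- s)) * indicator {0<..} s * (?p x * ?q s x) \<partial>lborel) \<partial>M)"
    by (rule P.Fubini'[symmetric]) measurable
  also have "\<dots> = (\<integral>\<^sup>+x. ?p x * ennreal (exp (- (fibre_sq x / weight x))) \<partial>M)"
  proof (rule nn_integral_cong)
    fix x
    have "(\<integral>\<^sup>+s. ennreal (exp (- s)) * indicator {0<..} s * (?p x * ?q s x) \<partial>lborel)
      = (\<integral>\<^sup>+s. ?p x * (ennreal (exp (- s)) * indicator {fibre_sq x / weight x<..} s) \<partial>lborel)"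
    proof (rule nn_integral_cong)
      fix s :: real
      have "fibre_sq x / weight x \<ge> 0" using weight_pos[of x] by (simp add: fibre_sq_def sum_nonneg)
      moreover have "fibre_sq x < s * weight x \<longleftrightarrow> fibre_sq x / weight x < s"
        using weight_pos[of x] by (simp add: field_simps)
      ultimately show "ennreal (exp (- s)) * indicator {0<..} s * (?p x * ?q s x)
        = ?p x * (ennreal (exp (- s)) * indicator {fibre_sq x / weight x<..} s)"
        by (auto simp: indicator_def mult_ac)
    qed
    also have "\<dots> = ?p x * ennreal (exp (- (fibre_sq x / weight x)))"
      by (subst nn_integral_cmult) (simp_all add: nn_integral_exp_Ioi)
    finally show "(\<integral>\<^sup>+s. ennreal (exp (- s)) * indicator {0<..} s * (?p x * ?q s x) \<partial>lborel)
       = ?p x * ennreal (exp (- (fibre_sq x / weight x)))" .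
  qed
  also have "\<dots> = (\<integral>\<^sup>+x. ennreal ((cmod (x (n + i))) ^ (2 * k) * exp (- fibre_sq x) * weight x ^ (m + k)) \<partial>M)"
  proof -
    \<comment> \<open>Scaling the fibre by \<open>u\<close> removes the denominator from the exponent; the Jacobian and
      \<open>\<bar>\<zeta>\<^sub>i\<bar>\<^sup>2\<^sup>k\<close> contribute the power of the weight.\<close>
    define u where "u x = complex_of_real (sqrt (weight x))" for x
    have [measurable]: "u \<in> borel_measurable M" unfolding u_def by measurable
    have u2: "(cmod (u x))\<^sup>2 = weight x" for x using weight_pos[of x] by (simp add: u_def)
    have cov: "change_of_vars N (\<lambda>x. scale_on fibre (u x) x) (\<lambda>x. u x ^ card fibre)"
    proof (rule change_of_vars_scale)
      show "u x \<noteq> 0" for x using weight_pos[of x] by (simp add: u_def)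
      show "u (x(j := v)) = u x" if "j \<in> fibre" for x v j
        using that by (simp add: u_def weight_def fibre_def)
    qed (use fibre in auto)
    have "(\<lambda>x. ?p x * ennreal (exp (- (fibre_sq x / weight x)))) \<in> borel_measurable M" by measurable
    then have "(\<integral>\<^sup>+x. ?p x * ennreal (exp (- (fibre_sq x / weight x))) \<partial>M)
      = (\<integral>\<^sup>+x. (?p (scale_on fibre (u x) x) * ennreal (exp (- (fibre_sq (scale_on fibre (u x) x) / weight (scale_on fibre (u x) x)))))
           * ennreal ((cmod (u x ^ card fibre))\<^sup>2) \<partial>M)"
      by (rule change_of_vars_nn_integral[OF cov])
    also have "\<dots> = (\<integral>\<^sup>+x. ennreal ((cmod (x (n + i))) ^ (2 * k) * exp (- fibre_sq x) * weight x ^ (m + k)) \<partial>M)"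
    proof (rule nn_integral_cong)
      fix x
      have a: "(cmod (u x ^ card fibre))\<^sup>2 = weight x ^ m"
        by (simp add: fibre norm_power flip: u2 power_mult) (simp add: mult.commute)
      have b: "(cmod (scale_on fibre (u x) x (n + i))) ^ (2 * k) = weight x ^ k * (cmod (x (n + i))) ^ (2 * k)"
        using nif by (simp add: scale_on_def norm_mult power_mult power_mult_distrib u2)
      have c: "fibre_sq (scale_on fibre (u x) x) / weight (scale_on fibre (u x) x) = fibre_sq x"
        using weight_pos[of x] by (simp add: fibre_scale u2)
      show "(?p (scale_on fibre (u x) x) * ennreal (exp (- (fibre_sq (scale_on fibre (u x) x) / weight (scale_on fibre (u x) x)))))
           * ennreal ((cmod (u x ^ card fibre))\<^sup>2)
        = ennreal ((cmod (x (n + i))) ^ (2 * k) * exp (- fibre_sq x) * weight x ^ (m + k))"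
        unfolding a b c using weight_pos[of x]
        by (simp add: power_add ennreal_mult[symmetric] mult_ac less_imp_le)
    qed
    finally show ?thesis .
  qed
  also have "\<dots> = ennreal (moment k * fact (m + k))" by (rule nn_integral_full_gaussian[OF i])
  finally have eq: "ennreal (fact (m + k)) * ?J = ennreal (moment k * fact (m + k))" .
  have "ennreal (1 / fact (m + k)) * ennreal (fact (m + k)) = 1" by (simp flip: ennreal_mult)
  then show ?thesis using arg_cong[OF eq, of "\<lambda>z. ennreal (1 / fact (m + k)) * z"] moment_pos[of k]
    by (simp flip: mult.assoc) (simp add: less_imp_le flip: ennreal_mult)
qed

section \<open>The Bergman space of the domain\<close>

lemma finite_volume: "emeasure M \<Omega> < \<infinity>"
proof -
  have "emeasure M \<Omega> = (\<integral>\<^sup>+x. indicator \<Omega> x \<partial>M)" by simp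
  also have "\<dots> = ennreal (moment 0)" using nn_integral_moment[of 0 0] m by simp
  finally show ?thesis by simp
qed

lemma const_set_integrable: "set_integrable M \<Omega> (\<lambda>_. c :: real)"
  using finite_volume by (simp add: set_integrable_def)

lemma bergman_measurable:
  "f \<in> bergman_space N \<Omega> \<Longrightarrow> (\<lambda>x. indicator \<Omega> x *\<^sub>R f x) \<in> borel_measurable M"
  by (rule holomorphic_C_measurable) (auto simp: bergman_space_def open_D D_subset)

text \<open>
  The domain has finite volume and \<open>t \<le> 1 + t\<^sup>2\<close>.
\<close>

lemma bergman_set_integrable:
  assumes "f \<in> bergman_space N \<Omega>" shows "set_integrable M \<Omega> f"
proof -
  have "set_integrable M \<Omega> (\<lambda>x. 1 + (cmod (f x))\<^sup>2)"
    using assms const_set_integrable by (intro set_integral_add) (auto simp: bergman_space_def)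
  then show ?thesis unfolding set_integrable_def
  proof (rule Bochner_Integration.integrable_bound)
    show "(\<lambda>x. indicator \<Omega> x *\<^sub>R f x) \<in> borel_measurable M" by (rule bergman_measurable[OF assms])
    have "t \<le> 1 + t\<^sup>2" for t :: real by (sos)
    then show "AE x in M. norm (indicator \<Omega> x *\<^sub>R f x) \<le> norm (indicator \<Omega> x *\<^sub>R (1 + (cmod (f x))\<^sup>2))"
      by (intro AE_I2) (auto simp: indicator_def)
  qed
qed

lemma bounded_holomorphic_bergman:
  assumes "holomorphic_C N f \<Omega>" "\<And>x. x \<in> \<Omega> \<Longrightarrow> cmod (f x) \<le> B"
  shows "f \<in> bergman_space N \<Omega>"
proof -
  have [measurable]: "(\<lambda>x. indicator \<Omega> x *\<^sub>R f x) \<in> borel_measurable M"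
    by (rule holomorphic_C_measurable[OF assms(1) open_D D_subset])
  have eq: "indicator \<Omega> x *\<^sub>R (cmod (f x))\<^sup>2 = (cmod (indicator \<Omega> x *\<^sub>R f x))\<^sup>2" for x
    by (simp add: indicator_def)
  have "set_integrable M \<Omega> (\<lambda>_. B\<^sup>2)" by (rule const_set_integrable)
  then have "set_integrable M \<Omega> (\<lambda>x. (cmod (f x))\<^sup>2)"
    unfolding set_integrable_def
  proof (rule Bochner_Integration.integrable_bound)
    show "(\<lambda>x. indicator \<Omega> x *\<^sub>R (cmod (f x))\<^sup>2) \<in> borel_measurable M" unfolding eq by measurable
    show "AE x in M. norm (indicator \<Omega> x *\<^sub>R (cmod (f x))\<^sup>2) \<le> norm (indicator \<Omega> x *\<^sub>R B\<^sup>2)"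
      using assms(2) by (intro AE_I2) (auto simp: indicator_def intro!: power_mono)
  qed
  then show ?thesis using assms(1) by (simp add: bergman_space_def)
qed

section \<open>The kernel at the base points\<close>

text \<open>
  The point \<open>(0, r e\<^sub>i)\<close>.
\<close>

definition base_point :: "nat \<Rightarrow> complex \<Rightarrow> nat \<Rightarrow> complex" where
  "base_point i r = (\<lambda>l. if l < N then (if l = n + i then r else 0) else undefined)"

lemma base_point_D: "i < m \<Longrightarrow> base_point i r \<in> \<Omega> \<longleftrightarrow> cmod r < 1"
proof -
  assume i: "i < m"
  have "fibre_sq (base_point i r) = (\<Sum>l\<in>{n..<N}. if l = n + i then (cmod r)\<^sup>2 else 0)"
    unfolding fibre_sq_def by (rule sum.cong) (auto simp: base_point_def)
  also have "\<dots> = (cmod r)\<^sup>2" using i by (subst sum.delta) auto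
  finally have "fibre_sq (base_point i r) = (cmod r)\<^sup>2" .
  moreover have "weight (base_point i r) = 1" using i by (simp add: weight_def base_point_def)
  moreover have "base_point i r \<in> Cspace N" by (auto simp: base_point_def Cspace_def PiE_def extensional_def)
  ultimately show ?thesis by (simp add: mem_D abs_square_less_1)
qed

lemma slice_holomorphic:
  assumes f: "holomorphic_C N f \<Omega>" and i: "i < m"
  shows "(\<lambda>r. f (base_point i r)) holomorphic_on ball 0 1"
  by (rule holomorphic_on_affine_line[OF f, where p = "\<lambda>_. 0" and q = "\<lambda>l. if l = n + i then 1 else 0"])
     (use i in \<open>auto simp: base_point_D, auto simp: base_point_def\<close>)

lemma rotation_invariant:
  assumes S: "S \<subseteq> {..<N}" and x: "x \<in> space M"
  shows "scale_on S (cis t) x \<in> \<Omega> \<longleftrightarrow> x \<in> \<Omega>"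
proof
  assume "scale_on S (cis t) x \<in> \<Omega>"
  then have "scale_on S (cis (- t)) (scale_on S (cis t) x) \<in> \<Omega>" by (rule scale_on_D[OF S]) simp
  moreover have "scale_on S (cis (- t)) (scale_on S (cis t) x) = x"
    by (auto simp: scale_on_def cis_mult simp flip: mult.assoc)
  ultimately show "x \<in> \<Omega>" by simp
qed (use S in \<open>auto intro: scale_on_D\<close>)

text \<open>
  Multiplying some coordinates by a number of modulus at most \<open>1\<close> stays in the domain, and
  the domain is open, so the orbit of a point is defined and holomorphic slightly beyond the closed unit disc.
\<close>

lemma orbit_holomorphic:
  assumes f: "holomorphic_C N f \<Omega>" and S: "S \<subseteq> {..<N}" and x: "x \<in> \<Omega>"
  obtains U where "open U" "cball 0 1 \<subseteq> U" "(\<lambda>c. f (scale_on S c x)) holomorphic_on U"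
proof
  let ?U = "{c. scale_on S c x \<in> \<Omega>}"
  have eq: "restrict (scale_on S c x) {..<N} = scale_on S c x" for c
    using S x D_subset by (auto simp: scale_on_def Cspace_def PiE_def extensional_def fun_eq_iff)
  have "continuous_on UNIV (\<lambda>c. scale_on S c x)"
  proof (rule continuous_on_coordinatewise_then_product)
    show "continuous_on UNIV (\<lambda>c. scale_on S c x l)" for l
      by (cases "l \<in> S") (auto simp: scale_on_def intro!: continuous_intros)
  qed
  then have "open ((\<lambda>c. scale_on S c x) -` {y. restrict y {..<N} \<in> \<Omega>})"
    by (rule open_vimage[OF open_D])
  moreover have "(\<lambda>c. scale_on S c x) -` {y. restrict y {..<N} \<in> \<Omega>} = ?U" by (auto simp: eq)
  ultimately show "open ?U" by simp
  show "cball 0 1 \<subseteq> ?U" using scale_on_D[OF S x] by auto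
  show "(\<lambda>c. f (scale_on S c x)) holomorphic_on ?U"
    by (rule holomorphic_on_affine_line[OF f \<open>open ?U\<close>, where p = "\<lambda>l. if l \<in> S then 0 else x l" and q = "\<lambda>l. if l \<in> S then x l else 0"])
       (auto simp: scale_on_def)
qed

text \<open>
  Two averages. Rotating all coordinates but \<open>\<zeta>\<^sub>i\<close> leaves \<open>cnj \<zeta>\<^sub>i\<^sup>k\<close> alone and replaces \<open>f\<close> by its value
  at the centre of the orbit, a base point. Rotating \<open>\<zeta>\<^sub>i\<close> then selects the Taylor coefficient
  of order \<open>k\<close> along the base points, and a multiple of \<open>\<bar>\<zeta>\<^sub>i\<bar>\<^sup>2\<^sup>k\<close> remains.
\<close>

lemma pairing_with_power:
  assumes f: "f \<in> bergman_space N \<Omega>" and i: "i < m"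
  shows "set_integrable M \<Omega> (\<lambda>x. f x * cnj (x (n + i)) ^ k)"
    and "(LINT x:\<Omega>|M. f x * cnj (x (n + i)) ^ k) = (deriv ^^ k) (\<lambda>r. f (base_point i r)) 0 / fact k * moment k"
proof -
  have hf: "holomorphic_C N f \<Omega>" using f by (simp add: bergman_space_def)
  have [measurable]: "(\<lambda>x. x (n + i)) \<in> borel_measurable M" using i by (intro measurable_coord) simp
  let ?g = "\<lambda>r. f (base_point i r)"
  let ?S = "{..<N} - {n + i}"
  show int: "set_integrable M \<Omega> (\<lambda>x. f x * cnj (x (n + i)) ^ k)"
  proof -
    have eq: "(\<lambda>x. indicator \<Omega> x *\<^sub>R (f x * cnj (x (n + i)) ^ k)) = (\<lambda>x. (indicator \<Omega> x *\<^sub>R f x) * cnj (x (n + i)) ^ k)"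
      by auto
    show ?thesis using bergman_set_integrable[OF f] unfolding set_integrable_def
    proof (rule Bochner_Integration.integrable_bound)
      have "(\<lambda>x. cnj (x (n + i))) \<in> borel_measurable M"
        using i by (intro measurable_compose[OF measurable_coord borel_measurable_continuous_onI] continuous_intros) auto
      then show "(\<lambda>x. indicator \<Omega> x *\<^sub>R (f x * cnj (x (n + i)) ^ k)) \<in> borel_measurable M"
        unfolding eq by (intro borel_measurable_times borel_measurable_power bergman_measurable[OF f])
      show "AE x in M. norm (indicator \<Omega> x *\<^sub>R (f x * cnj (x (n + i)) ^ k)) \<le> norm (indicator \<Omega> x *\<^sub>R f x)"
      proof (rule AE_I2)
        fix x
        have "cmod (f x) * cmod (x (n + i)) ^ k \<le> cmod (f x)" if "x \<in> \<Omega>"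
          using fibre_coord_lt_1[OF that i] by (intro mult_right_le_one_le power_le_one) auto
        then show "norm (indicator \<Omega> x *\<^sub>R (f x * cnj (x (n + i)) ^ k)) \<le> norm (indicator \<Omega> x *\<^sub>R f x)"
          by (cases "x \<in> \<Omega>") (simp_all add: norm_mult norm_power)
      qed
    qed
  qed
  define G where "G x = ?g (x (n + i)) * cnj (x (n + i)) ^ k" for x
  have step1: "set_integrable M \<Omega> G" "(LINT x:\<Omega>|M. f x * cnj (x (n + i)) ^ k) = (LINT x:\<Omega>|M. G x)"
  proof -
    have S: "?S \<subseteq> {..<N}" by auto
    have inv: "scale_on ?S c x (n + i) = x (n + i)" for c x by (simp add: scale_on_def)
    have zero: "scale_on ?S 0 x = base_point i (x (n + i))" if "x \<in> \<Omega>" for x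
      using that D_subset i by (auto simp: scale_on_def base_point_def Cspace_def PiE_def extensional_def fun_eq_iff)
    have "((\<lambda>t. f (scale_on ?S (cis t) x) * cnj (scale_on ?S (cis t) x (n + i)) ^ k) has_integral 2 * pi * G x) {0..2 * pi}
       \<and> continuous_on {0..2 * pi} (\<lambda>t. f (scale_on ?S (cis t) x) * cnj (scale_on ?S (cis t) x (n + i)) ^ k)"
      if x: "x \<in> \<Omega>" for x
    proof -
      obtain U where U: "open U" "cball 0 1 \<subseteq> U" "(\<lambda>c. f (scale_on ?S c x)) holomorphic_on U"
        using orbit_holomorphic[OF hf S x] .
      from circle_coefficient[OF U(3,1,2), of 0] zero[OF x]
      have 1: "((\<lambda>t. f (scale_on ?S (cis t) x)) has_integral 2 * pi * ?g (x (n + i))) {0..2 * pi}"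
        and 2: "continuous_on {0..2 * pi} (\<lambda>t. f (scale_on ?S (cis t) x))" by simp_all
      show ?thesis unfolding inv G_def using has_integral_mult_left[OF 1, of "cnj (x (n + i)) ^ k"]
        by (auto intro!: continuous_intros 2 simp: mult.assoc)
    qed
    from rotation_average[OF S int rotation_invariant[OF S], of G] this
    show "set_integrable M \<Omega> G" "(LINT x:\<Omega>|M. f x * cnj (x (n + i)) ^ k) = (LINT x:\<Omega>|M. G x)"
      by blast+
  qed
  have S: "{n + i} \<subseteq> {..<N}" using i by auto
  have hg: "?g holomorphic_on ball 0 1" by (rule slice_holomorphic[OF hf i])
  define a where "a = (deriv ^^ k) ?g 0 / fact k"
  define G' where "G' x = a * of_real ((cmod (x (n + i))) ^ (2 * k))" for x :: "nat \<Rightarrow> complex"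
  have rot: "((\<lambda>t. G (scale_on {n + i} (cis t) x)) has_integral 2 * pi * G' x) {0..2 * pi}
       \<and> continuous_on {0..2 * pi} (\<lambda>t. G (scale_on {n + i} (cis t) x))"
    if x: "x \<in> \<Omega>" for x
  proof -
    define z where "z = x (n + i)"
    have z: "cmod z < 1" using fibre_coord_lt_1[OF x i] by (simp add: z_def)
    define U where "U = {c. z * c \<in> ball 0 1}"
    have U: "open U"
    proof -
      have "open ((\<lambda>c. z * c) -` ball 0 1)" by (intro continuous_open_vimage) (auto intro!: continuous_intros)
      then show ?thesis by (simp add: U_def vimage_def)
    qed
    have "cball 0 1 \<subseteq> U"
    proof
      fix c :: complex assume "c \<in> cball 0 1"
      then have "cmod z * cmod c \<le> cmod z * 1" by (intro mult_left_mono) auto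
      then show "c \<in> U" using z by (simp add: U_def norm_mult)
    qed
    note U = U this
    have hol: "(\<lambda>c. ?g (z * c)) holomorphic_on U"
    proof -
      have "(?g \<circ> (\<lambda>c. z * c)) holomorphic_on U"
        by (rule holomorphic_on_compose_gen[OF _ hg]) (auto simp: U_def intro!: holomorphic_intros)
      then show ?thesis by (simp only: o_def)
    qed
    have der: "(deriv ^^ k) (\<lambda>c. ?g (z * c)) 0 = z ^ k * (deriv ^^ k) ?g (z * 0)"
      by (rule higher_deriv_compose_linear[OF hg U(1) open_ball]) (use U(2) in \<open>auto simp: U_def\<close>)
    have eq: "G (scale_on {n + i} (cis t) x) = ?g (z * cis t) * cnj (cis t) ^ k * cnj z ^ k" for t
      by (simp add: G_def scale_on_def z_def power_mult_distrib mult_ac)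
    have "cnj z ^ k * z ^ k = of_real (cmod z ^ (2 * k))"
    proof -
      have "complex_of_real (cmod z ^ (2 * k)) = (complex_of_real ((cmod z)\<^sup>2)) ^ k" by (simp add: power_mult)
      also have "\<dots> = (z * cnj z) ^ k" unfolding complex_norm_square ..
      finally show ?thesis by (simp add: power_mult_distrib mult.commute)
    qed
    then have G': "G' x = a * (cnj z ^ k * z ^ k)" unfolding G'_def z_def by (simp only:)
    have val: "2 * pi * ((deriv ^^ k) (\<lambda>c. ?g (z * c)) 0 / fact k) * cnj z ^ k = 2 * pi * G' x"
      unfolding der G' a_def by simp
    show ?thesis unfolding eq
      using has_integral_mult_left[OF circle_coefficient(1)[OF hol U, of k], of "cnj z ^ k"] circle_coefficient(2)[OF hol U, of k]
      unfolding val by (auto intro!: continuous_intros)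
  qed
  have "(LINT x:\<Omega>|M. G x) = (LINT x:\<Omega>|M. G' x)"
    using rotation_average(2)[OF S step1(1) rotation_invariant[OF S], of G'] rot by blast
  also have "\<dots> = a * of_real (LINT x:\<Omega>|M. (cmod (x (n + i))) ^ (2 * k))"
  proof -
    have "indicator \<Omega> x *\<^sub>R G' x = a * of_real (indicator \<Omega> x *\<^sub>R (cmod (x (n + i))) ^ (2 * k))" for x
      by (simp add: G'_def indicator_def)
    then show ?thesis
      unfolding set_lebesgue_integral_def by (simp only: integral_mult_right_zero integral_complex_of_real)
  qed
  also have "(LINT x:\<Omega>|M. (cmod (x (n + i))) ^ (2 * k)) = moment k"
    unfolding set_lebesgue_integral_def
  proof (subst integral_eq_nn_integral)
    have "(\<integral>\<^sup>+x. ennreal (indicator \<Omega> x *\<^sub>R (cmod (x (n + i))) ^ (2 * k)) \<partial>M)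
      = (\<integral>\<^sup>+x. ennreal ((cmod (x (n + i))) ^ (2 * k)) * indicator \<Omega> x \<partial>M)"
      by (rule nn_integral_cong) (auto simp: indicator_def)
    then show "enn2real (\<integral>\<^sup>+x. ennreal (indicator \<Omega> x *\<^sub>R (cmod (x (n + i))) ^ (2 * k)) \<partial>M) = moment k"
      using nn_integral_moment[OF i] moment_pos[of k] by simp
  qed auto
  finally show "(LINT x:\<Omega>|M. f x * cnj (x (n + i)) ^ k) = (deriv ^^ k) ?g 0 / fact k * moment k"
    using step1(2) by (simp add: a_def)
qed

text \<open>
  The constant is fixed by \<open>moment_eq\<close>: it makes the coefficients of the kernel at a base point the
  inverses of the moments.
\<close>

definition kernel_const :: real where
  "kernel_const = (\<mu> / pi) ^ n * fact m / pi ^ m"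

lemma kernel_const_pos: "kernel_const > 0" using mu by (simp add: kernel_const_def)

lemma moment_eq: "kernel_const * real ((m + k) ^ n * ((m + k) choose m)) * moment k = 1"
proof -
  define q where "q = real ((m + k) choose m)"
  have q: "q > 0" unfolding q_def by simp
  have "fact m * fact k * ((m + k) choose m) = (fact (m + k) :: nat)"
    using binomial_fact_lemma[of m "m + k"] by simp
  then have "real (fact m * fact k * ((m + k) choose m)) = real (fact (m + k))" by (simp only:)
  then have fact: "fact (m + k) = q * fact m * fact k"
    unfolding q_def of_nat_mult of_nat_fact by (simp only: mult_ac)
  have "(\<mu> / pi) ^ n * real (m + k) ^ n * (pi / (\<mu> * real (m + k))) ^ n = 1"
    using mu m by (simp flip: power_mult_distrib)
  moreover have "fact m / pi ^ m * q * (pi ^ m * fact k / (q * fact m * fact k)) = 1"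
    using q by simp
  ultimately have "((\<mu> / pi) ^ n * real (m + k) ^ n * (pi / (\<mu> * real (m + k))) ^ n)
     * (fact m / pi ^ m * q * (pi ^ m * fact k / (q * fact m * fact k))) = 1" by (simp only: mult_1)
  then show ?thesis
    unfolding kernel_const_def moment_def fact of_nat_mult of_nat_power q_def[symmetric]
    by (simp only: times_divide_eq_left times_divide_eq_right mult_ac)
qed

definition base_kernel :: "nat \<Rightarrow> complex \<Rightarrow> (nat \<Rightarrow> complex) \<Rightarrow> complex" where
  "base_kernel i r x = of_real kernel_const * profile n m (cnj r * x (n + i))"

lemma base_kernel_arg:
  assumes "x \<in> \<Omega>" "i < m" "cmod r < 1" shows "cmod (cnj r * x (n + i)) \<le> cmod r"
  using mult_left_mono[OF less_imp_le[OF fibre_coord_lt_1[OF assms(1,2)]], of "cmod r"] by (simp add: norm_mult)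

lemma base_kernel_bergman:
  assumes i: "i < m" and r: "cmod r < 1"
  shows "base_kernel i r \<in> bergman_space N \<Omega>"
proof -
  have "holomorphic_C N (\<lambda>x. profile n m (cnj r * x (n + i))) \<Omega>"
  proof (rule holomorphic_C_compose[OF _ profile_holomorphic open_ball])
    show "holomorphic_C N (\<lambda>x. cnj r * x (n + i)) \<Omega>"
      using i by (intro holomorphic_C_mult holomorphic_C_const holomorphic_C_coord) simp
    show "cnj r * x (n + i) \<in> ball 0 1" if "x \<in> \<Omega>" for x
      using base_kernel_arg[OF that i r] r by simp
  qed
  then have hol: "holomorphic_C N (base_kernel i r) \<Omega>"
    unfolding base_kernel_def by (intro holomorphic_C_mult holomorphic_C_const)
  have "continuous_on (cball 0 (cmod r)) (profile n m)"
    using r by (intro holomorphic_on_imp_continuous_on holomorphic_on_subset[OF profile_holomorphic]) auto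
  then have "bounded (profile n m ` cball 0 (cmod r))"
    by (intro compact_imp_bounded compact_continuous_image) auto
  then obtain B where B: "\<And>t. t \<in> cball 0 (cmod r) \<Longrightarrow> cmod (profile n m t) \<le> B"
    unfolding bounded_iff by blast
  have "cmod (base_kernel i r x) \<le> kernel_const * B" if "x \<in> \<Omega>" for x
    using B base_kernel_arg[OF that i r] kernel_const_pos
    by (simp add: base_kernel_def norm_mult)
  with hol show ?thesis by (rule bounded_holomorphic_bergman)
qed

text \<open>
  Expanding the kernel in powers of \<open>cnj r * \<zeta>\<^sub>i\<close>, each term pairs with \<open>f\<close> to a term of the Taylor series
  of \<open>f\<close> along the base points, evaluated at \<open>r\<close>. Integration term by term is justified since
  \<open>f\<close> is integrable and \<open>\<bar>\<zeta>\<^sub>i\<bar> < 1\<close> leaves a convergent series in \<open>\<bar>r\<bar>\<close>.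
\<close>

lemma base_kernel_reproduces:
  assumes i: "i < m" and r: "cmod r < 1"
  shows "reproduces_at N \<Omega> (base_point i r) (base_kernel i r)"
  unfolding reproduces_at_def
proof (intro conjI ballI base_kernel_bergman[OF i r])
  fix f assume f: "f \<in> bergman_space N \<Omega>"
  have hf: "holomorphic_C N f \<Omega>" using f by (simp add: bergman_space_def)
  let ?g = "\<lambda>r. f (base_point i r)"
  define a where "a k = kernel_const * real ((m + k) ^ n * ((m + k) choose m))" for k
  have a0: "a k \<ge> 0" for k using kernel_const_pos by (simp add: a_def)
  define F where "F k x = indicator \<Omega> x *\<^sub>R (of_real (a k) * r ^ k * (f x * cnj (x (n + i)) ^ k))" for k x
  have Fint: "integrable M (F k)" for k
    using pairing_with_power(1)[OF f i, of k] unfolding set_integrable_def F_def mult_scaleR_right[symmetric]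
    by (rule integrable_mult_right)
  have Fval: "(\<integral>x. F k x \<partial>M) = (deriv ^^ k) ?g 0 / fact k * (r - 0) ^ k" for k
  proof -
    have "(\<integral>x. F k x \<partial>M) = of_real (a k) * r ^ k * (LINT x:\<Omega>|M. f x * cnj (x (n + i)) ^ k)"
      unfolding F_def set_lebesgue_integral_def by (simp flip: integral_mult_right_zero)
    also have "\<dots> = of_real (a k * moment k) * ((deriv ^^ k) ?g 0 / fact k * r ^ k)"
      unfolding pairing_with_power(2)[OF f i] by simp
    also have "a k * moment k = 1" unfolding a_def by (rule moment_eq)
    finally show ?thesis by simp
  qed
  have Fsum: "(\<lambda>k. F k x) sums (indicator \<Omega> x *\<^sub>R (f x * cnj (base_kernel i r x)))" for x
  proof (cases "x \<in> \<Omega>")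
    case True
    have "cmod (cnj r * x (n + i)) < 1" using base_kernel_arg[OF True i r] r by simp
    from sums_mult[OF profile_sums[OF this, of m n], of "of_real kernel_const"]
    have "(\<lambda>k. of_real (a k) * (cnj r * x (n + i)) ^ k) sums base_kernel i r x"
      using \<open>cmod (cnj r * x (n + i)) < 1\<close> by (simp add: base_kernel_def profile_eq a_def mult.assoc)
    then have "(\<lambda>k. cnj (of_real (a k) * (cnj r * x (n + i)) ^ k)) sums cnj (base_kernel i r x)"
      by (simp only: sums_cnj)
    from sums_mult[OF this, of "f x"] show ?thesis
      using True by (simp add: F_def power_mult_distrib mult_ac)
  qed (simp add: F_def)
  have Fnorm: "norm (F k x) \<le> a k * cmod r ^ k * norm (indicator \<Omega> x *\<^sub>R f x)" for k x
  proof (cases "x \<in> \<Omega>")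
    case True
    have "cmod (x (n + i)) ^ k \<le> 1"
      using fibre_coord_lt_1[OF True i] by (intro power_le_one) auto
    then have "a k * cmod r ^ k * (cmod (f x) * cmod (x (n + i)) ^ k) \<le> a k * cmod r ^ k * (cmod (f x) * 1)"
      using a0[of k] by (intro mult_left_mono) auto
    then show ?thesis using True a0[of k] by (simp add: F_def norm_mult norm_power)
  qed (simp add: F_def)
  \<comment> \<open>This is the profile series at the real point \<open>\<bar>r\<bar> < 1\<close>.\<close>
  have asum: "summable (\<lambda>k. a k * cmod r ^ k)"
  proof -
    have r': "cmod (of_real (cmod r)) < 1" using r by simp
    have "summable (\<lambda>k. of_real (a k * cmod r ^ k) :: complex)"
      using sums_summable[OF sums_mult[OF profile_sums[OF r', of m n], of "of_real kernel_const"]]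
      by (simp add: a_def mult.assoc)
    then show ?thesis by (simp only: summable_complex_of_real)
  qed
  let ?L = "\<integral>x. norm (indicator \<Omega> x *\<^sub>R f x) \<partial>M"
  have fint: "integrable M (\<lambda>x. indicator \<Omega> x *\<^sub>R f x)"
    using bergman_set_integrable[OF f] by (simp add: set_integrable_def)
  have "(\<lambda>k. \<integral>x. F k x \<partial>M) sums (\<integral>x. (\<Sum>k. F k x) \<partial>M)"
  proof (rule sums_integral[OF Fint])
    show "AE x in M. summable (\<lambda>k. norm (F k x))"
      by (intro AE_I2 summable_comparison_test'[OF summable_mult2[OF asum], of 0 "\<lambda>k. norm (F k _)" "norm (indicator \<Omega> _ *\<^sub>R f _)"])
         (use Fnorm in auto)
    show "summable (\<lambda>k. \<integral>x. norm (F k x) \<partial>M)"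
    proof (rule summable_comparison_test'[OF summable_mult2[OF asum, of ?L], of 0])
      fix k
      have "(\<integral>x. norm (F k x) \<partial>M) \<le> (\<integral>x. a k * cmod r ^ k * norm (indicator \<Omega> x *\<^sub>R f x) \<partial>M)"
        by (intro integral_mono Fnorm integrable_norm Fint integrable_mult_right fint)
      then show "norm (\<integral>x. norm (F k x) \<partial>M) \<le> a k * cmod r ^ k * ?L" by simp
    qed
  qed
  also have "(\<integral>x. (\<Sum>k. F k x) \<partial>M) = (LINT x:\<Omega>|M. f x * cnj (base_kernel i r x))"
    unfolding set_lebesgue_integral_def using Fsum[THEN sums_unique] by simp
  finally have "(\<lambda>k. (deriv ^^ k) ?g 0 / fact k * (r - 0) ^ k) sums (LINT x:\<Omega>|M. f x * cnj (base_kernel i r x))"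
    unfolding Fval .
  moreover have "(\<lambda>k. (deriv ^^ k) ?g 0 / fact k * (r - 0) ^ k) sums ?g r"
    by (rule holomorphic_power_series[OF slice_holomorphic[OF hf i]]) (use r in simp)
  ultimately show "f (base_point i r) = (LINT x:\<Omega>|M. f x * cnj (base_kernel i r x))"
    by (rule sums_unique2[symmetric])
qed

section \<open>Transport of the kernel along automorphisms\<close>

text \<open>
  \<open>J\<close> and \<open>L\<close> are the Jacobian determinants of \<open>\<phi>\<close> and of its inverse \<open>\<psi>\<close>.
\<close>

definition automorphism where
  "automorphism \<phi> \<psi> J L \<longleftrightarrow> change_of_vars N \<phi> J
     \<and> (\<forall>x\<in>Cspace N. \<phi> x \<in> \<Omega> \<longleftrightarrow> x \<in> \<Omega>)
     \<and> (\<forall>y\<in>\<Omega>. \<psi> y \<in> \<Omega> \<and> \<phi> (\<psi> y) = y)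
     \<and> (\<forall>x\<in>\<Omega>. \<psi> (\<phi> x) = x \<and> J x * L (\<phi> x) = 1)
     \<and> (\<forall>i<N. holomorphic_C N (\<lambda>x. \<phi> x i) \<Omega> \<and> holomorphic_C N (\<lambda>x. \<psi> x i) \<Omega>)
     \<and> holomorphic_C N J \<Omega> \<and> holomorphic_C N L \<Omega>"

text \<open>
  The transformation rule of the Bergman kernel: \<open>f \<mapsto> (f \<circ> \<phi>) J\<close> is a unitary operator on the Bergman
  space.
\<close>

lemma reproduces_transport:
  assumes aut: "automorphism \<phi> \<psi> J L" and q: "q \<in> \<Omega>" and k: "reproduces_at N \<Omega> (\<psi> q) k"
  shows "reproduces_at N \<Omega> q (\<lambda>y. k (\<psi> y) * L y * cnj (L q))"
proof -
  let ?k = "\<lambda>y. k (\<psi> y) * L y * cnj (L q)"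
  have cov: "change_of_vars N \<phi> J" and map: "\<And>x. x \<in> space M \<Longrightarrow> \<phi> x \<in> \<Omega> \<longleftrightarrow> x \<in> \<Omega>"
    and psi: "\<And>y. y \<in> \<Omega> \<Longrightarrow> \<psi> y \<in> \<Omega>" "\<And>y. y \<in> \<Omega> \<Longrightarrow> \<phi> (\<psi> y) = y"
    and inv: "\<And>x. x \<in> \<Omega> \<Longrightarrow> \<psi> (\<phi> x) = x" "\<And>x. x \<in> \<Omega> \<Longrightarrow> J x * L (\<phi> x) = 1"
    and hol: "\<And>i. i < N \<Longrightarrow> holomorphic_C N (\<lambda>x. \<phi> x i) \<Omega>" "\<And>i. i < N \<Longrightarrow> holomorphic_C N (\<lambda>x. \<psi> x i) \<Omega>"
      "holomorphic_C N J \<Omega>" "holomorphic_C N L \<Omega>"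
    using aut by (auto simp: automorphism_def space_Cmeasure)
  have phi: "\<phi> x \<in> \<Omega>" if "x \<in> \<Omega>" for x using map that D_subset by (auto simp: space_Cmeasure)
  have kb: "k \<in> bergman_space N \<Omega>" using k by (simp add: reproduces_at_def)
  have L: "cmod (J x) * cmod (L (\<phi> x)) = 1" if "x \<in> \<Omega>" for x
    using inv(2)[OF that] by (simp flip: norm_mult)
  have meas: "(\<lambda>x. indicator \<Omega> x *\<^sub>R f x) \<in> borel_measurable M" if "holomorphic_C N f \<Omega>" for f
    by (rule holomorphic_C_measurable[OF that open_D D_subset])
  have measn: "(\<lambda>x. indicator \<Omega> x *\<^sub>R (cmod (f x))\<^sup>2) \<in> borel_measurable M" if "holomorphic_C N f \<Omega>" for f
  proof -
    have "indicator \<Omega> x *\<^sub>R (cmod (f x))\<^sup>2 = (cmod (indicator \<Omega> x *\<^sub>R f x))\<^sup>2" for x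
      by (simp add: indicator_def)
    then show ?thesis
      using borel_measurable_power[OF measurable_compose[OF meas[OF that] borel_measurable_norm], of 2] by (simp only:)
  qed
  have hk: "holomorphic_C N ?k \<Omega>"
    using kb hol(4) by (intro holomorphic_C_mult holomorphic_C_const holomorphic_C_chain[OF _ hol(2) psi(1)])
      (auto simp: bergman_space_def)
  have kb': "?k \<in> bergman_space N \<Omega>"
  proof -
    have "integrable M (\<lambda>x. (cmod (J x))\<^sup>2 *\<^sub>R (indicator \<Omega> (\<phi> x) *\<^sub>R (cmod (?k (\<phi> x)))\<^sup>2))
      \<longleftrightarrow> integrable M (\<lambda>x. (cmod (L q))\<^sup>2 * (indicator \<Omega> x *\<^sub>R (cmod (k x))\<^sup>2))"
    proof (rule Bochner_Integration.integrable_cong[OF refl])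
      fix x assume x: "x \<in> space M"
      show "(cmod (J x))\<^sup>2 *\<^sub>R (indicator \<Omega> (\<phi> x) *\<^sub>R (cmod (?k (\<phi> x)))\<^sup>2)
        = (cmod (L q))\<^sup>2 * (indicator \<Omega> x *\<^sub>R (cmod (k x))\<^sup>2)"
      proof (cases "x \<in> \<Omega>")
        case True
        have "(cmod (J x))\<^sup>2 * (cmod (?k (\<phi> x)))\<^sup>2 = (cmod (J x) * cmod (L (\<phi> x)))\<^sup>2 * ((cmod (L q))\<^sup>2 * (cmod (k x))\<^sup>2)"
          by (simp add: inv(1)[OF True] norm_mult power_mult_distrib)
        then show ?thesis using True phi[OF True] by (simp add: L)
      qed (use map[OF x] in simp)
    qed
    moreover have "integrable M (\<lambda>x. (cmod (L q))\<^sup>2 * (indicator \<Omega> x *\<^sub>R (cmod (k x))\<^sup>2))"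
      using kb by (intro integrable_mult_right) (simp add: bergman_space_def set_integrable_def)
    ultimately have "integrable M (\<lambda>x. indicator \<Omega> x *\<^sub>R (cmod (?k x))\<^sup>2)"
      using change_of_vars_integral(1)[OF cov measn[OF hk]] by (simp only:)
    then show ?thesis using hk by (simp add: bergman_space_def set_integrable_def)
  qed
  have "f q = (LINT x:\<Omega>|M. f x * cnj (?k x))" if f: "f \<in> bergman_space N \<Omega>" for f
  proof -
    let ?g = "\<lambda>x. f (\<phi> x) * J x"
    have hf: "holomorphic_C N f \<Omega>" using f by (simp add: bergman_space_def)
    have hg: "holomorphic_C N ?g \<Omega>"
      using hf hol(3) by (intro holomorphic_C_mult holomorphic_C_chain[OF _ hol(1) phi])
    have "integrable M (\<lambda>x. (cmod (J x))\<^sup>2 *\<^sub>R (indicator \<Omega> (\<phi> x) *\<^sub>R (cmod (f (\<phi> x)))\<^sup>2))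
      \<longleftrightarrow> integrable M (\<lambda>x. indicator \<Omega> x *\<^sub>R (cmod (?g x))\<^sup>2)"
    proof (rule Bochner_Integration.integrable_cong[OF refl])
      fix x assume x: "x \<in> space M"
      show "(cmod (J x))\<^sup>2 *\<^sub>R (indicator \<Omega> (\<phi> x) *\<^sub>R (cmod (f (\<phi> x)))\<^sup>2) = indicator \<Omega> x *\<^sub>R (cmod (?g x))\<^sup>2"
        using map[OF x] by (simp add: indicator_def norm_mult power_mult_distrib)
    qed
    moreover have "integrable M (\<lambda>x. indicator \<Omega> x *\<^sub>R (cmod (f x))\<^sup>2)"
      using f by (simp add: bergman_space_def set_integrable_def)
    ultimately have "integrable M (\<lambda>x. indicator \<Omega> x *\<^sub>R (cmod (?g x))\<^sup>2)"
      using change_of_vars_integral(1)[OF cov measn[OF hf]] by (simp only:)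
    then have gb: "?g \<in> bergman_space N \<Omega>" using hg by (simp add: bergman_space_def set_integrable_def)
    let ?F = "\<lambda>x. indicator \<Omega> x *\<^sub>R (f x * cnj (?k x))"
    have Fm: "?F \<in> borel_measurable M"
    proof -
      have "?F = (\<lambda>x. (indicator \<Omega> x *\<^sub>R f x) * cnj (indicator \<Omega> x *\<^sub>R ?k x))"
        by (auto simp: indicator_def)
      moreover have "(\<lambda>x. cnj (indicator \<Omega> x *\<^sub>R ?k x)) \<in> borel_measurable M"
        by (intro measurable_compose[OF meas[OF hk] borel_measurable_continuous_onI] continuous_intros)
      ultimately show ?thesis using meas[OF hf] by (simp only:) (intro borel_measurable_times)
    qed
    have "(LINT x:\<Omega>|M. f x * cnj (?k x)) = (\<integral>x. (cmod (J x))\<^sup>2 *\<^sub>R ?F (\<phi> x) \<partial>M)"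
      unfolding set_lebesgue_integral_def by (rule change_of_vars_integral(2)[OF cov Fm, symmetric])
    also have "\<dots> = (\<integral>x. L q * (indicator \<Omega> x *\<^sub>R (?g x * cnj (k x))) \<partial>M)"
    proof (rule Bochner_Integration.integral_cong[OF refl])
      fix x assume x: "x \<in> space M"
      show "(cmod (J x))\<^sup>2 *\<^sub>R ?F (\<phi> x) = L q * (indicator \<Omega> x *\<^sub>R (?g x * cnj (k x)))"
      proof (cases "x \<in> \<Omega>")
        case True
        have "complex_of_real ((cmod (J x))\<^sup>2) * cnj (L (\<phi> x)) = J x * cnj (J x * L (\<phi> x))"
          unfolding complex_norm_square by simp
        then have "complex_of_real ((cmod (J x))\<^sup>2) * cnj (L (\<phi> x)) = J x"
          by (simp only: inv(2)[OF True]) simp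
        then have "(complex_of_real ((cmod (J x))\<^sup>2) * cnj (L (\<phi> x))) * (f (\<phi> x) * cnj (k x) * L q)
          = J x * (f (\<phi> x) * cnj (k x) * L q)" by (simp only:)
        then show ?thesis using True phi[OF True]
          by (simp add: inv(1)[OF True] scaleR_conv_of_real mult_ac)
      qed (use map[OF x] in simp)
    qed
    also have "\<dots> = L q * (LINT x:\<Omega>|M. ?g x * cnj (k x))"
      unfolding set_lebesgue_integral_def by (rule integral_mult_right_zero)
    also have "(LINT x:\<Omega>|M. ?g x * cnj (k x)) = ?g (\<psi> q)"
      using k gb by (auto simp: reproduces_at_def)
    also have "L q * ?g (\<psi> q) = f q * (J (\<psi> q) * L (\<phi> (\<psi> q)))"
      by (simp add: psi(2)[OF q])
    also have "\<dots> = f q" by (simp add: inv(2)[OF psi(1)[OF q]])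
    finally show ?thesis ..
  qed
  with kb' show ?thesis by (simp add: reproduces_at_def)
qed

text \<open>
  What has to be remembered about the kernel at \<open>q\<close> and what automorphisms preserve: they multiply
  reproducing functions by factors without zeros.
\<close>

definition zeros_from_profile :: "(nat \<Rightarrow> complex) \<Rightarrow> bool" where
  "zeros_from_profile q \<longleftrightarrow> (\<exists>k. reproduces_at N \<Omega> q k \<and>
     (\<forall>y\<in>\<Omega>. k y = 0 \<longrightarrow> (\<exists>t. cmod t < 1 \<and> profile n m t = 0)))"

lemma zeros_transport:
  assumes aut: "automorphism \<phi> \<psi> J L" and q: "q \<in> \<Omega>" and z: "zeros_from_profile (\<psi> q)"
  shows "zeros_from_profile q"
proof -
  obtain k where k: "reproduces_at N \<Omega> (\<psi> q) k"
    "\<And>y. y \<in> \<Omega> \<Longrightarrow> k y = 0 \<Longrightarrow> \<exists>t. cmod t < 1 \<and> profile n m t = 0"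
    using z unfolding zeros_from_profile_def by blast
  have psi: "\<psi> y \<in> \<Omega>" "L y \<noteq> 0" if "y \<in> \<Omega>" for y
  proof -
    show p: "\<psi> y \<in> \<Omega>" using aut that by (auto simp: automorphism_def)
    have "J (\<psi> y) * L (\<phi> (\<psi> y)) = 1" using aut p by (auto simp: automorphism_def)
    then show "L y \<noteq> 0" using aut that by (auto simp: automorphism_def)
  qed
  show ?thesis unfolding zeros_from_profile_def
    using reproduces_transport[OF aut q k(1)] k(2) psi q by fastforce
qed

lemma zeros_base_point:
  assumes "i < m" "cmod r < 1" shows "zeros_from_profile (base_point i r)"
  unfolding zeros_from_profile_def
proof (rule exI, intro conjI ballI impI)
  show "reproduces_at N \<Omega> (base_point i r) (base_kernel i r)" by (rule base_kernel_reproduces[OF assms])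
  fix y assume y: "y \<in> \<Omega>" "base_kernel i r y = 0"
  then have "cmod (cnj r * y (n + i)) < 1 \<and> profile n m (cnj r * y (n + i)) = 0"
    using base_kernel_arg[OF y(1) assms] assms(2) kernel_const_pos by (simp add: base_kernel_def)
  then show "\<exists>t. cmod t < 1 \<and> profile n m t = 0" by blast
qed

section \<open>Unitary rotations of the fibre\<close>

text \<open>
  The unitary matrix of determinant \<open>1\<close> with first column \<open>(\<alpha>, \<beta>)\<close>, acting on the coordinates \<open>a\<close> and
  \<open>b\<close>.
\<close>

definition givens :: "nat \<Rightarrow> nat \<Rightarrow> complex \<Rightarrow> complex \<Rightarrow> (nat \<Rightarrow> complex) \<Rightarrow> nat \<Rightarrow> complex" where
  "givens a b \<alpha> \<beta> x = x(a := \<alpha> * x a - cnj \<beta> * x b, b := \<beta> * x a + cnj \<alpha> * x b)"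

lemma givens_inverse:
  assumes "a \<noteq> b" "\<alpha> * cnj \<alpha> + \<beta> * cnj \<beta> = 1"
  shows "givens a b (cnj \<alpha>) (- \<beta>) (givens a b \<alpha> \<beta> x) = x"
proof -
  have "cnj \<alpha> * (\<alpha> * u - cnj \<beta> * v) + cnj \<beta> * (\<beta> * u + cnj \<alpha> * v) = (\<alpha> * cnj \<alpha> + \<beta> * cnj \<beta>) * u"
    "- \<beta> * (\<alpha> * u - cnj \<beta> * v) + \<alpha> * (\<beta> * u + cnj \<alpha> * v) = (\<alpha> * cnj \<alpha> + \<beta> * cnj \<beta>) * v" for u v
    by (simp_all add: algebra_simps)
  then show ?thesis using assms by (auto simp: givens_def)
qed

lemma givens_norm:
  assumes "\<alpha> * cnj \<alpha> + \<beta> * cnj \<beta> = 1"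
  shows "(cmod (\<alpha> * u - cnj \<beta> * v))\<^sup>2 + (cmod (\<beta> * u + cnj \<alpha> * v))\<^sup>2 = (cmod u)\<^sup>2 + (cmod v)\<^sup>2"
proof -
  have "complex_of_real ((cmod (\<alpha> * u - cnj \<beta> * v))\<^sup>2 + (cmod (\<beta> * u + cnj \<alpha> * v))\<^sup>2)
    = (\<alpha> * cnj \<alpha> + \<beta> * cnj \<beta>) * (u * cnj u + v * cnj v)"
    unfolding of_real_add complex_norm_square by (simp add: algebra_simps)
  also have "\<dots> = complex_of_real ((cmod u)\<^sup>2 + (cmod v)\<^sup>2)"
    unfolding assms of_real_add complex_norm_square by simp
  finally show ?thesis using of_real_eq_iff by blast
qed

lemma givens_D:
  assumes i: "i < m" "j < m" "i \<noteq> j" and u: "\<alpha> * cnj \<alpha> + \<beta> * cnj \<beta> = 1" and x: "x \<in> Cspace N"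
  shows "givens (n + i) (n + j) \<alpha> \<beta> x \<in> \<Omega> \<longleftrightarrow> x \<in> \<Omega>"
proof -
  let ?y = "givens (n + i) (n + j) \<alpha> \<beta> x"
  have split: "{n..<N} = insert (n + i) (insert (n + j) ({n..<N} - {n + i, n + j}))" using i by auto
  have fs: "fibre_sq z = (cmod (z (n + i)))\<^sup>2 + ((cmod (z (n + j)))\<^sup>2 + (\<Sum>l\<in>{n..<N} - {n + i, n + j}. (cmod (z l))\<^sup>2))" for z
    unfolding fibre_sq_def by (subst split, subst sum.insert, simp, use i in simp, subst sum.insert) auto
  have "(\<Sum>l\<in>{n..<N} - {n + i, n + j}. (cmod (?y l))\<^sup>2) = (\<Sum>l\<in>{n..<N} - {n + i, n + j}. (cmod (x l))\<^sup>2)"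
    by (rule sum.cong) (auto simp: givens_def)
  then have "fibre_sq ?y = fibre_sq x"
    using givens_norm[OF u, of "x (n + i)" "x (n + j)"] i(3) by (simp add: fs givens_def)
  moreover have "weight ?y = weight x" by (simp add: weight_def givens_def)
  moreover have "?y \<in> Cspace N" using x i by (auto simp: Cspace_def givens_def PiE_def extensional_def)
  ultimately show ?thesis using x by (simp add: mem_D)
qed

text \<open>
  For \<open>\<alpha> \<noteq> 0\<close> the matrix is a product of two elementary maps, with factors \<open>\<alpha>\<close> and \<open>1 / \<alpha>\<close>.
\<close>

lemma givens_change_of_vars:
  assumes i: "i < m" "j < m" "i \<noteq> j" and u: "\<alpha> * cnj \<alpha> + \<beta> * cnj \<beta> = 1" and a0: "\<alpha> \<noteq> 0"
  shows "change_of_vars N (givens (n + i) (n + j) \<alpha> \<beta>) (\<lambda>_. 1)"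
proof -
  let ?a = "n + i" and ?b = "n + j"
  have [measurable]: "(\<lambda>x. x ?a) \<in> borel_measurable M" "(\<lambda>x. x ?b) \<in> borel_measurable M"
    using i by (auto intro: measurable_coord)
  have 1: "change_of_vars N (\<lambda>x. x(?a := \<alpha> * x ?a + (- cnj \<beta> * x ?b))) (\<lambda>_. \<alpha>)"
    by (rule change_of_vars_elementary) (use i a0 in auto)
  have 2: "change_of_vars N (\<lambda>x. x(?b := (1 / \<alpha>) * x ?b + (\<beta> / \<alpha>) * x ?a)) (\<lambda>_. 1 / \<alpha>)"
    by (rule change_of_vars_elementary) (use i a0 in auto)
  \<comment> \<open>The relation between \<open>\<alpha>\<close> and \<open>\<beta>\<close> turns the lower right entry of the product, \<open>(1 - \<bar>\<beta>\<bar>\<^sup>2) / \<alpha>\<close>,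
    into \<open>cnj \<alpha>\<close>.\<close>
  have ca: "cnj \<alpha> = (1 - \<beta> * cnj \<beta>) / \<alpha>" using u a0 by (simp add: field_simps eq_diff_eq)
  have "(x(?a := \<alpha> * x ?a + (- cnj \<beta> * x ?b)))(?b := (1 / \<alpha>) * (x(?a := \<alpha> * x ?a + (- cnj \<beta> * x ?b))) ?b
      + (\<beta> / \<alpha>) * (x(?a := \<alpha> * x ?a + (- cnj \<beta> * x ?b))) ?a) = givens ?a ?b \<alpha> \<beta> x" for x
    using i a0 by (auto simp: givens_def fun_eq_iff ca field_simps)
  with change_of_vars_comp[OF 1 2] a0 show ?thesis by simp
qed

lemma givens_holomorphic:
  assumes "a < N" "b < N" "l < N" shows "holomorphic_C N (\<lambda>x. givens a b \<alpha> \<beta> x l) \<Omega>"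
proof -
  have c: "holomorphic_C N (\<lambda>x. u * x a + v * x b) \<Omega>" for u v
    using assms by (intro holomorphic_C_add holomorphic_C_mult holomorphic_C_const holomorphic_C_coord)
  show ?thesis
    using c[of \<alpha> "- cnj \<beta>"] c[of \<beta> "cnj \<alpha>"] holomorphic_C_coord[OF assms(3), of \<Omega>]
    by (cases "l = b"; cases "l = a") (simp_all add: givens_def)
qed

lemma givens_automorphism:
  assumes i: "i < m" "j < m" "i \<noteq> j" and u: "\<alpha> * cnj \<alpha> + \<beta> * cnj \<beta> = 1" and a0: "\<alpha> \<noteq> 0"
  shows "automorphism (givens (n + i) (n + j) \<alpha> \<beta>) (givens (n + i) (n + j) (cnj \<alpha>) (- \<beta>)) (\<lambda>_. 1) (\<lambda>_. 1)"
proof -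
  have u': "cnj \<alpha> * cnj (cnj \<alpha>) + (- \<beta>) * cnj (- \<beta>) = 1" using u by (simp add: mult.commute)
  have ne: "n + i \<noteq> n + j" using i by simp
  have inv2: "givens (n + i) (n + j) \<alpha> \<beta> (givens (n + i) (n + j) (cnj \<alpha>) (- \<beta>) x) = x" for x
    using givens_inverse[OF ne u', of x] by simp
  show ?thesis
    unfolding automorphism_def
    using givens_change_of_vars[OF i u a0] givens_D[OF i u] givens_D[OF i u'] givens_inverse[OF ne u] inv2 D_subset i
    by (auto intro!: givens_holomorphic holomorphic_C_const)
qed

text \<open>
  Fix a coordinate \<open>i\<close> with \<open>\<zeta>\<^sub>i \<noteq> 0\<close> and rotate the coordinates below \<open>c\<close> into it one after the other; as
  \<open>\<zeta>\<^sub>i\<close> never becomes \<open>0\<close>, each rotation has \<open>\<alpha> \<noteq> 0\<close>.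
\<close>

lemma zeros_origin_fibre_aux:
  assumes "q \<in> \<Omega>" "\<And>l. l < n \<Longrightarrow> q l = 0" "i < m" "q (n + i) \<noteq> 0"
    "\<And>j. c \<le> j \<Longrightarrow> j < m \<Longrightarrow> j \<noteq> i \<Longrightarrow> q (n + j) = 0"
  shows "zeros_from_profile q"
  using assms
proof (induction c arbitrary: q)
  case 0
  have "q l = base_point i (q (n + i)) l" for l
  proof -
    consider "l < n" | j where "l = n + j" "j < m" | "\<not> l < N"
      by (metis add_less_cancel_left le_add_diff_inverse not_less)
    then show ?thesis
      using 0 D_subset by cases (auto simp: base_point_def Cspace_def PiE_def extensional_def)
  qed
  then have "q = base_point i (q (n + i))" by blast
  moreover have "cmod (q (n + i)) < 1" using 0 by (intro fibre_coord_lt_1)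
  ultimately show ?case using zeros_base_point[OF \<open>i < m\<close>] by metis
next
  case (Suc c)
  show ?case
  proof (cases "c < m \<and> c \<noteq> i")
    case False
    show ?thesis
    proof (rule Suc.IH[OF Suc.prems(1-4)])
      fix j assume "c \<le> j" "j < m" "j \<noteq> i"
      then show "q (n + j) = 0" using Suc.prems(5)[of j] False by (cases "j = c") auto
    qed
  next
    case True
    define r where "r = sqrt ((cmod (q (n + i)))\<^sup>2 + (cmod (q (n + c)))\<^sup>2)"
    have r2: "r\<^sup>2 = (cmod (q (n + i)))\<^sup>2 + (cmod (q (n + c)))\<^sup>2" unfolding r_def by simp
    have r0: "r \<noteq> 0" using Suc.prems(4) unfolding r_def by (simp add: sum_power2_eq_zero_iff)
    define \<alpha> where "\<alpha> = q (n + i) / of_real r"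
    define \<beta> where "\<beta> = q (n + c) / of_real r"
    have nn: "q (n + i) * cnj (q (n + i)) + q (n + c) * cnj (q (n + c)) = of_real (r\<^sup>2)"
      unfolding r2 of_real_add complex_norm_square ..
    have u: "\<alpha> * cnj \<alpha> + \<beta> * cnj \<beta> = 1"
    proof -
      have "\<alpha> * cnj \<alpha> + \<beta> * cnj \<beta> = (q (n + i) * cnj (q (n + i)) + q (n + c) * cnj (q (n + c))) / of_real (r\<^sup>2)"
        unfolding \<alpha>_def \<beta>_def by (simp add: power2_eq_square add_divide_distrib)
      then show ?thesis using r0 unfolding nn by simp
    qed
    have a0: "\<alpha> \<noteq> 0" using Suc.prems(4) r0 by (simp add: \<alpha>_def)
    have aut: "automorphism (givens (n + i) (n + c) \<alpha> \<beta>) (givens (n + i) (n + c) (cnj \<alpha>) (- \<beta>)) (\<lambda>_. 1) (\<lambda>_. 1)"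
      using True Suc.prems(3) by (intro givens_automorphism u a0) auto
    let ?p = "givens (n + i) (n + c) (cnj \<alpha>) (- \<beta>) q"
    have "zeros_from_profile ?p"
    proof (rule Suc.IH)
      show "?p \<in> \<Omega>" using aut Suc.prems(1) by (auto simp: automorphism_def)
      show "?p l = 0" if "l < n" for l using Suc.prems(2) that by (auto simp: givens_def)
      show "i < m" by fact
      have "?p (n + i) = cnj \<alpha> * q (n + i) + cnj \<beta> * q (n + c)"
        using True by (simp add: givens_def)
      also have "\<dots> = (q (n + i) * cnj (q (n + i)) + q (n + c) * cnj (q (n + c))) / of_real r"
        by (simp add: \<alpha>_def \<beta>_def add_divide_distrib mult.commute)
      also have "\<dots> = of_real r" unfolding nn using r0 by (simp add: power2_eq_square)
      finally show "?p (n + i) \<noteq> 0" using r0 by simp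
      show "?p (n + j) = 0" if "c \<le> j" "j < m" "j \<noteq> i" for j
      proof (cases "j = c")
        case True
        then show ?thesis by (simp add: givens_def \<alpha>_def \<beta>_def)
      next
        case False
        then show ?thesis using that Suc.prems(5)[of j] by (simp add: givens_def)
      qed
    qed
    then show ?thesis by (rule zeros_transport[OF aut Suc.prems(1)])
  qed
qed

lemma zeros_origin_fibre:
  assumes q: "q \<in> \<Omega>" and z: "\<And>l. l < n \<Longrightarrow> q l = 0"
  shows "zeros_from_profile q"
proof (cases "\<exists>i<m. q (n + i) \<noteq> 0")
  case True
  then obtain i where "i < m" "q (n + i) \<noteq> 0" by blast
  then show ?thesis by (intro zeros_origin_fibre_aux[OF q z, where c = m]) auto
next
  case False
  have "q l = base_point 0 0 l" for l
  proof -
    consider "l < n" | j where "l = n + j" "j < m" | "\<not> l < N"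
      by (metis add_less_cancel_left le_add_diff_inverse not_less)
    then show ?thesis
      using False z q D_subset by cases (auto simp: base_point_def Cspace_def PiE_def extensional_def)
  qed
  then have "q = base_point 0 0" by blast
  then show ?thesis using zeros_base_point[of 0 0] m by simp
qed

section \<open>Heisenberg translations\<close>

definition heis_factor :: "nat \<Rightarrow> complex \<Rightarrow> (nat \<Rightarrow> complex) \<Rightarrow> complex" where
  "heis_factor l w x = exp (- of_real \<mu> * cnj w * x l - of_real (\<mu> * (cmod w)\<^sup>2 / 2))"

text \<open>
  Translating \<open>z\<^sub>l\<close> by \<open>w\<close> multiplies \<open>exp (- \<mu> \<parallel>z\<parallel>\<^sup>2)\<close> by the squared modulus of the holomorphic function
  \<open>heis_factor\<close>; scaling the fibre by this function preserves the domain.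
\<close>

definition heis :: "nat \<Rightarrow> complex \<Rightarrow> (nat \<Rightarrow> complex) \<Rightarrow> nat \<Rightarrow> complex" where
  "heis l w x = (scale_on fibre (heis_factor l w x) x)(l := x l + w)"

lemma heis_factor_inverse:
  assumes "l < n" shows "heis_factor l w x * heis_factor l (- w) (heis l w x) = 1"
proof -
  have "complex_of_real \<mu> * cnj w * w = of_real (\<mu> * (cmod w)\<^sup>2)"
    unfolding of_real_mult complex_norm_square by (simp add: mult_ac)
  then have "- of_real \<mu> * cnj w * x l - of_real (\<mu> * (cmod w)\<^sup>2 / 2)
    + (- of_real \<mu> * cnj (- w) * (x l + w) - of_real (\<mu> * (cmod (- w))\<^sup>2 / 2)) = 0"
    by (simp add: algebra_simps)
  then show ?thesis by (simp only: heis_factor_def heis_def fun_upd_same exp_add[symmetric]) simp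
qed

lemma heis_inverse:
  assumes l: "l < n" shows "heis l (- w) (heis l w x) = x"
proof
  fix j
  have "l \<notin> fibre" using l by (simp add: fibre_def)
  then show "heis l (- w) (heis l w x) j = x j"
    using heis_factor_inverse[OF l, of w x]
    by (auto simp: heis_def[of l "- w"] scale_on_def) (auto simp: heis_def scale_on_def mult.commute mult.left_commute simp flip: mult.assoc)
qed

lemma heis_D:
  assumes l: "l < n" and x: "x \<in> Cspace N"
  shows "heis l w x \<in> \<Omega> \<longleftrightarrow> x \<in> \<Omega>"
proof -
  let ?c = "heis_factor l w x"
  have lf: "l \<notin> {n..<N}" using l by simp
  have c2: "(cmod ?c)\<^sup>2 = exp (- \<mu> * (2 * Re (cnj w * x l) + (cmod w)\<^sup>2))"
    unfolding heis_factor_def norm_exp_eq_Re exp_of_nat_mult[symmetric] power2_eq_square exp_add[symmetric]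
    by (rule arg_cong[where f = exp]) (simp add: algebra_simps)
  have "fibre_sq (heis l w x) = fibre_sq (scale_on fibre ?c x)"
    unfolding fibre_sq_def by (rule sum.cong) (use lf in \<open>auto simp: heis_def\<close>)
  then have 1: "fibre_sq (heis l w x) = (cmod ?c)\<^sup>2 * fibre_sq x" by (simp add: fibre_scale)
  have "(\<Sum>j<n. (cmod (heis l w x j))\<^sup>2) = (cmod (x l + w))\<^sup>2 + (\<Sum>j\<in>{..<n} - {l}. (cmod (heis l w x j))\<^sup>2)"
    by (subst sum.remove[of _ l]) (use l in \<open>auto simp: heis_def\<close>)
  also have "(\<Sum>j\<in>{..<n} - {l}. (cmod (heis l w x j))\<^sup>2) = (\<Sum>j\<in>{..<n} - {l}. (cmod (x j))\<^sup>2)"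
    by (rule sum.cong) (auto simp: heis_def scale_on_def fibre_def)
  also have "\<dots> = (\<Sum>j<n. (cmod (x j))\<^sup>2) - (cmod (x l))\<^sup>2"
    by (subst (2) sum.remove[of _ l]) (use l in auto)
  also have "(cmod (x l + w))\<^sup>2 = (cmod (x l))\<^sup>2 + (2 * Re (cnj w * x l) + (cmod w)\<^sup>2)"
    unfolding cmod_power2 by (simp add: power2_eq_square algebra_simps)
  finally have "(\<Sum>j<n. (cmod (heis l w x j))\<^sup>2) = (\<Sum>j<n. (cmod (x j))\<^sup>2) + (2 * Re (cnj w * x l) + (cmod w)\<^sup>2)" by simp
  then have 2: "weight (heis l w x) = (cmod ?c)\<^sup>2 * weight x"
    unfolding weight_def c2 exp_add[symmetric] by (simp add: algebra_simps)
  have "heis l w x \<in> Cspace N"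
    using x l by (auto simp: heis_def scale_on_def Cspace_def fibre_def PiE_def extensional_def)
  moreover have "(cmod ?c)\<^sup>2 > 0" by (simp add: heis_factor_def)
  ultimately show ?thesis using x by (simp add: mem_D 1 2)
qed

lemma heis_factor_holomorphic: "l < n \<Longrightarrow> holomorphic_C N (heis_factor l w) \<Omega>"
proof -
  assume l: "l < n"
  have "holomorphic_C N (\<lambda>x. - of_real \<mu> * cnj w * x l + - of_real (\<mu> * (cmod w)\<^sup>2 / 2)) \<Omega>"
    using l by (intro holomorphic_C_add holomorphic_C_mult holomorphic_C_const holomorphic_C_coord) simp
  from holomorphic_C_compose[OF this holomorphic_on_exp open_UNIV] show ?thesis
    by (simp add: heis_factor_def[abs_def])
qed

lemma heis_holomorphic:
  assumes l: "l < n" and j: "j < N" shows "holomorphic_C N (\<lambda>x. heis l w x j) \<Omega>"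
proof -
  consider "j = l" | "j \<noteq> l" "j \<in> fibre" | "j \<noteq> l" "j \<notin> fibre" by blast
  then show ?thesis
  proof cases
    case 1
    then show ?thesis using j
      by (simp add: heis_def holomorphic_C_add holomorphic_C_const holomorphic_C_coord)
  next
    case 2
    then show ?thesis using j
      by (simp add: heis_def scale_on_def holomorphic_C_mult heis_factor_holomorphic[OF l] holomorphic_C_coord)
  next
    case 3
    then show ?thesis using j by (simp add: heis_def scale_on_def holomorphic_C_coord)
  qed
qed

lemma heis_change_of_vars:
  assumes l: "l < n" shows "change_of_vars N (heis l w) (\<lambda>x. heis_factor l w x ^ m)"
proof -
  have lf: "l \<notin> fibre" using l by (simp add: fibre_def)
  have "(\<lambda>x. x l) \<in> borel_measurable M" using l by (intro measurable_coord) simp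
  then have meas: "heis_factor l w \<in> borel_measurable M" unfolding heis_factor_def[abs_def]
    by (intro measurable_compose[OF _ borel_measurable_continuous_onI[of exp]] borel_measurable_diff borel_measurable_times continuous_intros) simp_all
  have 1: "change_of_vars N (\<lambda>x. scale_on fibre (heis_factor l w x) x) (\<lambda>x. heis_factor l w x ^ card fibre)"
  proof (rule change_of_vars_scale[OF fibre(1) meas])
    show "heis_factor l w x \<noteq> 0" for x by (simp add: heis_factor_def)
    show "heis_factor l w (x(j := v)) = heis_factor l w x" if "j \<in> fibre" for x v j
      using lf that by (auto simp: heis_factor_def)
  qed
  have 2: "change_of_vars N (\<lambda>x. x(l := 1 * x l + w)) (\<lambda>_. 1)"
    by (rule change_of_vars_elementary) (use l in auto)
  have "(scale_on fibre (heis_factor l w x) x)(l := 1 * scale_on fibre (heis_factor l w x) x l + w) = heis l w x" for x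
    using lf by (simp add: heis_def scale_on_def)
  with change_of_vars_comp[OF 1 2] show ?thesis by (simp add: fibre)
qed

lemma heis_automorphism:
  assumes l: "l < n"
  shows "automorphism (heis l w) (heis l (- w)) (\<lambda>x. heis_factor l w x ^ m) (\<lambda>y. heis_factor l (- w) y ^ m)"
proof -
  have pw: "holomorphic_C N (\<lambda>x. heis_factor l v x ^ m) \<Omega>" for v
    by (rule holomorphic_C_compose[OF heis_factor_holomorphic[OF l], of _ UNIV]) (auto intro!: holomorphic_intros)
  have inv2: "heis l w (heis l (- w) x) = x" for x using heis_inverse[OF l, of "- w" x] by simp
  show ?thesis unfolding automorphism_def
    using heis_change_of_vars[OF l] heis_D[OF l] heis_inverse[OF l] inv2 heis_factor_inverse[OF l] pw D_subset
    by (auto simp: heis_holomorphic[OF l] subset_iff simp flip: power_mult_distrib)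
qed

text \<open>
  Translations move the coordinates of \<open>z\<close> to \<open>0\<close> one at a time, starting with the last one.
\<close>

lemma zeros_everywhere:
  assumes "q \<in> \<Omega>" shows "zeros_from_profile q"
proof -
  have "zeros_from_profile q" if "q \<in> \<Omega>" "\<And>l. c \<le> l \<Longrightarrow> l < n \<Longrightarrow> q l = 0" "c \<le> n" for c q
    using that
  proof (induction c arbitrary: q)
    case 0
    then show ?case by (intro zeros_origin_fibre) auto
  next
    case (Suc c)
    then have c: "c < n" by simp
    note aut = heis_automorphism[OF c, of "q c"]
    let ?p = "heis c (- q c) q"
    have "zeros_from_profile ?p"
    proof (rule Suc.IH)
      show "?p \<in> \<Omega>" using aut Suc.prems(1) by (auto simp: automorphism_def)
      show "?p l = 0" if "c \<le> l" "l < n" for l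
        using that Suc.prems(2)[of l] by (cases "l = c") (auto simp: heis_def scale_on_def fibre_def)
    qed (use c in simp)
    then show ?case by (rule zeros_transport[OF aut Suc.prems(1)])
  qed
  from this[of q n] show ?thesis using assms by auto
qed

text \<open>
  A zero \<open>t\<close> of the profile is realised by two base points: for \<open>s\<^sup>2 = t\<close> the kernel at \<open>(0, cnj s e\<^sub>0)\<close> and
  \<open>(0, s e\<^sub>0)\<close> is, up to conjugation, a multiple of the profile at \<open>t\<close>.
\<close>

lemma lu_qi_keng_iff:
  "lu_qi_keng N \<Omega> \<longleftrightarrow> (\<forall>t. cmod t < 1 \<longrightarrow> profile n m t \<noteq> 0)"
proof
  assume lqk: "lu_qi_keng N \<Omega>"
  show "\<forall>t. cmod t < 1 \<longrightarrow> profile n m t \<noteq> 0"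
  proof (intro allI impI notI)
    fix t assume t: "cmod t < 1" "profile n m t = 0"
    define s where "s = csqrt t"
    have s2: "s * s = t" by (simp add: s_def flip: power2_eq_square)
    have "(cmod s)\<^sup>2 < 1" using t(1) s2 by (metis norm_mult power2_eq_square)
    then have s: "cmod s < 1" by (simp add: abs_square_less_1)
    have i: "0 < m" using m by simp
    let ?x = "base_point 0 (cnj s)" and ?w = "base_point 0 s"
    have D: "?x \<in> \<Omega>" "?w \<in> \<Omega>" using s i by (simp_all add: base_point_D)
    have "\<exists>k. reproduces_at N \<Omega> ?w k" using base_kernel_reproduces[OF i s] by blast
    then have "reproduces_at N \<Omega> ?w (SOME k. reproduces_at N \<Omega> ?w k)" by (rule someI_ex)
    moreover have "reproduces_at N \<Omega> ?x (base_kernel 0 (cnj s))"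
      by (rule base_kernel_reproduces[OF i]) (use s in simp)
    ultimately have "bergman_kernel N \<Omega> ?x ?w = cnj (base_kernel 0 (cnj s) ?w)"
      unfolding bergman_kernel_def by (intro reproducing_symmetric)
    also have "base_kernel 0 (cnj s) ?w = 0"
      using t(2) m s2 by (simp add: base_kernel_def base_point_def)
    finally show False using lqk D by (simp add: lu_qi_keng_def)
  qed
next
  assume nz: "\<forall>t. cmod t < 1 \<longrightarrow> profile n m t \<noteq> 0"
  show "lu_qi_keng N \<Omega>"
    unfolding lu_qi_keng_def
  proof (intro ballI)
    fix x w assume x: "x \<in> \<Omega>" and w: "w \<in> \<Omega>"
    obtain k where k: "reproduces_at N \<Omega> x k" "k w \<noteq> 0"
      using zeros_everywhere[OF x] w nz unfolding zeros_from_profile_def by blast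
    have "\<exists>l. reproduces_at N \<Omega> w l" using zeros_everywhere[OF w] unfolding zeros_from_profile_def by blast
    then have "reproduces_at N \<Omega> w (SOME l. reproduces_at N \<Omega> w l)" by (rule someI_ex)
    from reproducing_symmetric[OF k(1) this] k(2) show "bergman_kernel N \<Omega> x w \<noteq> 0"
      by (simp add: bergman_kernel_def)
  qed
qed

end

section \<open>Monotonicity\<close>

theorem theorem6:
  fixes \<mu> :: real and m0 :: "nat \<Rightarrow> nat"
  assumes "\<mu> > 0"
  shows "((\<forall>n\<ge>1. is_m0 \<mu> n (m0 n)) \<longrightarrow> (\<forall>n\<ge>1. m0 n \<le> m0 (n + 1))) \<and>
         (\<forall>n\<ge>1. \<forall>m\<ge>1. \<not> lu_qi_keng (n + m) (D \<mu> n m) \<longrightarrow>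
                        \<not> lu_qi_keng ((n + 1) + m) (D \<mu> (n + 1) m))"
proof -
  have step: "\<not> lu_qi_keng ((n + 1) + m) (D \<mu> (n + 1) m)"
    if m: "m \<ge> 1" and zero: "\<not> lu_qi_keng (n + m) (D \<mu> n m)" for n m
  proof -
    interpret A: fock_bargmann_hartogs \<mu> n m using assms m by unfold_locales
    interpret B: fock_bargmann_hartogs \<mu> "n + 1" m using assms m by unfold_locales
    obtain t where "cmod t < 1" "profile n m t = 0" using zero unfolding A.lu_qi_keng_iff by blast
    from profile_zero_Suc[OF m this] show ?thesis unfolding B.lu_qi_keng_iff by auto
  qed
  moreover have "m0 n \<le> m0 (n + 1)" if m0: "\<forall>n\<ge>1. is_m0 \<mu> n (m0 n)" and n: "n \<ge> 1" for n
  proof -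
    have "is_m0 \<mu> n (m0 n)" "is_m0 \<mu> (n + 1) (m0 (n + 1))" using m0 n by auto
    then show ?thesis using step[of "m0 (n + 1)" n] unfolding is_m0_def by blast
  qed
  ultimately show ?thesis by blast
qed

end
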